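(* Let $\Lambda\subseteq\mathbb{R}$ be uniformly discrete with separation constant $\delta(\Lambda)$. If $\Lambda$ is the zero set of a sine-type function $F_\Lambda$ with width of diagram equal to $2\pi$, then $E(\Lambda)$ is a Riesz basis in $L^2[0,1]$ with lower Riesz basis bound satisfying $$A(\Lambda)\geq\frac{1}{7\delta(\Lambda)}\,\frac{m}{M}\,e^{-\frac{8\pi y}{\delta(\Lambda)}},$$ where $y,m,M>0$ are such that $m\leq|F_\Lambda(x+iy)|^2\leq M$ for all $x\in\mathbb{R}$.
   Context: A sequence $\Lambda\subseteq\mathbb{R}$ is uniformly discrete if there is $\delta>0$ with $|\lambda-\lambda'|\geq\delta$ for all distinct $\lambda,\lambda'\in\Lambda$; the largest such $\delta$ is the separation constant $\delta(\Lambda)$. $E(\Lambda)=\{e^{2\pi i\lambda t}\}_{\lambda\in\Lambda}$. A system $\{\phi_n\}$ in a Hilbert space is a Riesz basis if it is complete and there are $A,B>0$ with $A\sum|a_n|^2\leq\|\sum a_n\phi_n\|^2\leq B\sum|a_n|^2$ for all finite sequences $\{a_n\}$; the largest such $A$ is the lower Riesz basis bound, denoted $A(\Lambda)$ when the system is $E(\Lambda)$ in $L^2[0,1]$. $\Lambda$ is the zero set of a sine-type function $F_\Lambda$ (real zeros) with width of diagram equal to $2\pi$ means: the limit $\lim_{R\to\infty}\prod_{\lambda\in\Lambda,|\lambda|<R}(1-z/\lambda)$ converges (if $0\in\Lambda$ the corresponding factor is replaced by $z$), and the function $$F_\Lambda(z)=e^{\pi iz}\lim_{R\to\infty}\prod_{\lambda\in\Lambda,\,|\lambda|<R}\Big(1-\frac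 z\lambda\Big)$$ is entire of exponential type $2\pi$, satisfies $\int_{\mathbb{R}}\frac{|F_\Lambda(x)|^2}{1+x^2}dx<\infty$, $$\limsup_{t\to\infty}\frac{\log|F_\Lambda(it)|}{t}=0,\qquad \limsup_{t\to\infty}\frac{\log|F_\Lambda(-it)|}{t}=2\pi,$$ and there exist $y>0$ and constants $m,M>0$ such that $m\leq|F_\Lambda(x+iy)|^2\leq M$ for all $x\in\mathbb{R}$. *)

theory Defs
  imports "HOL-Analysis.Analysis"
begin

section \<open>Separation constant\<close>

text \<open>
  A one-point or empty set has no largest separation, so the value is only meaningful
  for sets with at least two points. Uniform discreteness itself is the library's
  \<^const>\<open>uniform_discrete\<close>.
\<close>

definition separation_constant :: "real set \<Rightarrow> real" where
  "separation_constant \<Lambda> =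
     (GREATEST \<delta>. 0 < \<delta> \<and> (\<forall>\<mu>\<in>\<Lambda>. \<forall>\<nu>\<in>\<Lambda>. \<mu> \<noteq> \<nu> \<longrightarrow> \<delta> \<le> \<bar>\<mu> - \<nu>\<bar>))"

section \<open>Riesz bases in \<open>L\<^sup>2\<close>\<close>

text \<open>
  Elements of the Hilbert space \<open>L\<^sup>2(M)\<close> are handled through representatives, that is,
  complex-valued measurable functions with integrable squared modulus. The functional
  \<open>L2_norm M\<close> is then a seminorm whose kernel consists of the functions vanishing
  almost everywhere.
\<close>

definition L2_space :: "'a measure \<Rightarrow> ('a \<Rightarrow> complex) set" where
  "L2_space M = {f. f \<in> borel_measurable M \<and> integrable M (\<lambda>x. (cmod (f x))\<^sup>2)}"

definition L2_norm :: "'a measure \<Rightarrow> ('a \<Rightarrow> complex) \<Rightarrow> real" where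
  "L2_norm M f = sqrt (LINT x|M. (cmod (f x))\<^sup>2)"

text \<open>Completeness of a system: its finite linear combinations are dense.\<close>

definition complete_system ::
    "'a measure \<Rightarrow> 'i set \<Rightarrow> ('i \<Rightarrow> 'a \<Rightarrow> complex) \<Rightarrow> bool" where
  "complete_system M I \<phi> \<longleftrightarrow>
     (\<forall>f\<in>L2_space M. \<forall>\<epsilon>>0. \<exists>S a. finite S \<and> S \<subseteq> I \<and>
        L2_norm M (\<lambda>x. f x - (\<Sum>n\<in>S. a n * \<phi> n x)) < \<epsilon>)"

definition lower_riesz_inequality ::
    "'a measure \<Rightarrow> 'i set \<Rightarrow> ('i \<Rightarrow> 'a \<Rightarrow> complex) \<Rightarrow> real \<Rightarrow> bool" where
  "lower_riesz_inequality M I \<phi> A \<longleftrightarrow>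
     (\<forall>S a. finite S \<longrightarrow> S \<subseteq> I \<longrightarrow>
        A * (\<Sum>n\<in>S. (cmod (a n))\<^sup>2) \<le> (L2_norm M (\<lambda>x. \<Sum>n\<in>S. a n * \<phi> n x))\<^sup>2)"

definition upper_riesz_inequality ::
    "'a measure \<Rightarrow> 'i set \<Rightarrow> ('i \<Rightarrow> 'a \<Rightarrow> complex) \<Rightarrow> real \<Rightarrow> bool" where
  "upper_riesz_inequality M I \<phi> B \<longleftrightarrow>
     (\<forall>S a. finite S \<longrightarrow> S \<subseteq> I \<longrightarrow>
        (L2_norm M (\<lambda>x. \<Sum>n\<in>S. a n * \<phi> n x))\<^sup>2 \<le> B * (\<Sum>n\<in>S. (cmod (a n))\<^sup>2))"

definition riesz_basis ::
    "'a measure \<Rightarrow> 'i set \<Rightarrow> ('i \<Rightarrow> 'a \<Rightarrow> complex) \<Rightarrow> bool" where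
  "riesz_basis M I \<phi> \<longleftrightarrow>
     (\<forall>n\<in>I. \<phi> n \<in> L2_space M) \<and>
     complete_system M I \<phi> \<and>
     (\<exists>A>0. \<exists>B>0. lower_riesz_inequality M I \<phi> A \<and> upper_riesz_inequality M I \<phi> B)"

definition lower_riesz_bound ::
    "'a measure \<Rightarrow> 'i set \<Rightarrow> ('i \<Rightarrow> 'a \<Rightarrow> complex) \<Rightarrow> real" where
  "lower_riesz_bound M I \<phi> = (GREATEST A. 0 < A \<and> lower_riesz_inequality M I \<phi> A)"

text \<open>The system \<open>E(\<Lambda>)\<close> is the family \<open>exponential\<close> indexed by the set \<open>\<Lambda>\<close>.\<close>

definition exponential :: "real \<Rightarrow> real \<Rightarrow> complex" where
  "exponential \<mu> t = exp (2 * of_real pi * \<i> * of_real \<mu> * of_real t)"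

section \<open>Sine-type functions with real zeros\<close>

definition partial_zero_product :: "real set \<Rightarrow> complex \<Rightarrow> real \<Rightarrow> complex" where
  "partial_zero_product \<Lambda> z R =
     (\<Prod>\<mu>\<in>{\<mu>\<in>\<Lambda>. \<bar>\<mu>\<bar> < R}. if \<mu> = 0 then z else 1 - z / of_real \<mu>)"

definition sine_fun :: "real set \<Rightarrow> complex \<Rightarrow> complex" where
  "sine_fun \<Lambda> z = exp (of_real pi * \<i> * z) * Lim at_top (partial_zero_product \<Lambda> z)"

definition exponential_type :: "(complex \<Rightarrow> complex) \<Rightarrow> real \<Rightarrow> bool" where
  "exponential_type f \<sigma> \<longleftrightarrow>
     (\<forall>\<epsilon>>0. \<exists>C. \<forall>z. cmod (f z) \<le> C * exp ((\<sigma> + \<epsilon>) * cmod z))"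

definition bounded_on_line ::
    "(complex \<Rightarrow> complex) \<Rightarrow> real \<Rightarrow> real \<Rightarrow> real \<Rightarrow> bool" where
  "bounded_on_line f y m M \<longleftrightarrow>
     (\<forall>x::real. m \<le> (cmod (f (Complex x y)))\<^sup>2 \<and> (cmod (f (Complex x y)))\<^sup>2 \<le> M)"

text \<open>
  The type is required to be at most \<open>2\<pi>\<close>; equality then follows from the growth along the
  negative imaginary axis. For uniformly discrete \<open>\<Lambda>\<close>, convergence of the product at every
  point already forces the zeros of \<^term>\<open>sine_fun \<Lambda>\<close> to be exactly the points of \<open>\<Lambda>\<close>.
  In particular the logarithms below have nonzero arguments for all \<open>t > 0\<close>.
\<close>

definition sine_type_zero_set :: "real set \<Rightarrow> bool" where
  "sine_type_zero_set \<Lambda> \<longleftrightarrow>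
     (\<forall>z. \<exists>l. (partial_zero_product \<Lambda> z \<longlongrightarrow> l) at_top) \<and>
     sine_fun \<Lambda> holomorphic_on UNIV \<and>
     exponential_type (sine_fun \<Lambda>) (2 * pi) \<and>
     integrable lborel (\<lambda>x::real. (cmod (sine_fun \<Lambda> (of_real x)))\<^sup>2 / (1 + x\<^sup>2)) \<and>
     Limsup at_top (\<lambda>t::real. ereal (ln (cmod (sine_fun \<Lambda> (\<i> * of_real t))) / t)) = 0 \<and>
     Limsup at_top (\<lambda>t::real. ereal (ln (cmod (sine_fun \<Lambda> (- \<i> * of_real t))) / t))
       = ereal (2 * pi) \<and>
     (\<exists>y>0. \<exists>m>0. \<exists>M>0. bounded_on_line (sine_fun \<Lambda>) y m M)"

end

theory Submission
  imports Defs "HOL-Complex_Analysis.Complex_Analysis" "HOL-Probability.Sinc_Integral"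
    "HOL-Real_Asymp.Real_Asymp"
begin

text \<open>
  Write \<open>F\<close> for the sine-type function and \<open>d\<close> for a separation of its zero set \<open>\<Lambda>\<close>. Since
  the zeros are real and enter symmetrically, \<open>|F|\<close> is a finite-product limit whose values at two
  points can be compared factor by factor. This gives monotonicity of \<open>|F(x+it)| exp(\<pi>t)\<close> in \<open>t > 0\<close>,
  the symmetry between the two half-planes, the fact that the zeros are exactly \<open>\<Lambda>\<close> and simple,
  and, through a comparison with the product formula of the sine, the bound
  \<open>|F'(\<mu>)| \<ge> \<surd>m exp(\<pi>y - \<pi>y/d) / y\<close> at each zero (\<open>F_deriv_lower_bound\<close>).

  The bounds \<open>m \<le> |F|\<^sup>2 \<le> M\<close> on the single line at height \<open>y\<close> persist above it. The upper one is the
  Phragmen-Lindelof principle, because \<open>F\<close> has indicator 0 in the direction \<open>i\<close> (\<open>F_upper_bound\<close>).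
  For the lower one the principle is applied to \<open>1/F\<close>, which needs \<open>log |F(it)|\<close> to be
  \<open>o(t)\<close> from below, whereas the hypothesis only controls an upper limit. Harnack's inequality closes
  this gap: \<open>v = - log |F|\<close>, up to an additive constant, is positive and harmonic, so \<open>v(it)/t\<close> is
  decreasing, and a lower limit of zero is a limit (\<open>F_lower_bound\<close>).

  For the lower Riesz inequality, let \<open>h = \<Sum> a\<^sub>\<mu> e\<^sub>\<mu>\<close> be a finite exponential sum on \<open>[0,1]\<close> with Laplace
  transform \<open>H\<close>, and let \<open>\<Phi>\<close> be the Lagrange interpolation of the conjugates of the \<open>a\<^sub>\<mu>\<close>,
  a combination of the functions \<open>F(z) / (F'(\<mu>)(z - \<mu>))\<close>. By residues, \<open>\<Sum> |a\<^sub>\<mu>|\<^sup>2\<close> is the integral of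
  \<open>\<Phi>H\<close> over the line at height \<open>y\<close> (\<open>reproducing_formula\<close>). On this line \<open>H\<close> is controlled by \<open>h\<close> through
  Plancherel's identity, and \<open>\<Phi>\<close> is \<open>F\<close>, which is at most \<open>\<surd>M\<close>, times a sum of Cauchy kernels, whose norm
  Schur's test bounds in terms of the separation (\<open>Cauchy_kernel_sum_le\<close>). The inequality between
  arithmetic and geometric means then gives the claimed constant; it uses \<open>d \<le> 1\<close>, which
  holds because zeros of larger separation could not produce growth of type \<open>\<pi>\<close>
  (\<open>separation_le_one\<close>). The upper Riesz inequality follows from the same Cauchy kernel bound.

  For completeness, every exponential is expanded over the zeros: the residues of
  \<open>z \<mapsto> F(w) e\<^sub>z(t) / (F(z) (z - w))\<close> are \<open>e\<^sub>w(t)\<close> at \<open>w\<close> and multiples of \<open>e\<^sub>\<mu>(t)\<close> at the zeros, and its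
  integral over growing rectangles tends to 0 in \<open>L\<^sup>2[0,1]\<close> by the lower bounds for \<open>F\<close>
  (\<open>exponential_in_span\<close>). All exponentials together span a dense subspace by the Stone-Weierstrass
  theorem.
\<close>

section \<open>Sums and products over separated sets\<close>

definition separated :: "real \<Rightarrow> real set \<Rightarrow> bool" where
  "separated d S \<longleftrightarrow> (\<forall>\<mu>\<in>S. \<forall>\<nu>\<in>S. \<mu> \<noteq> \<nu> \<longrightarrow> d \<le> \<bar>\<mu> - \<nu>\<bar>)"

lemma separatedD: "separated d S \<Longrightarrow> \<mu> \<in> S \<Longrightarrow> \<nu> \<in> S \<Longrightarrow> \<mu> \<noteq> \<nu> \<Longrightarrow> d \<le> \<bar>\<mu> - \<nu>\<bar>"
  by (simp add: separated_def)

lemma separated_mono: "separated d S \<Longrightarrow> e \<le> d \<Longrightarrow> separated e S"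
  unfolding separated_def by (meson order_trans)

lemma separated_subset: "separated d S \<Longrightarrow> T \<subseteq> S \<Longrightarrow> separated d T"
  unfolding separated_def by blast

lemma finite_separated_bounded:
  assumes "separated d S" "0 < d"
  shows "finite {\<mu>\<in>S. \<bar>\<mu>\<bar> < R}"
proof -
  have "uniform_discrete S"
    using assms by (intro uniformI2[of d]) (auto simp: separated_def dist_real_def)
  then have "uniform_discrete {\<mu>\<in>S. \<bar>\<mu>\<bar> < R}" by (rule uniform_discrete_subset) auto
  moreover have "bounded {\<mu>\<in>S. \<bar>\<mu>\<bar> < R}" by (auto simp: bounded_iff intro!: exI[of _ R])
  ultimately show ?thesis using uniform_discrete_finite_iff by blast
qed

text \<open>
  The index \<open>\<lfloor>(\<mu> - x) / d\<rfloor>\<close> is injective because two points with the same index would be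
  closer than \<open>d\<close>. Comparing each point with \<open>x + kd\<close> turns sums over an arbitrary separated set into
  sums over an arithmetic progression.
\<close>

lemma separated_one_side_index:
  fixes S :: "real set"
  assumes "finite S" "0 < d" "separated d S" "\<And>\<mu>. \<mu> \<in> S \<Longrightarrow> d \<le> \<mu> - x"
  obtains k n where "inj_on k S" "k ` S \<subseteq> {1..n::nat}" "\<And>\<mu>. \<mu> \<in> S \<Longrightarrow> d * real (k \<mu>) \<le> \<mu> - x"
proof -
  define k where "k \<mu> = nat \<lfloor>(\<mu> - x) / d\<rfloor>" for \<mu>
  have ge1: "1 \<le> (\<mu> - x) / d" if "\<mu> \<in> S" for \<mu> using assms(4)[OF that] \<open>0 < d\<close> by simp
  have k: "real (k \<mu>) \<le> (\<mu> - x) / d" "(\<mu> - x) / d < real (k \<mu>) + 1" "1 \<le> k \<mu>" if "\<mu> \<in> S" for \<mu>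
  proof -
    have "0 \<le> \<lfloor>(\<mu> - x) / d\<rfloor>" "1 \<le> \<lfloor>(\<mu> - x) / d\<rfloor>" using ge1[OF that] by linarith+
    then show "real (k \<mu>) \<le> (\<mu> - x) / d" "(\<mu> - x) / d < real (k \<mu>) + 1" "1 \<le> k \<mu>"
      unfolding k_def by (simp_all del: one_le_floor add: le_nat_iff)
  qed
  have "inj_on k S"
  proof (rule inj_onI, rule ccontr)
    fix \<mu> \<nu> assume *: "\<mu> \<in> S" "\<nu> \<in> S" "k \<mu> = k \<nu>" "\<mu> \<noteq> \<nu>"
    have "\<bar>(\<mu> - x) / d - (\<nu> - x) / d\<bar> < 1" using k[OF *(1)] k[OF *(2)] *(3) by linarith
    then have "\<bar>\<mu> - \<nu>\<bar> < d" using \<open>0 < d\<close> by (simp add: diff_divide_distrib[symmetric] divide_less_eq)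
    moreover have "d \<le> \<bar>\<mu> - \<nu>\<bar>" using assms(3) * unfolding separated_def by blast
    ultimately show False by linarith
  qed
  moreover have "k ` S \<subseteq> {1..Max (insert 0 (k ` S))}" using k(3) \<open>finite S\<close> by auto
  moreover have "d * real (k \<mu>) \<le> \<mu> - x" if "\<mu> \<in> S" for \<mu>
    using k(1)[OF that] \<open>0 < d\<close> by (simp add: field_simps)
  ultimately show ?thesis using that by blast
qed

lemma sum_separated_one_side_le:
  fixes S :: "real set" and f :: "real \<Rightarrow> real"
  assumes "finite S" "0 < d" "separated d S" "\<And>\<mu>. \<mu> \<in> S \<Longrightarrow> d \<le> \<mu> - x"
    and mono: "\<And>s t. 0 < s \<Longrightarrow> s \<le> t \<Longrightarrow> f t \<le> f s" and pos: "\<And>t. 0 < t \<Longrightarrow> 0 \<le> f t"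
    and bound: "\<And>n. (\<Sum>k=1..n. f (d * real k)) \<le> B"
  shows "(\<Sum>\<mu>\<in>S. f (\<mu> - x)) \<le> B"
proof -
  obtain k n where k: "inj_on k S" "k ` S \<subseteq> {1..n::nat}" "\<And>\<mu>. \<mu> \<in> S \<Longrightarrow> d * real (k \<mu>) \<le> \<mu> - x"
    using separated_one_side_index[OF assms(1-4)] by blast
  have "(\<Sum>\<mu>\<in>S. f (\<mu> - x)) \<le> (\<Sum>\<mu>\<in>S. f (d * real (k \<mu>)))"
    using k \<open>0 < d\<close> by (intro sum_mono mono) (auto simp: image_subset_iff Suc_le_eq)
  also have "\<dots> = (\<Sum>j\<in>k ` S. f (d * real j))"
    using k(1) by (simp add: sum.reindex)
  also have "\<dots> \<le> (\<Sum>j=1..n. f (d * real j))"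
    using k(2) \<open>0 < d\<close> by (intro sum_mono2 pos) auto
  also have "\<dots> \<le> B" by (rule bound)
  finally show ?thesis .
qed

lemma sum_separated_le:
  fixes S :: "real set" and f :: "real \<Rightarrow> real"
  assumes "finite S" "0 < d" "separated d S" "\<And>\<mu>. \<mu> \<in> S \<Longrightarrow> d \<le> \<bar>\<mu> - x\<bar>"
    and mono: "\<And>s t. 0 < s \<Longrightarrow> s \<le> t \<Longrightarrow> f t \<le> f s" and pos: "\<And>t. 0 < t \<Longrightarrow> 0 \<le> f t"
    and bound: "\<And>n. (\<Sum>k=1..n. f (d * real k)) \<le> B"
  shows "(\<Sum>\<mu>\<in>S. f \<bar>\<mu> - x\<bar>) \<le> 2 * B"
proof -
  let ?P = "{\<mu>\<in>S. x < \<mu>}" and ?N = "{\<mu>\<in>S. \<mu> < x}"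
  have S: "S = ?P \<union> ?N"   proof -
    have "x \<notin> S" using assms(2) assms(4)[of x] by auto
    then show ?thesis using less_linear[of x] by blast
  qed
  have "(\<Sum>\<mu>\<in>?P. f \<bar>\<mu> - x\<bar>) = (\<Sum>\<mu>\<in>?P. f (\<mu> - x))" by (intro sum.cong) auto
  also have "\<dots> \<le> B"
    by (rule sum_separated_one_side_le[OF _ \<open>0 < d\<close> _ _ mono pos bound])
       (use assms in \<open>force simp: separated_def\<close>)+
  finally have P: "(\<Sum>\<mu>\<in>?P. f \<bar>\<mu> - x\<bar>) \<le> B" .
  have "(\<Sum>\<mu>\<in>?N. f \<bar>\<mu> - x\<bar>) = (\<Sum>\<mu>\<in>uminus ` ?N. f (\<mu> - (- x)))"
    by (subst sum.reindex) (auto intro!: sum.cong)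
  also have "\<dots> \<le> B"
    by (rule sum_separated_one_side_le[OF _ \<open>0 < d\<close> _ _ mono pos bound])
       (use assms in \<open>force simp: separated_def\<close>)+
  finally have N: "(\<Sum>\<mu>\<in>?N. f \<bar>\<mu> - x\<bar>) \<le> B" .
  have "(\<Sum>\<mu>\<in>S. f \<bar>\<mu> - x\<bar>) = (\<Sum>\<mu>\<in>?P. f \<bar>\<mu> - x\<bar>) + (\<Sum>\<mu>\<in>?N. f \<bar>\<mu> - x\<bar>)"
    by (subst S, rule sum.union_disjoint) (use \<open>finite S\<close> in auto)
  then show ?thesis using P N by simp
qed

text \<open>
  The product increases to \<open>sinh (\<pi>q) / (\<pi>q)\<close>, which is the product formula of the sine at the point \<open>iq\<close>,
  and \<open>sinh x \<le> x exp(x)\<close>.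
\<close>

lemma prod_one_plus_square_le_exp:
  assumes "0 \<le> q"
  shows "(\<Prod>k=1..n. 1 + q\<^sup>2 / (real k)\<^sup>2) \<le> exp (pi * q)"
proof (cases "q = 0")
  case False
  then have q: "0 < q" using assms by simp
  let ?p = "\<lambda>n. \<Prod>k=1..n. 1 + q\<^sup>2 / (real k)\<^sup>2"
  have "(\<lambda>n. of_real pi * (\<i> * of_real q) * (\<Prod>k=1..n. 1 - (\<i> * of_real q)^2 / of_nat k^2))
      \<longlonglongrightarrow> sin (of_real pi * (\<i> * of_real q))"
    by (rule sin_product_formula_complex)
  then have "(\<lambda>n. cmod (of_real pi * (\<i> * of_real q) * (\<Prod>k=1..n. 1 - (\<i> * of_real q)^2 / of_nat k^2)))
      \<longlonglongrightarrow> cmod (sin (of_real pi * (\<i> * of_real q)))"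
    by (rule tendsto_norm)
  also have "(\<lambda>n. cmod (of_real pi * (\<i> * of_real q) * (\<Prod>k=1..n. 1 - (\<i> * of_real q)^2 / of_nat k^2)))
      = (\<lambda>n. pi * q * ?p n)"
  proof
    fix n
    have "1 - (\<i> * of_real q)^2 / of_nat k^2 = complex_of_real (1 + q\<^sup>2 / (real k)\<^sup>2)" for k
      by (simp add: power_mult_distrib)
    then have "(\<Prod>k=1..n. 1 - (\<i> * of_real q)^2 / of_nat k^2) = complex_of_real (?p n)"
      unfolding of_real_prod by (intro prod.cong refl)
    moreover have "0 \<le> ?p n" by (intro prod_nonneg) auto
    ultimately show "cmod (of_real pi * (\<i> * of_real q) * (\<Prod>k=1..n. 1 - (\<i> * of_real q)^2 / of_nat k^2)) = pi * q * ?p n"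
      using q by (simp only: norm_mult norm_of_real) simp
  qed
  also have "cmod (sin (of_real pi * (\<i> * of_real q))) = sinh (pi * q)"
  proof -
    have "sin (of_real pi * (\<i> * of_real q)) = \<i> * sinh (complex_of_real (pi * q))"
      by (simp add: sin_i_times mult.left_commute sinh_field_def exp_minus)
    moreover have "0 \<le> sinh (pi * q)" using q by simp
    moreover have "sinh (complex_of_real (pi * q)) = complex_of_real (sinh (pi * q))"
      by (simp only: sinh_field_def exp_of_real of_real_minus[symmetric] of_real_diff[symmetric]) simp
    ultimately show ?thesis by (simp only: norm_mult norm_of_real) simp
  qed
  finally have "(\<lambda>n. pi * q * ?p n) \<longlonglongrightarrow> sinh (pi * q)" .
  moreover have "incseq (\<lambda>n. pi * q * ?p n)"
  proof (intro incseq_SucI mult_left_mono)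
    fix n
    have "0 \<le> ?p n" by (intro prod_nonneg) auto
    then have "?p n * 1 \<le> ?p n * (1 + q\<^sup>2 / (real (Suc n))\<^sup>2)" by (intro mult_left_mono) auto
    then show "?p n \<le> ?p (Suc n)" by simp
  qed (use q in auto)
  ultimately have "pi * q * ?p n \<le> sinh (pi * q)" by (rule incseq_le[rotated])
  also have "\<dots> \<le> pi * q * exp (pi * q)"
  proof -
    have "1 - exp (- 2 * (pi * q)) \<le> 2 * (pi * q)" using exp_ge_add_one_self[of "- 2 * (pi * q)"] by linarith
    then have "(1 - exp (- 2 * (pi * q))) * exp (pi * q) \<le> 2 * (pi * q) * exp (pi * q)"
      by (intro mult_right_mono) auto
    moreover have "exp (- 2 * (pi * q)) * exp (pi * q) = exp (- (pi * q))"
      by (simp flip: exp_add)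
    ultimately show ?thesis by (simp add: sinh_def algebra_simps)
  qed
  finally show ?thesis using q by simp
qed auto

text \<open>
  The logarithm of a factor decreases with the distance from \<open>x\<close>, so both sides of \<open>x\<close> are dominated by
  the progression with step \<open>d\<close>; the square accounts for the two sides.
\<close>

lemma prod_separated_le_exp:
  fixes S :: "real set"
  assumes "finite S" "0 < d" "separated d S" "\<And>\<mu>. \<mu> \<in> S \<Longrightarrow> d \<le> \<bar>\<mu> - x\<bar>" and "0 \<le> Y"
  shows "(\<Prod>\<mu>\<in>S. 1 + Y\<^sup>2 / (\<mu> - x)\<^sup>2) \<le> (exp (pi * Y / d))\<^sup>2"
proof -
  define f where "f t = ln (1 + Y\<^sup>2 / t\<^sup>2)" for t
  have pos: "0 < 1 + Y\<^sup>2 / t\<^sup>2" for t by (rule add_pos_nonneg) auto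
  have "(\<Sum>\<mu>\<in>S. f \<bar>\<mu> - x\<bar>) \<le> 2 * (pi * Y / d)"
  proof (rule sum_separated_le[OF assms(1-4)])
    show "f t \<le> f s" if "0 < s" "s \<le> t" for s t
    proof -
      have "Y\<^sup>2 / t\<^sup>2 \<le> Y\<^sup>2 / s\<^sup>2" using that by (intro divide_left_mono power_mono) auto
      then show ?thesis unfolding f_def using pos by (subst ln_le_cancel_iff) auto
    qed
    show "0 \<le> f t" for t unfolding f_def by (intro ln_ge_zero) auto
    show "(\<Sum>k = 1..n. f (d * real k)) \<le> pi * Y / d" for n
    proof -
      have "(\<Sum>k = 1..n. f (d * real k)) = ln (\<Prod>k=1..n. 1 + (Y/d)\<^sup>2 / (real k)\<^sup>2)"
      proof (subst ln_prod)
        show "(\<Sum>k = 1..n. f (d * real k)) = (\<Sum>k=1..n. ln (1 + (Y/d)\<^sup>2 / (real k)\<^sup>2))"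
          by (simp add: f_def power_divide power_mult_distrib)
      next
        have "0 < 1 + (Y/d)\<^sup>2 / t\<^sup>2" for t by (rule add_pos_nonneg) auto
        then show "1 + (Y/d)\<^sup>2 / (real i)\<^sup>2 \<noteq> 0" for i by (metis less_irrefl)
      qed auto
      also have "\<dots> \<le> ln (exp (pi * (Y / d)))"
        using prod_one_plus_square_le_exp[of "Y/d" n] assms(2,5)
        by (subst ln_le_cancel_iff) (auto intro!: prod_pos add_pos_nonneg)
      finally show ?thesis by simp
    qed
  qed
  moreover have "(\<Sum>\<mu>\<in>S. f \<bar>\<mu> - x\<bar>) = ln (\<Prod>\<mu>\<in>S. 1 + Y\<^sup>2 / (\<mu> - x)\<^sup>2)"
  proof (subst ln_prod)
    show "1 + Y\<^sup>2 / (\<mu> - x)\<^sup>2 \<noteq> 0" for \<mu> using pos by (metis less_irrefl)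
  qed (simp_all add: f_def assms(1))
  ultimately have "ln (\<Prod>\<mu>\<in>S. 1 + Y\<^sup>2 / (\<mu> - x)\<^sup>2) \<le> 2 * (pi * Y / d)" by simp
  then have "(\<Prod>\<mu>\<in>S. 1 + Y\<^sup>2 / (\<mu> - x)\<^sup>2) \<le> exp (2 * (pi * Y / d))"
  proof -
    have "0 < (\<Prod>\<mu>\<in>S. 1 + Y\<^sup>2 / (\<mu> - x)\<^sup>2)" using pos by (intro prod_pos) auto
    then show ?thesis using \<open>ln _ \<le> _\<close> by (metis exp_le_cancel_iff exp_ln)
  qed
  then show ?thesis by (simp only: exp_double)
qed

lemma sum_inverse_squares_le_2: "(\<Sum>k=1..n. 1 / (real k)\<^sup>2) \<le> 2"
proof -
  have "(\<Sum>k=1..Suc n. 1 / (real k)\<^sup>2) \<le> 2 - 1 / real (Suc n)" for n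
  proof (induction n)
    case (Suc n)
    have "1 / (real (Suc (Suc n)))\<^sup>2 \<le> 1 / real (Suc n) - 1 / real (Suc (Suc n))"
    proof -
      have "1 / real (Suc n) - 1 / real (Suc (Suc n)) = 1 / (real (Suc n) * real (Suc (Suc n)))"
        by (simp add: field_simps)
      then show ?thesis
        by (simp only: power2_eq_square) (intro divide_left_mono mult_right_mono, auto)
    qed
    with Suc show ?case by simp
  qed auto
  then have "(\<Sum>k=1..Suc n. 1 / (real k)\<^sup>2) \<le> 2" for n
    by (smt (verit) divide_nonneg_nonneg of_nat_0_le_iff)
  then show ?thesis by (cases n) auto
qed

text \<open>
  The kernel is positive and symmetric, so the inequality between the arithmetic and the geometric mean
  bounds the form by its largest row sum. The diagonal contributes \<open>2\<pi>/y\<close>, and the rest is dominated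
  by two copies of \<open>\<Sum> 8\<pi>y/(kd)\<^sup>2\<close>.
\<close>

lemma Schur_test_separated:
  fixes S :: "real set" and c :: "real \<Rightarrow> complex"
  assumes "finite S" "0 < d" "separated d S" "0 < y"
  shows "Re (\<Sum>\<nu>\<in>S. \<Sum>\<mu>\<in>S. c \<nu> * cnj (c \<mu>) * of_real (8 * pi * y / (4 * y\<^sup>2 + (\<mu> - \<nu>)\<^sup>2)))
    \<le> 2 * pi * (1 / y + 16 * y / d\<^sup>2) * (\<Sum>\<nu>\<in>S. (cmod (c \<nu>))\<^sup>2)"
proof -
  define k where "k t = 8 * pi * y / (4 * y\<^sup>2 + t\<^sup>2)" for t
  define B where "B = 2 * pi * (1 / y + 16 * y / d\<^sup>2)"
  have den: "0 < 4 * y\<^sup>2 + t\<^sup>2" for t using \<open>0 < y\<close> by (simp add: add_pos_nonneg)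
  have kpos: "0 \<le> k t" for t unfolding k_def using \<open>0 < y\<close> den by (simp add: less_imp_le)
  have ksym: "k (\<mu> - \<nu>) = k (\<nu> - \<mu>)" for \<mu> \<nu> by (simp add: k_def power2_commute)
  have row: "(\<Sum>\<mu>\<in>S. k (\<mu> - \<nu>)) \<le> B" if "\<nu> \<in> S" for \<nu>
  proof -
    have "(\<Sum>\<mu>\<in>S - {\<nu>}. k \<bar>\<mu> - \<nu>\<bar>) \<le> 2 * (16 * pi * y / d\<^sup>2)"
    proof (rule sum_separated_le[where d = d])
      show "k t \<le> k s" if "0 < s" "s \<le> t" for s t
        unfolding k_def using that \<open>0 < y\<close> den by (intro divide_left_mono add_left_mono power_mono mult_pos_pos) auto
      show "(\<Sum>j = 1..n. k (d * real j)) \<le> 16 * pi * y / d\<^sup>2" for n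
      proof -
        have "k (d * real j) \<le> 8 * pi * y / d\<^sup>2 * (1 / (real j)\<^sup>2)" if "j \<in> {1..n}" for j
        proof -
          have "k (d * real j) \<le> 8 * pi * y / (d * real j)\<^sup>2"
            unfolding k_def using that \<open>0 < y\<close> \<open>0 < d\<close> den by (intro divide_left_mono mult_pos_pos) auto
          then show ?thesis by (simp add: power_mult_distrib)
        qed
        then have "(\<Sum>j = 1..n. k (d * real j)) \<le> (\<Sum>j=1..n. 8 * pi * y / d\<^sup>2 * (1 / (real j)\<^sup>2))"
          by (rule sum_mono)
        also have "\<dots> = 8 * pi * y / d\<^sup>2 * (\<Sum>j=1..n. 1 / (real j)\<^sup>2)" by (simp add: sum_distrib_left)
        also have "\<dots> \<le> 8 * pi * y / d\<^sup>2 * 2"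
          using sum_inverse_squares_le_2[of n] \<open>0 < y\<close> by (intro mult_left_mono) auto
        finally show ?thesis by simp
      qed
    qed (use assms that kpos in \<open>auto simp: separated_def\<close>)
    moreover have "(\<Sum>\<mu>\<in>S - {\<nu>}. k \<bar>\<mu> - \<nu>\<bar>) = (\<Sum>\<mu>\<in>S - {\<nu>}. k (\<mu> - \<nu>))"
      by (intro sum.cong) (auto simp: k_def)
    moreover have "(\<Sum>\<mu>\<in>S. k (\<mu> - \<nu>)) = k 0 + (\<Sum>\<mu>\<in>S - {\<nu>}. k (\<mu> - \<nu>))"
      using that assms(1) by (simp add: sum.remove)
    moreover have "k 0 = 2 * pi / y" using \<open>0 < y\<close> by (simp add: k_def power2_eq_square)
    ultimately show ?thesis by (simp add: B_def algebra_simps)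
  qed
  have "Re (\<Sum>\<nu>\<in>S. \<Sum>\<mu>\<in>S. c \<nu> * cnj (c \<mu>) * of_real (k (\<mu> - \<nu>)))
    \<le> (\<Sum>\<nu>\<in>S. \<Sum>\<mu>\<in>S. ((cmod (c \<nu>))\<^sup>2 / 2 + (cmod (c \<mu>))\<^sup>2 / 2) * k (\<mu> - \<nu>))"
  proof -
    have "Re (c \<nu> * cnj (c \<mu>) * of_real (k (\<mu> - \<nu>))) \<le> ((cmod (c \<nu>))\<^sup>2 / 2 + (cmod (c \<mu>))\<^sup>2 / 2) * k (\<mu> - \<nu>)" for \<nu> \<mu>
    proof -
      have "Re (c \<nu> * cnj (c \<mu>)) \<le> cmod (c \<nu>) * cmod (c \<mu>)"
        using complex_Re_le_cmod[of "c \<nu> * cnj (c \<mu>)"] by (simp add: norm_mult)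
      also have "\<dots> \<le> (cmod (c \<nu>))\<^sup>2 / 2 + (cmod (c \<mu>))\<^sup>2 / 2"
        using sum_squares_bound[of "cmod (c \<nu>)" "cmod (c \<mu>)"] by simp
      finally have "Re (c \<nu> * cnj (c \<mu>)) * k (\<mu> - \<nu>) \<le> ((cmod (c \<nu>))\<^sup>2 / 2 + (cmod (c \<mu>))\<^sup>2 / 2) * k (\<mu> - \<nu>)"
        by (rule mult_right_mono) (rule kpos)
      then show ?thesis by simp
    qed
    then show ?thesis unfolding Re_sum by (intro sum_mono)
  qed
  also have "\<dots> = (\<Sum>\<nu>\<in>S. (cmod (c \<nu>))\<^sup>2 / 2 * (\<Sum>\<mu>\<in>S. k (\<mu> - \<nu>)))
      + (\<Sum>\<mu>\<in>S. (cmod (c \<mu>))\<^sup>2 / 2 * (\<Sum>\<nu>\<in>S. k (\<nu> - \<mu>)))"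
  proof -
    have "(\<Sum>\<nu>\<in>S. \<Sum>\<mu>\<in>S. (cmod (c \<mu>))\<^sup>2 / 2 * k (\<mu> - \<nu>)) = (\<Sum>\<mu>\<in>S. (cmod (c \<mu>))\<^sup>2 / 2 * (\<Sum>\<nu>\<in>S. k (\<nu> - \<mu>)))"
      by (subst sum.swap) (simp add: sum_distrib_left ksym[of _ "_"])
    then show ?thesis by (simp only: distrib_right sum.distrib sum_distrib_left)
  qed
  also have "\<dots> = (\<Sum>\<nu>\<in>S. (cmod (c \<nu>))\<^sup>2 * (\<Sum>\<mu>\<in>S. k (\<mu> - \<nu>)))"
    by (simp add: mult.commute flip: sum.distrib)
  also have "\<dots> \<le> (\<Sum>\<nu>\<in>S. (cmod (c \<nu>))\<^sup>2 * B)"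
    by (intro sum_mono mult_left_mono row) auto
  also have "\<dots> = B * (\<Sum>\<nu>\<in>S. (cmod (c \<nu>))\<^sup>2)" by (simp add: sum_distrib_left mult.commute)
  finally show ?thesis unfolding k_def B_def .
qed

section \<open>Maximum principles in a half-plane\<close>

text \<open>
  Outside a large disc the bound is assumed, so the maximum principle only has to be applied to the part of
  \<open>S\<close> inside the disc.
\<close>

lemma maximum_modulus_unbounded:
  fixes f :: "complex \<Rightarrow> complex"
  assumes "closed S" and hol: "f holomorphic_on S"
    and frontier: "\<And>z. z \<in> frontier S \<Longrightarrow> cmod (f z) \<le> B"
    and far: "\<And>z. z \<in> S \<Longrightarrow> r \<le> cmod z \<Longrightarrow> cmod (f z) \<le> B"
    and "z \<in> S"
  shows "cmod (f z) \<le> B"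
proof -
  define \<rho> where "\<rho> = max r (cmod z) + 1"
  define T where "T = S \<inter> cball 0 \<rho>"
  have cT: "closed T" using \<open>closed S\<close> by (auto simp: T_def)
  have iT: "interior T = interior S \<inter> ball 0 \<rho>"
    by (simp add: T_def interior_cball)
  show ?thesis
  proof (rule maximum_modulus_frontier[where S = T and f = f and \<xi> = z])
    show "f holomorphic_on interior T"
      using hol by (rule holomorphic_on_subset) (use iT interior_subset in auto)
    show "continuous_on (closure T) f"
      using cT hol by (auto simp: T_def intro: continuous_on_subset holomorphic_on_imp_continuous_on)
    show "bounded T" by (simp add: T_def bounded_Int)
    show "z \<in> T" using \<open>z \<in> S\<close> by (auto simp: T_def \<rho>_def)
    fix w assume "w \<in> frontier T"
    then have w: "w \<in> T" "w \<notin> interior T" using cT by (auto simp: frontier_def)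
    show "cmod (f w) \<le> B"
    proof (cases "w \<in> interior S")
      case True
      then have "\<rho> \<le> cmod w" using w iT by (auto simp: T_def)
      then show ?thesis using far[of w] w by (auto simp: T_def \<rho>_def)
    next
      case False
      then have "w \<in> frontier S" using w closure_subset by (auto simp: frontier_def T_def)
      then show ?thesis by (rule frontier)
    qed
  qed
qed

text \<open>
  In the sector \<open>|arg w| \<le> \<pi>/4\<close> the argument of \<open>w\<close> to the power \<open>3/2\<close> is at most \<open>3\<pi>/8\<close>, so its real part is
  comparable to its modulus.
\<close>

lemma Re_three_halves_power:
  assumes "\<bar>Im w\<bar> \<le> Re w" "0 < Re w"
  shows "Re (w * csqrt w) \<ge> cmod w * sqrt (cmod w) / 10"
proof -
  define s where "s = csqrt w"
  have ws: "w = s\<^sup>2" by (simp add: s_def)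
  define p q where "p = Re s" and "q = Im s"
  have Rw: "Re w = p\<^sup>2 - q\<^sup>2" and Iw: "Im w = 2 * p * q"
    by (auto simp: ws p_def q_def power2_eq_square)
  have p0: "0 \<le> p" using csqrt_principal[of w] by (auto simp: s_def p_def)
  have ppos: "0 < p" using p0 Rw assms(2) by (cases "p = 0") auto
  have "2 * p * \<bar>q\<bar> \<le> p\<^sup>2 - q\<^sup>2" using assms(1) Rw Iw ppos by (simp add: abs_mult)
  then have "2 * p * \<bar>q\<bar> \<le> p\<^sup>2" using zero_le_power2[of q] by linarith
  then have "(2 * \<bar>q\<bar>) * p \<le> p * p" by (simp add: power2_eq_square mult_ac)
  then have q: "2 * \<bar>q\<bar> \<le> p" using ppos by (rule mult_right_le_imp_le)
  then have "(2 * \<bar>q\<bar>)\<^sup>2 \<le> p\<^sup>2" by (intro power_mono) auto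
  then have q2: "4 * q\<^sup>2 \<le> p\<^sup>2" by (simp add: power_mult_distrib)
  have cw: "cmod w = p\<^sup>2 + q\<^sup>2" by (simp add: ws norm_power cmod_power2 p_def q_def)
  have "cmod w \<le> (2 * p)\<^sup>2"   proof -
    have "q\<^sup>2 \<le> 3 * p\<^sup>2" using q2 zero_le_power2[of p] by linarith
    then show ?thesis by (simp add: cw power_mult_distrib)
  qed
  then have sq: "sqrt (cmod w) \<le> 2 * p" using ppos by (intro real_le_lsqrt) auto
  have "Re (w * csqrt w) = Re w * p - Im w * q" by (simp add: s_def p_def q_def)
  also have "\<dots> = p * (p\<^sup>2 - 3 * q\<^sup>2)"
    unfolding Rw Iw by (simp add: power2_eq_square algebra_simps)
  also have "\<dots> \<ge> p * (p\<^sup>2 / 4)" using q2 ppos by (intro mult_left_mono) auto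
  finally have 1: "Re (w * csqrt w) \<ge> p * (p\<^sup>2 / 4)" .
  have "cmod w * sqrt (cmod w) \<le> (5/4 * p\<^sup>2) * (2 * p)"
    using sq q2 by (intro mult_mono) (auto simp: cw)
  then show ?thesis using 1 by simp
qed

text \<open>
  A function of exponential type on a quadrant is damped by \<open>exp (- \<epsilon> w \<surd>w)\<close>: the order \<open>3/2\<close> exceeds the order
  1 of the function, and it is below 2, so that the damping factor is still at most 1 in modulus on the
  whole quadrant. The damped function obeys the maximum principle, and \<open>\<epsilon>\<close> is then sent to 0.
\<close>

lemma phragmen_lindelof_quadrant:
  fixes f :: "complex \<Rightarrow> complex"
  defines "Q \<equiv> {z. 0 \<le> Re z \<and> 0 \<le> Im z}"
  assumes hol: "f holomorphic_on Q"
    and growth: "\<And>z. z \<in> Q \<Longrightarrow> cmod (f z) \<le> C * exp (C * cmod z)"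
    and "0 < K"
    and real: "\<And>x. 0 \<le> x \<Longrightarrow> cmod (f (of_real x)) \<le> K"
    and imag: "\<And>t. 0 \<le> t \<Longrightarrow> cmod (f (\<i> * of_real t)) \<le> K"
    and "z \<in> Q"
  shows "cmod (f z) \<le> K"
proof -
  \<comment> \<open>The rotation by \<open>-\<pi>/4\<close> centres the quadrant on the positive axis; the shift by 1 keeps it away from the branch point of the square root.\<close>
  define w where "w z = (1 - \<i>) * z + 1" for z
  define h where "h \<epsilon> z = exp (- of_real \<epsilon> * (w z * csqrt (w z)))" for \<epsilon> :: real and z
  have w: "\<bar>Im (w z)\<bar> \<le> Re (w z)" "0 < Re (w z)" "cmod z \<le> cmod (w z)" if "z \<in> Q" for z
  proof -
    have "cmod z \<le> \<bar>Re z\<bar> + \<bar>Im z\<bar>" by (rule cmod_le)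
    also have "\<dots> \<le> Re (w z)" using that by (auto simp: Q_def w_def)
    also have "\<dots> \<le> cmod (w z)" by (rule complex_Re_le_cmod)
    finally show "cmod z \<le> cmod (w z)" .
  qed (use that in \<open>auto simp: Q_def w_def\<close>)
  have h_le: "cmod (h \<epsilon> z) \<le> exp (- \<epsilon> * (cmod z * sqrt (cmod z) / 10))" if "z \<in> Q" "0 < \<epsilon>" for \<epsilon> z
  proof -
    have "cmod z * sqrt (cmod z) \<le> cmod (w z) * sqrt (cmod (w z))"
      using w(3)[OF that(1)] by (intro mult_mono) auto
    also have "\<dots> / 10 \<le> Re (w z * csqrt (w z))"
      using Re_three_halves_power w(1,2)[OF that(1)] by blast
    finally show ?thesis using that(2) by (simp add: h_def norm_exp_eq_Re)
  qed
  have C0: "0 \<le> C" using growth[of 0] norm_ge_zero[of "f 0"] by (auto simp: Q_def simp del: norm_ge_zero)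
  have clQ: "closed Q"
    unfolding Q_def by (auto intro!: closed_Collect_conj closed_Collect_le continuous_intros)
  have frQ: "Re z = 0 \<or> Im z = 0" "z \<in> Q" if "z \<in> frontier Q" for z
  proof -
    show "z \<in> Q" using that clQ by (auto simp: frontier_def)
    have "open {z. 0 < Re z \<and> 0 < Im z}"
      by (auto intro!: open_Collect_conj open_Collect_less continuous_intros)
    then have "{z. 0 < Re z \<and> 0 < Im z} \<subseteq> interior Q"
      by (intro interior_maximal) (auto simp: Q_def)
    then show "Re z = 0 \<or> Im z = 0" using that \<open>z \<in> Q\<close> by (force simp: frontier_def Q_def)
  qed
  have fh: "cmod (f z * h \<epsilon> z) \<le> K" if "0 < \<epsilon>" for \<epsilon>
  proof -
    have "((\<lambda>r. C * exp (- r)) \<longlongrightarrow> 0) at_top" for C :: real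
      by (intro tendsto_mult_right_zero filterlim_compose[OF exp_at_bot] filterlim_uminus_at_bot_at_top)
    then have "eventually (\<lambda>r. C * exp (- r) < K) at_top"
      using \<open>0 < K\<close> by (rule order_tendstoD)
    then obtain r where r: "\<And>s. r \<le> s \<Longrightarrow> C * exp (- s) < K" by (auto simp: eventually_at_top_linorder)
    \<comment> \<open>Beyond this radius the damping exceeds \<open>exp ((C + 1) |z|)\<close>.\<close>
    define \<rho> where "\<rho> = max r ((10 * (C + 1) / \<epsilon>)\<^sup>2)"
    show ?thesis
    proof (rule maximum_modulus_unbounded[where f = "\<lambda>z. f z * h \<epsilon> z" and r = \<rho>, OF clQ _ _ _ \<open>z \<in> Q\<close>])
      have "w z \<notin> \<real>\<^sub>\<le>\<^sub>0" if "z \<in> Q" for z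
        using w(2)[OF that] by (auto simp: complex_nonpos_Reals_iff)
      then show "(\<lambda>z. f z * h \<epsilon> z) holomorphic_on Q"
        unfolding h_def by (intro holomorphic_intros hol) (auto simp: w_def intro!: holomorphic_intros)
    next
      fix z assume z: "z \<in> frontier Q"
      have "cmod (f z) \<le> K"
        using frQ[OF z] real[of "Re z"] imag[of "Im z"] complex_eq[of z] by (auto simp: Q_def)
      moreover have "cmod (h \<epsilon> z) \<le> 1"
        using h_le[OF frQ(2)[OF z] that] by (smt (verit) divide_nonneg_nonneg exp_le_one_iff mult_minus_left mult_nonneg_nonneg norm_ge_zero real_sqrt_ge_zero that)
      ultimately show "cmod (f z * h \<epsilon> z) \<le> K"
        using \<open>0 < K\<close> by (simp add: norm_mult mult_le_one mult_left_le[THEN order_trans])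
    next
      fix z assume z: "z \<in> Q" "\<rho> \<le> cmod z"
      have "10 * (C + 1) / \<epsilon> \<le> sqrt (cmod z)" using z by (intro real_le_rsqrt) (auto simp: \<rho>_def)
      then have "C + 1 \<le> \<epsilon> * sqrt (cmod z) / 10" using that by (simp add: field_simps)
      then have *: "cmod z * (C + 1) \<le> cmod z * (\<epsilon> * sqrt (cmod z) / 10)" by (intro mult_left_mono) auto
      have "cmod (f z * h \<epsilon> z) \<le> (C * exp (C * cmod z)) * exp (- \<epsilon> * (cmod z * sqrt (cmod z) / 10))"
        unfolding norm_mult using growth[OF z(1)] h_le[OF z(1) that] by (intro mult_mono) (use C0 in auto)
      also have "\<dots> = C * exp (C * cmod z + - \<epsilon> * (cmod z * sqrt (cmod z) / 10))"
        by (simp only: exp_add mult.assoc)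
      also have "\<dots> \<le> C * exp (- cmod z)"
        using * C0 by (intro mult_left_mono) (auto simp: algebra_simps)
      also have "\<dots> \<le> K" using r[of "cmod z"] z by (auto simp: \<rho>_def)
      finally show "cmod (f z * h \<epsilon> z) \<le> K" .
    qed
  qed
  have "((\<lambda>\<epsilon>. cmod (f z * h \<epsilon> z)) \<longlongrightarrow> cmod (f z * h 0 z)) (at_right 0)"
    unfolding h_def by (intro tendsto_intros)
  moreover have "eventually (\<lambda>\<epsilon>. cmod (f z * h \<epsilon> z) \<le> K) (at_right (0::real))"
    using eventually_at_right_less[of "0::real"] by eventually_elim (rule fh)
  ultimately have "cmod (f z * h 0 z) \<le> K" by (rule tendsto_upperbound) simp
  then show ?thesis by (simp add: h_def)
qed

text \<open>
  Division by \<open>1 - i\<epsilon>z\<close>, which has modulus at least 1 in the upper half-plane, makes a bounded function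
  vanish at infinity without increasing it on the real axis.
\<close>

lemma bounded_half_plane_maximum_modulus:
  fixes f :: "complex \<Rightarrow> complex"
  assumes hol: "f holomorphic_on {z. 0 \<le> Im z}"
    and bounded: "\<And>z. 0 \<le> Im z \<Longrightarrow> cmod (f z) \<le> K"
    and "0 < B" and real: "\<And>x. cmod (f (of_real x)) \<le> B"
    and "0 \<le> Im z"
  shows "cmod (f z) \<le> B"
proof -
  define d where "d \<epsilon> z = 1 - \<i> * of_real \<epsilon> * z" for \<epsilon> :: real and z
  have d1: "1 \<le> cmod (d \<epsilon> z)" "\<epsilon> * cmod z \<le> cmod (d \<epsilon> z)" if "0 \<le> Im z" "0 < \<epsilon>" for \<epsilon> z
  proof -
    show "1 \<le> cmod (d \<epsilon> z)" using complex_Re_le_cmod[of "d \<epsilon> z"] that by (auto simp: d_def intro: order_trans[rotated])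
    have "(\<epsilon> * cmod z)\<^sup>2 \<le> (cmod (d \<epsilon> z))\<^sup>2"
      using that unfolding d_def cmod_power2 power_mult_distrib
      by (simp add: power2_eq_square algebra_simps)
    then show "\<epsilon> * cmod z \<le> cmod (d \<epsilon> z)" by (rule power2_le_imp_le) simp
  qed
  have clH: "closed {z. 0 \<le> Im z}"
    by (auto intro!: closed_Collect_le continuous_intros)
  have frH: "Im z = 0" if "z \<in> frontier {z. 0 \<le> Im z}" for z
  proof -
    have "{z. 0 < Im z} \<subseteq> interior {z. 0 \<le> Im z}"
      by (intro interior_maximal) (auto simp: open_halfspace_Im_gt)
    then show ?thesis using that clH by (force simp: frontier_def)
  qed
  have q: "cmod (f z / d \<epsilon> z) \<le> B" if "0 < \<epsilon>" for \<epsilon>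
  proof (rule maximum_modulus_unbounded[where f = "\<lambda>z. f z / d \<epsilon> z" and r = "K / (\<epsilon> * B)", OF clH])
    show "(\<lambda>z. f z / d \<epsilon> z) holomorphic_on {z. 0 \<le> Im z}"
      using d1(1)[OF _ that] unfolding d_def by (intro holomorphic_intros hol) force
  next
    fix z assume "z \<in> frontier {z. 0 \<le> Im z}"
    then have z: "z = of_real (Re z)" using frH[of z] by (simp add: complex_eq_iff)
    then have "cmod (f z) \<le> B" using real[of "Re z"] by simp
    moreover have "1 \<le> cmod (d \<epsilon> z)" using d1(1)[OF _ that, of z] z by (metis Im_complex_of_real order_refl)
    ultimately show "cmod (f z / d \<epsilon> z) \<le> B"
      using \<open>0 < B\<close> by (simp add: norm_divide divide_le_eq mult_le_cancel_left1[THEN iffD2] order_trans[of _ B])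
  next
    fix z assume z: "z \<in> {z. 0 \<le> Im z}" "K / (\<epsilon> * B) \<le> cmod z"
    have "1 \<le> cmod (d \<epsilon> z)" using d1(1)[OF _ that, of z] z by simp
    then have "0 < cmod (d \<epsilon> z)" by linarith
    have "K \<le> (\<epsilon> * cmod z) * B" using z(2) that \<open>0 < B\<close> by (simp add: field_simps)
    also have "\<dots> \<le> cmod (d \<epsilon> z) * B" using d1(2)[OF _ that, of z] z(1) \<open>0 < B\<close> by (intro mult_right_mono) auto
    finally have "cmod (f z) \<le> B * cmod (d \<epsilon> z)" using bounded[of z] z(1) by (simp add: mult.commute)
    then show "cmod (f z / d \<epsilon> z) \<le> B"
      using \<open>0 < cmod (d \<epsilon> z)\<close> by (simp add: norm_divide divide_le_eq)
  qed (use \<open>0 \<le> Im z\<close> in auto)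
  have "((\<lambda>\<epsilon>. cmod (f z / d \<epsilon> z)) \<longlongrightarrow> cmod (f z / d 0 z)) (at_right 0)"
    unfolding d_def by (intro tendsto_intros) auto
  moreover have "eventually (\<lambda>\<epsilon>. cmod (f z / d \<epsilon> z) \<le> B) (at_right (0::real))"
    using eventually_at_right_less[of "0::real"] by eventually_elim (rule q)
  ultimately have "cmod (f z / d 0 z) \<le> B" by (rule tendsto_upperbound) simp
  then show ?thesis by (simp add: d_def)
qed

text \<open>
  The factor \<open>exp(i\<epsilon>z)\<close> makes the function bounded on the imaginary half-axis, hence on both quadrants and on
  the half-plane; then its bound on the real axis is the bound everywhere, uniformly in \<open>\<epsilon>\<close>.
\<close>

lemma phragmen_lindelof_half_plane:
  fixes f :: "complex \<Rightarrow> complex"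
  assumes hol: "f holomorphic_on {z. 0 \<le> Im z}"
    and growth: "\<And>z. 0 \<le> Im z \<Longrightarrow> cmod (f z) \<le> C * exp (C * cmod z)"
    and "0 < B" and real: "\<And>x. cmod (f (of_real x)) \<le> B"
    and imag: "\<And>\<epsilon>. 0 < \<epsilon> \<Longrightarrow> \<exists>K. \<forall>t\<ge>0. cmod (f (\<i> * of_real t)) \<le> K * exp (\<epsilon> * t)"
    and "0 \<le> Im z"
  shows "cmod (f z) \<le> B"
proof -
  define g where "g \<epsilon> z = f z * exp (\<i> * of_real \<epsilon> * z)" for \<epsilon> :: real and z
  have g: "cmod (g \<epsilon> z) = cmod (f z) * exp (- \<epsilon> * Im z)" for \<epsilon> z
    by (simp add: g_def norm_mult norm_exp_eq_Re)
  have gB: "cmod (g \<epsilon> z) \<le> B" if "0 < \<epsilon>" for \<epsilon>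
  proof -
    obtain K where K: "\<And>t. 0 \<le> t \<Longrightarrow> cmod (f (\<i> * of_real t)) \<le> K * exp (\<epsilon> * t)"
      using imag[OF \<open>0 < \<epsilon>\<close>] by blast
    define K' where "K' = max B K"
    have real': "cmod (g \<epsilon> (of_real x)) \<le> K'" for x
      using real[of x] by (auto simp: g K'_def)
    have imag': "cmod (g \<epsilon> (\<i> * of_real t)) \<le> K'" if "0 \<le> t" for t
    proof -
      have "cmod (g \<epsilon> (\<i> * of_real t)) \<le> K"
        using K[OF that] by (simp add: g exp_minus field_simps)
      then show ?thesis by (simp add: K'_def)
    qed
    have growth': "cmod (g \<epsilon> z) \<le> C * exp (C * cmod z)" if "0 \<le> Im z" for z
    proof -
      have "cmod (g \<epsilon> z) \<le> cmod (f z) * 1"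
        unfolding g using that \<open>0 < \<epsilon>\<close> by (intro mult_left_mono) auto
      then show ?thesis using growth[OF that] by simp
    qed
    have hol': "g \<epsilon> holomorphic_on {z. 0 \<le> Im z}"
      unfolding g_def by (intro holomorphic_intros hol)
    have right: "cmod (g \<epsilon> z) \<le> K'" if "0 \<le> Re z" "0 \<le> Im z" for z
      by (rule phragmen_lindelof_quadrant[where C = C])
         (use that real' imag' growth' \<open>0 < B\<close> in \<open>auto intro: holomorphic_on_subset[OF hol'] simp: K'_def\<close>)
    have left: "cmod (g \<epsilon> z) \<le> K'" if "Re z \<le> 0" "0 \<le> Im z" for z
    proof -
      have "cmod ((g \<epsilon> \<circ> (\<lambda>z. \<i> * z)) (- \<i> * z)) \<le> K'"
      proof (rule phragmen_lindelof_quadrant[where C = C and f = "g \<epsilon> \<circ> (\<lambda>z. \<i> * z)" and K = K'])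
        show "g \<epsilon> \<circ> (\<lambda>z. \<i> * z) holomorphic_on {z. 0 \<le> Re z \<and> 0 \<le> Im z}"
          by (rule holomorphic_on_compose_gen[OF _ hol']) (auto intro!: holomorphic_intros)
        show "cmod ((g \<epsilon> \<circ> (\<lambda>z. \<i> * z)) w) \<le> C * exp (C * cmod w)"
          if "w \<in> {z. 0 \<le> Re z \<and> 0 \<le> Im z}" for w
          using growth'[of "\<i> * w"] that by (simp add: norm_mult)
        show "cmod ((g \<epsilon> \<circ> (\<lambda>z. \<i> * z)) (\<i> * of_real t)) \<le> K'" if "0 \<le> t" for t
          using real'[of "- t"] by (simp add: mult.assoc[symmetric])
      qed (use that imag' \<open>0 < B\<close> in \<open>auto simp: K'_def\<close>)
      then show ?thesis by (simp add: mult.assoc[symmetric])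
    qed
    show "cmod (g \<epsilon> z) \<le> B"
      by (rule bounded_half_plane_maximum_modulus[where K = K', OF hol'])
         (use left right \<open>0 < B\<close> \<open>0 < \<epsilon>\<close> real \<open>0 \<le> Im z\<close> in \<open>auto simp: g intro: linear\<close>,
          metis g linear left right)
  qed
  have "((\<lambda>\<epsilon>. cmod (g \<epsilon> z)) \<longlongrightarrow> cmod (g 0 z)) (at_right 0)"
    unfolding g_def by (intro tendsto_intros)
  moreover have "eventually (\<lambda>\<epsilon>. cmod (g \<epsilon> z) \<le> B) (at_right (0::real))"
    using eventually_at_right_less[of "0::real"] by eventually_elim (rule gB)
  ultimately have "cmod (g 0 z) \<le> B" by (rule tendsto_upperbound) simp
  then show ?thesis by (simp add: g_def)
qed

text \<open>
  This is Harnack's inequality in its sharp form for the half-plane, obtained from Schwarz's lemma: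
  \<open>(g - a) / (g + cnj a)\<close> with \<open>a = g(is)\<close> maps the half-plane into the unit disc and vanishes at \<open>is\<close>, and
  the half-plane is the image of the disc under the Moebius transformation \<open>c\<close> with \<open>c(0) = is\<close>.
\<close>

lemma Harnack_imaginary_axis:
  fixes g :: "complex \<Rightarrow> complex"
  assumes hol: "g holomorphic_on {z. 0 < Im z}"
    and pos: "\<And>z. 0 < Im z \<Longrightarrow> 0 < Re (g z)"
    and "0 < s" "s \<le> t"
  shows "Re (g (\<i> * of_real t)) / t \<le> Re (g (\<i> * of_real s)) / s"
proof -
  define c where "c \<zeta> = \<i> * of_real s * (1 + \<zeta>) / (1 - \<zeta>)" for \<zeta>
  define a where "a = g (\<i> * of_real s)"
  define \<phi> where "\<phi> \<zeta> = (g (c \<zeta>) - a) / (g (c \<zeta>) + cnj a)" for \<zeta>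
  have Imc: "0 < Im (c \<zeta>)" if "cmod \<zeta> < 1" for \<zeta>
  proof -
    have ne: "1 - \<zeta> \<noteq> 0" using that by auto
    have "(1 + \<zeta>) / (1 - \<zeta>) = (1 + \<zeta>) * cnj (1 - \<zeta>) / of_real ((cmod (1 - \<zeta>))\<^sup>2)"
      by (rule complex_div_cnj)
    then have q: "Re ((1 + \<zeta>) / (1 - \<zeta>)) = Re ((1 + \<zeta>) * cnj (1 - \<zeta>)) / (cmod (1 - \<zeta>))\<^sup>2"
      by (simp only: Re_divide_of_real)
    have "c \<zeta> = of_real s * (\<i> * ((1 + \<zeta>) / (1 - \<zeta>)))"
      by (simp add: c_def)
    then have "Im (c \<zeta>) = s * Re ((1 + \<zeta>) / (1 - \<zeta>))"
      by (simp only: times_complex.sel Im_complex_of_real Re_complex_of_real imaginary_unit.sel mult_zero_left mult_1 add_0_right add_0_left)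
    note this[unfolded q]
    also have "Re ((1 + \<zeta>) * cnj (1 - \<zeta>)) = 1 - (cmod \<zeta>)\<^sup>2"
      unfolding cmod_power2 by (simp add: power2_eq_square algebra_simps)
    also have "s * ((1 - (cmod \<zeta>)\<^sup>2) / (cmod (1 - \<zeta>))\<^sup>2) > 0"
      using that ne \<open>0 < s\<close> by (intro mult_pos_pos divide_pos_pos) (auto simp: abs_square_less_1)
    finally show ?thesis .
  qed
  have a: "0 < Re a" using pos \<open>0 < s\<close> by (simp add: a_def)
  have ne: "g (c \<zeta>) + cnj a \<noteq> 0" if "cmod \<zeta> < 1" for \<zeta>
    using pos[OF Imc[OF that]] a by (auto simp: complex_eq_iff)
  \<comment> \<open>The point of the disc that \<open>c\<close> maps to \<open>it\<close>.\<close>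
  define \<rho> where "\<rho> = (t - s) / (t + s)"
  have \<rho>: "0 \<le> \<rho>" "\<rho> < 1" using assms(3,4) by (auto simp: \<rho>_def)
  have "cmod (\<phi> (of_real \<rho>)) \<le> cmod (of_real \<rho>)"
  proof (rule Schwarz_Lemma(1))
    have ch: "c holomorphic_on ball 0 1"
      unfolding c_def by (intro holomorphic_intros) auto
    have "(g \<circ> c) holomorphic_on ball 0 1"
      by (rule holomorphic_on_compose_gen[OF ch hol]) (use Imc in auto)
    then have "(\<lambda>\<zeta>. g (c \<zeta>)) holomorphic_on ball 0 1" by (simp add: o_def)
    then show "\<phi> holomorphic_on ball 0 1"
      unfolding \<phi>_def by (intro holomorphic_intros) (use ne in auto)
    show "\<phi> 0 = 0" by (simp add: \<phi>_def c_def a_def)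
    fix \<zeta> :: complex assume z: "cmod \<zeta> < 1"
    define u where "u = g (c \<zeta>)"
    have u: "0 < Re u" using pos[OF Imc[OF z]] by (simp add: u_def)
    have "0 < Re u * Re a" using u a by simp
    then have "(cmod (u - a))\<^sup>2 < (cmod (u + cnj a))\<^sup>2"
      unfolding cmod_power2 by (simp add: power2_eq_square algebra_simps)
    then have "cmod (u - a) < cmod (u + cnj a)" by (rule power2_less_imp_less) simp
    then show "cmod (\<phi> \<zeta>) < 1"
      using ne[OF z] by (simp add: \<phi>_def u_def norm_divide divide_less_eq)
  qed (use \<rho> in auto)
  moreover have "c (of_real \<rho>) = \<i> * of_real t"
  proof -
    have "1 + \<rho> = 2 * t / (t + s)" "1 - \<rho> = 2 * s / (t + s)"
      using assms(3,4) by (simp_all add: \<rho>_def field_simps)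
    then have "(1 + \<rho>) / (1 - \<rho>) = t / s" using assms(3,4) by simp
    then have "(1 + complex_of_real \<rho>) / (1 - of_real \<rho>) = of_real t / of_real s"
      by (metis of_real_1 of_real_add of_real_diff of_real_divide)
    moreover have "c (of_real \<rho>) = \<i> * of_real s * ((1 + of_real \<rho>) / (1 - of_real \<rho>))"
      by (simp add: c_def)
    ultimately show ?thesis using \<open>0 < s\<close> by simp
  qed
  ultimately have le: "cmod (g (\<i> * of_real t) - a) \<le> \<rho> * cmod (g (\<i> * of_real t) + cnj a)"
    using ne[of "of_real \<rho>"] \<rho> by (simp add: \<phi>_def norm_divide divide_le_eq)
  define u where "u = g (\<i> * of_real t)"
  have upos: "0 < Re u" using pos assms(3,4) by (simp add: u_def)
  have "(cmod (u - a))\<^sup>2 \<le> (\<rho> * cmod (u + cnj a))\<^sup>2"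
    using le by (intro power_mono) (auto simp: u_def)
  then have "(Re u - Re a)\<^sup>2 + (Im u - Im a)\<^sup>2 \<le> \<rho>\<^sup>2 * (Re u + Re a)\<^sup>2 + \<rho>\<^sup>2 * (Im u - Im a)\<^sup>2"
    by (simp add: power_mult_distrib cmod_power2 algebra_simps)
  moreover have "\<rho>\<^sup>2 * (Im u - Im a)\<^sup>2 \<le> 1 * (Im u - Im a)\<^sup>2"
    using \<rho> by (intro mult_right_mono) (auto simp: power_le_one)
  ultimately have "(Re u - Re a)\<^sup>2 \<le> (\<rho> * (Re u + Re a))\<^sup>2" by (simp add: power_mult_distrib)
  then have "Re u - Re a \<le> \<rho> * (Re u + Re a)"
    by (rule power2_le_imp_le) (use \<rho> upos a in auto)
  then have "(Re u - Re a) * (t + s) \<le> (t - s) * (Re u + Re a)"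
    using assms(3,4) by (simp add: \<rho>_def pos_le_divide_eq)
  then have "Re u * s \<le> Re a * t" by (simp add: algebra_simps)
  then show ?thesis using assms(3,4) by (simp add: u_def a_def field_simps)
qed

section \<open>Growth of a sine-type function\<close>

lemma Complex_eq_diff_square: "(cmod (Complex x \<eta> - of_real \<mu>))\<^sup>2 = (\<mu> - x)\<^sup>2 + \<eta>\<^sup>2"
  by (simp add: cmod_power2 power2_commute)

lemma Complex_split: "of_real a + \<i> * of_real b = Complex a b"
  by (simp add: complex_eq_iff)

text \<open>
  Moving from height \<open>\<eta>\<close> to height \<open>Y\<close> above a point \<open>x\<close> that keeps the distance \<open>r\<close> from the zeros enlarges the
  distance to \<open>\<mu>\<close> by at most the factor \<open>\<surd>(1 + Y\<^sup>2/(\<mu>-x)\<^sup>2)\<close>.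
\<close>

lemma prod_cmod_separated:
  assumes "finite S" "0 < r" "separated r S" "\<And>\<mu>. \<mu> \<in> S \<Longrightarrow> r \<le> \<bar>\<mu> - x\<bar>" "0 \<le> Y"
  shows "exp (- pi * Y / r) * (\<Prod>\<mu>\<in>S. cmod (Complex x Y - of_real \<mu>)) \<le> (\<Prod>\<mu>\<in>S. cmod (Complex x \<eta> - of_real \<mu>))"
proof -
  have nz: "\<mu> - x \<noteq> 0" if "\<mu> \<in> S" for \<mu> using assms(2) assms(4)[OF that] by auto
  have "(\<Prod>\<mu>\<in>S. cmod (Complex x Y - of_real \<mu>))\<^sup>2 = (\<Prod>\<mu>\<in>S. (\<mu> - x)\<^sup>2 + Y\<^sup>2)"
    by (simp add: Complex_eq_diff_square prod_power_distrib)
  also have "\<dots> \<le> (\<Prod>\<mu>\<in>S. ((\<mu> - x)\<^sup>2 + \<eta>\<^sup>2) * (1 + Y\<^sup>2 / (\<mu> - x)\<^sup>2))"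
  proof (intro prod_mono conjI)
    fix \<mu> assume "\<mu> \<in> S"
    then have "(\<mu> - x)\<^sup>2 + Y\<^sup>2 = (\<mu> - x)\<^sup>2 * (1 + Y\<^sup>2 / (\<mu> - x)\<^sup>2)" using nz by (simp add: distrib_left)
    also have "\<dots> \<le> ((\<mu> - x)\<^sup>2 + \<eta>\<^sup>2) * (1 + Y\<^sup>2 / (\<mu> - x)\<^sup>2)" by (intro mult_right_mono) auto
    finally show "(\<mu> - x)\<^sup>2 + Y\<^sup>2 \<le> ((\<mu> - x)\<^sup>2 + \<eta>\<^sup>2) * (1 + Y\<^sup>2 / (\<mu> - x)\<^sup>2)" .
  qed auto
  also have "\<dots> = (\<Prod>\<mu>\<in>S. (\<mu> - x)\<^sup>2 + \<eta>\<^sup>2) * (\<Prod>\<mu>\<in>S. 1 + Y\<^sup>2 / (\<mu> - x)\<^sup>2)" by (rule prod.distrib)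
  also have "\<dots> \<le> (\<Prod>\<mu>\<in>S. (\<mu> - x)\<^sup>2 + \<eta>\<^sup>2) * (exp (pi * Y / r))\<^sup>2"
    by (intro mult_left_mono prod_separated_le_exp prod_nonneg) (use assms in auto)
  also have "(\<Prod>\<mu>\<in>S. (\<mu> - x)\<^sup>2 + \<eta>\<^sup>2) = (\<Prod>\<mu>\<in>S. cmod (Complex x \<eta> - of_real \<mu>))\<^sup>2"
    by (simp add: Complex_eq_diff_square prod_power_distrib)
  finally have "(\<Prod>\<mu>\<in>S. cmod (Complex x Y - of_real \<mu>))\<^sup>2
      \<le> ((\<Prod>\<mu>\<in>S. cmod (Complex x \<eta> - of_real \<mu>)) * exp (pi * Y / r))\<^sup>2"
    by (simp add: power_mult_distrib)
  then have "(\<Prod>\<mu>\<in>S. cmod (Complex x Y - of_real \<mu>)) \<le> (\<Prod>\<mu>\<in>S. cmod (Complex x \<eta> - of_real \<mu>)) * exp (pi * Y / r)"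
    by (rule power2_le_imp_le) (auto intro!: mult_nonneg_nonneg prod_nonneg)
  then show ?thesis by (simp add: exp_minus field_simps)
qed

text \<open>
  Any separation \<open>d\<close> and any line with its bounds are parameters, so that the results can be instantiated
  with the optimal separation, with each admissible line, and with an impossible separation to refute it.
\<close>

locale sine_type =
  fixes \<Lambda> :: "real set" and d y m M :: real
  assumes sine_type: "sine_type_zero_set \<Lambda>"
    and d_pos: "0 < d" and separated: "separated d \<Lambda>"
    and y_pos: "0 < y" and m_pos: "0 < m" and M_pos: "0 < M"
    and line: "bounded_on_line (sine_fun \<Lambda>) y m M"
begin

abbreviation F where "F \<equiv> sine_fun \<Lambda>"

definition L :: "complex \<Rightarrow> complex" where "L z = Lim at_top (partial_zero_product \<Lambda> z)"

definition T :: "real \<Rightarrow> real set" where "T R = {\<mu>\<in>\<Lambda>. \<bar>\<mu>\<bar> < R}"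

lemma finite_T: "finite (T R)" and T_subset: "T R \<subseteq> \<Lambda>"
  using finite_separated_bounded[OF separated d_pos] by (auto simp: T_def)

lemma tendsto_L: "(partial_zero_product \<Lambda> z \<longlongrightarrow> L z) at_top"
proof -
  obtain l where "(partial_zero_product \<Lambda> z \<longlongrightarrow> l) at_top"
    using sine_type by (auto simp: sine_type_zero_set_def)
  then show ?thesis by (simp add: L_def tendsto_Lim)
qed

lemma F_eq: "F z = exp (of_real pi * \<i> * z) * L z"
  by (simp add: sine_fun_def L_def)

lemma cmod_F: "cmod (F z) = exp (- pi * Im z) * cmod (L z)"
  by (simp add: F_eq norm_mult norm_exp_eq_Re)

lemma holomorphic_F: "F holomorphic_on A"
  using sine_type holomorphic_on_subset by (auto simp: sine_type_zero_set_def)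

lemma holomorphic_F_shift: "(\<lambda>z. F (z + c)) holomorphic_on A"
proof -
  have "(\<lambda>z. z + c) holomorphic_on A" by (intro holomorphic_intros)
  from holomorphic_on_compose[OF this holomorphic_F] show ?thesis by (simp add: o_def)
qed

lemma cmod_partial_zero_product:
  "cmod (partial_zero_product \<Lambda> z R) =
    (\<Prod>\<mu>\<in>T R. if \<mu> = 0 then 1 else 1 / \<bar>\<mu>\<bar>) * (\<Prod>\<mu>\<in>T R. cmod (z - of_real \<mu>))"
proof -
  have "cmod (if \<mu> = 0 then z else 1 - z / of_real \<mu>) = (if \<mu> = 0 then 1 else 1 / \<bar>\<mu>\<bar>) * cmod (z - of_real \<mu>)" for \<mu>
  proof (cases "\<mu> = 0")
    case False
    then have "1 - z / of_real \<mu> = - (z - of_real \<mu>) / of_real \<mu>" by (simp add: field_simps)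
    then have "cmod (1 - z / of_real \<mu>) = cmod (z - of_real \<mu>) / \<bar>\<mu>\<bar>"
      by (simp only: norm_divide norm_minus_cancel norm_of_real)
    then show ?thesis using False by simp
  qed simp
  then show ?thesis
    unfolding partial_zero_product_def T_def[symmetric] prod_norm[symmetric] by (simp only: prod.distrib)
qed

text \<open>
  The modulus of a partial product is a factor independent of the point times the product of the distances
  to the zeros, so inequalities between products of distances pass to the limit.
\<close>

lemma L_compare:
  assumes "\<And>R. b \<le> R \<Longrightarrow>
    k * (\<Prod>\<mu>\<in>T R. cmod (w - of_real \<mu>)) \<le> (\<Prod>\<mu>\<in>T R. cmod (z - of_real \<mu>))"
  shows "k * cmod (L w) \<le> cmod (L z)"
proof (rule tendsto_le)
  show "((\<lambda>R. k * cmod (partial_zero_product \<Lambda> w R)) \<longlongrightarrow> k * cmod (L w)) at_top"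
    and "((\<lambda>R. cmod (partial_zero_product \<Lambda> z R)) \<longlongrightarrow> cmod (L z)) at_top"
    by (intro tendsto_intros tendsto_L)+
  have "k * cmod (partial_zero_product \<Lambda> w R) \<le> cmod (partial_zero_product \<Lambda> z R)" if "b \<le> R" for R
  proof -
    let ?c = "\<Prod>\<mu>\<in>T R. if \<mu> = 0 then 1 else 1 / \<bar>\<mu>\<bar>"
    have "0 \<le> ?c" by (intro prod_nonneg) auto
    then have "?c * (k * (\<Prod>\<mu>\<in>T R. cmod (w - of_real \<mu>))) \<le> ?c * (\<Prod>\<mu>\<in>T R. cmod (z - of_real \<mu>))"
      using assms[OF that] by (rule mult_left_mono[rotated])
    then show ?thesis by (simp only: cmod_partial_zero_product mult.left_commute)
  qed
  then show "eventually (\<lambda>R. k * cmod (partial_zero_product \<Lambda> w R) \<le> cmod (partial_zero_product \<Lambda> z R)) at_top"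
    by (auto simp: eventually_at_top_linorder)
qed simp

lemma L_mono:
  assumes "\<bar>s\<bar> \<le> \<bar>t\<bar>"
  shows "cmod (L (Complex x s)) \<le> cmod (L (Complex x t))"
proof -
  have "cmod (Complex x s - of_real \<mu>) \<le> cmod (Complex x t - of_real \<mu>)" for \<mu>
    by (rule power2_le_imp_le) (use assms in \<open>auto simp: Complex_eq_diff_square abs_le_square_iff\<close>)
  then show ?thesis using L_compare[where k = 1 and b = 0] by (simp add: prod_mono)
qed

lemma L_cnj: "cmod (L (Complex x (- t))) = cmod (L (Complex x t))"
  by (rule antisym) (auto intro: L_mono)

lemma L_off_zeros_ge:
  assumes "0 < r" "separated r \<Lambda>" "\<And>\<mu>. \<mu> \<in> \<Lambda> \<Longrightarrow> r \<le> \<bar>\<mu> - x\<bar>" "0 \<le> Y"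
  shows "exp (- pi * Y / r) * cmod (L (Complex x Y)) \<le> cmod (L (Complex x \<eta>))"
proof (rule L_compare)
  fix R
  show "exp (- pi * Y / r) * (\<Prod>\<mu>\<in>T R. cmod (Complex x Y - of_real \<mu>)) \<le> (\<Prod>\<mu>\<in>T R. cmod (Complex x \<eta> - of_real \<mu>))"
    using assms finite_T T_subset[of R] separated_subset[OF assms(2) T_subset] by (intro prod_cmod_separated) auto
qed

text \<open>
  Above a zero, its own factor contributes exactly \<open>|\<eta>| / Y\<close>, and the remaining zeros keep the distance \<open>d\<close>.
\<close>

lemma L_near_zero_ge:
  assumes \<kappa>: "\<kappa> \<in> \<Lambda>" and "0 < Y"
  shows "\<bar>\<eta>\<bar> / Y * exp (- pi * Y / d) * cmod (L (Complex \<kappa> Y)) \<le> cmod (L (Complex \<kappa> \<eta>))"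
proof (rule L_compare[where b = "\<bar>\<kappa>\<bar> + 1"])
  fix R assume "\<bar>\<kappa>\<bar> + 1 \<le> R"
  then have \<kappa>T: "\<kappa> \<in> T R" using \<kappa> by (auto simp: T_def)
  define S where "S = T R - {\<kappa>}"
  have S: "finite S" "S \<subseteq> \<Lambda>" "\<kappa> \<notin> S" using finite_T T_subset by (auto simp: S_def)
  have split: "(\<Prod>\<mu>\<in>T R. cmod (z - of_real \<mu>)) = cmod (z - of_real \<kappa>) * (\<Prod>\<mu>\<in>S. cmod (z - of_real \<mu>))" for z
    unfolding S_def using finite_T \<kappa>T by (rule prod.remove)
  have gap: "d \<le> \<bar>\<mu> - \<kappa>\<bar>" if "\<mu> \<in> S" for \<mu>
    using that S(3) by (intro separatedD[OF separated] subsetD[OF S(2)] \<kappa>) auto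
  have "exp (- pi * Y / d) * (\<Prod>\<mu>\<in>S. cmod (Complex \<kappa> Y - of_real \<mu>)) \<le> (\<Prod>\<mu>\<in>S. cmod (Complex \<kappa> \<eta> - of_real \<mu>))"
    using S gap d_pos \<open>0 < Y\<close> separated_subset[OF separated S(2)] by (intro prod_cmod_separated) auto
  then have "\<bar>\<eta>\<bar> * (exp (- pi * Y / d) * (\<Prod>\<mu>\<in>S. cmod (Complex \<kappa> Y - of_real \<mu>))) \<le> \<bar>\<eta>\<bar> * (\<Prod>\<mu>\<in>S. cmod (Complex \<kappa> \<eta> - of_real \<mu>))"
    by (intro mult_left_mono) auto
  moreover have "cmod (Complex \<kappa> t - of_real \<kappa>) = \<bar>t\<bar>" for t by (simp add: cmod_def)
  ultimately show "\<bar>\<eta>\<bar> / Y * exp (- pi * Y / d) * (\<Prod>\<mu>\<in>T R. cmod (Complex \<kappa> Y - of_real \<mu>))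
      \<le> (\<Prod>\<mu>\<in>T R. cmod (Complex \<kappa> \<eta> - of_real \<mu>))"
    unfolding split using \<open>0 < Y\<close> by (simp add: mult_ac)
qed

lemma line_bounds: "sqrt m \<le> cmod (F (Complex x y))" "cmod (F (Complex x y)) \<le> sqrt M"
  using line by (auto simp: bounded_on_line_def intro: real_le_rsqrt real_le_lsqrt)

lemma L_line_ge: "y \<le> \<bar>\<eta>\<bar> \<Longrightarrow> exp (pi * y) * sqrt m \<le> cmod (L (Complex x \<eta>))"
proof -
  assume "y \<le> \<bar>\<eta>\<bar>"
  have "sqrt m \<le> exp (- (pi * y)) * cmod (L (Complex x y))"
    using line_bounds(1)[of x] by (simp add: cmod_F)
  then have "exp (pi * y) * sqrt m \<le> cmod (L (Complex x y))" by (simp add: exp_minus field_simps)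
  also have "\<dots> \<le> cmod (L (Complex x \<eta>))" using \<open>y \<le> \<bar>\<eta>\<bar>\<close> y_pos by (intro L_mono) auto
  finally show ?thesis .
qed

lemma F_zero: "\<kappa> \<in> \<Lambda> \<Longrightarrow> F (of_real \<kappa>) = 0"
proof -
  assume \<kappa>: "\<kappa> \<in> \<Lambda>"
  have "partial_zero_product \<Lambda> (of_real \<kappa>) R = 0" if "\<bar>\<kappa>\<bar> + 1 \<le> R" for R
  proof -
    have "\<kappa> \<in> T R" using \<kappa> that by (auto simp: T_def)
    then have "(\<Prod>\<mu>\<in>T R. cmod (of_real \<kappa> - of_real \<mu>)) = 0" using finite_T by (intro prod_zero) auto
    then have "cmod (partial_zero_product \<Lambda> (of_real \<kappa>) R) = 0"
      unfolding cmod_partial_zero_product by simp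
    then show ?thesis by simp
  qed
  then have "eventually (\<lambda>R. partial_zero_product \<Lambda> (of_real \<kappa>) R = 0) at_top"
    by (auto simp: eventually_at_top_linorder)
  then have "(partial_zero_product \<Lambda> (of_real \<kappa>) \<longlongrightarrow> 0) at_top" by (rule tendsto_eventually)
  then have "L (of_real \<kappa>) = 0" using tendsto_L tendsto_unique trivial_limit_at_top_linorder by blast
  then show ?thesis by (simp add: F_eq)
qed

text \<open>
  Every point off \<open>\<Lambda>\<close> is compared with the point at height \<open>y\<close> with the same real part, where \<open>F\<close> is
  bounded away from 0.
\<close>

lemma F_nonzero:
  assumes "\<And>\<kappa>. \<kappa> \<in> \<Lambda> \<Longrightarrow> z \<noteq> of_real \<kappa>"
  shows "F z \<noteq> 0"
proof -
  define x \<eta> where "x = Re z" and "\<eta> = Im z"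
  have z: "z = Complex x \<eta>" by (simp add: x_def \<eta>_def)
  have pos: "0 < cmod (L (Complex x y))"
    using L_line_ge[of y x] y_pos m_pos by (smt (verit) exp_gt_zero mult_pos_pos real_sqrt_gt_zero)
  have "0 < cmod (L (Complex x \<eta>))"
  proof (cases "x \<in> \<Lambda>")
    case True
    then have "\<eta> \<noteq> 0" using assms[of x] by (auto simp: z complex_eq_iff)
    then have "0 < \<bar>\<eta>\<bar> / y * exp (- pi * y / d) * cmod (L (Complex x y))" using pos y_pos by simp
    also have "\<dots> \<le> cmod (L (Complex x \<eta>))" by (rule L_near_zero_ge[OF True y_pos])
    finally show ?thesis .
  next
    case False
    have "closed \<Lambda>"
    proof (rule uniform_discrete_imp_closed)
      show "uniform_discrete \<Lambda>"
        using separated d_pos by (intro uniformI2[of d]) (auto simp: separated_def dist_real_def)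
    qed
    then obtain e where e: "0 < e" "\<And>\<mu>. \<mu> \<in> \<Lambda> \<Longrightarrow> e \<le> \<bar>\<mu> - x\<bar>"
      using separate_point_closed[of \<Lambda> x] False by (auto simp: dist_real_def abs_minus_commute)
    have "0 < exp (- pi * y / min d e) * cmod (L (Complex x y))" using pos by simp
    also have "\<dots> \<le> cmod (L (Complex x \<eta>))"
      using d_pos e y_pos separated_mono[OF separated]
      by (intro L_off_zeros_ge) (auto intro: min.coboundedI2)
    finally show ?thesis .
  qed
  then show ?thesis by (auto simp: F_eq z)
qed

text \<open>
  Monotonicity of \<open>|L|\<close> alone loses an exponential factor; it makes \<open>1/F\<close> of exponential type, which is what
  the Phragmen-Lindelof principle requires.
\<close>

lemma F_crude_lower:
  assumes "y \<le> Im z"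
  shows "exp (- pi * (Im z - y)) * sqrt m \<le> cmod (F z)"
proof -
  have "exp (- pi * Im z) * (exp (pi * y) * sqrt m) \<le> exp (- pi * Im z) * cmod (L (Complex (Re z) (Im z)))"
    using assms y_pos by (intro mult_left_mono L_line_ge) auto
  moreover have "exp (- pi * Im z) * exp (pi * y) = exp (- pi * (Im z - y))"
    by (simp add: exp_add[symmetric] algebra_simps)
  ultimately show ?thesis
    unfolding cmod_F by (simp only: complex.collapse mult.assoc[symmetric])
qed

lemma F_imaginary_nonzero: "0 < t \<Longrightarrow> F (\<i> * of_real t) \<noteq> 0"
  by (rule F_nonzero) (auto simp: complex_eq_iff)

text \<open>
  The indicator of \<open>F\<close> in the direction \<open>i\<close> is 0, so the Phragmen-Lindelof principle applies to the
  half-plane above the line.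
\<close>

theorem F_upper_bound:
  assumes "y \<le> Im z"
  shows "cmod (F z) \<le> sqrt M"
proof -
  define G where "G z = F (z + \<i> * of_real y)" for z
  have hol: "G holomorphic_on A" for A
    unfolding G_def by (rule holomorphic_F_shift)
  have "cmod (G (z - \<i> * of_real y)) \<le> sqrt M"
  proof -
    obtain C where C: "\<And>z. cmod (F z) \<le> C * exp ((2 * pi + 1) * cmod z)"
    proof -
      have "\<forall>\<epsilon>>0. \<exists>C. \<forall>z. cmod (F z) \<le> C * exp ((2 * pi + \<epsilon>) * cmod z)"
        using sine_type by (simp add: sine_type_zero_set_def exponential_type_def)
      then show ?thesis using that zero_less_one by blast
    qed
    define C' where "C' = max (2 * pi + 1) (\<bar>C\<bar> * exp ((2 * pi + 1) * y))"
    show ?thesis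
    proof (rule phragmen_lindelof_half_plane[where f = G and C = C', OF hol])
      fix z :: complex
      have "cmod (z + \<i> * of_real y) \<le> cmod z + y"
        using norm_triangle_ineq[of z "\<i> * of_real y"] y_pos by (simp add: norm_mult)
      then have "(2 * pi + 1) * cmod (z + \<i> * of_real y) \<le> (2 * pi + 1) * (cmod z + y)"
        by (intro mult_left_mono) auto
      then have "cmod (G z) \<le> \<bar>C\<bar> * exp ((2 * pi + 1) * (cmod z + y))"
        unfolding G_def by (intro order_trans[OF C] mult_mono) auto
      also have "\<dots> = (\<bar>C\<bar> * exp ((2 * pi + 1) * y)) * exp ((2 * pi + 1) * cmod z)"
        by (simp add: exp_add distrib_left)
      also have "\<dots> \<le> C' * exp (C' * cmod z)"
        by (intro mult_mono) (auto simp: C'_def le_max_iff_disj intro!: mult_right_mono)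
      finally show "cmod (G z) \<le> C' * exp (C' * cmod z)" .
    next
      show "cmod (G (of_real x)) \<le> sqrt M" for x
        using line_bounds(2) by (simp add: G_def Complex_split)
    next
      fix \<epsilon> :: real assume "0 < \<epsilon>"
      have "Limsup at_top (\<lambda>t::real. ereal (ln (cmod (F (\<i> * of_real t))) / t)) < ereal \<epsilon>"
        using sine_type \<open>0 < \<epsilon>\<close> by (simp add: sine_type_zero_set_def)
      then have "eventually (\<lambda>t. ereal (ln (cmod (F (\<i> * of_real t))) / t) < ereal \<epsilon>) at_top"
        by (rule Limsup_lessD)
      then obtain t0 where t0: "\<And>t. t0 \<le> t \<Longrightarrow> ln (cmod (F (\<i> * of_real t))) / t < \<epsilon>"
        by (auto simp: eventually_at_top_linorder)
      define t1 where "t1 = max t0 1"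
      have far: "cmod (F (\<i> * of_real t)) \<le> exp (\<epsilon> * t)" if "t1 \<le> t" for t
      proof -
        have t: "0 < t" using that by (auto simp: t1_def)
        have "ln (cmod (F (\<i> * of_real t))) < \<epsilon> * t" using t0[of t] that t by (simp add: t1_def divide_less_eq)
        then have "exp (ln (cmod (F (\<i> * of_real t)))) \<le> exp (\<epsilon> * t)" by simp
        then show ?thesis using F_imaginary_nonzero[OF t] by simp
      qed
      have "compact ((\<lambda>t. F (\<i> * of_real t)) ` {0..t1})"
        by (intro compact_continuous_image continuous_on_compose2[OF holomorphic_on_imp_continuous_on[OF holomorphic_F[of UNIV]]] continuous_intros) auto
      then obtain B where B: "\<And>t. t \<in> {0..t1} \<Longrightarrow> cmod (F (\<i> * of_real t)) \<le> B"
        by (meson bounded_iff compact_imp_bounded imageI)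
      define K where "K = \<bar>B\<bar> + exp (\<epsilon> * y)"
      have "cmod (G (\<i> * of_real t)) \<le> K * exp (\<epsilon> * t)" if "0 \<le> t" for t
      proof -
        have eq: "G (\<i> * of_real t) = F (\<i> * of_real (t + y))" by (simp add: G_def distrib_left)
        show ?thesis
        proof (cases "t1 \<le> t + y")
          case True
          then have "cmod (G (\<i> * of_real t)) \<le> exp (\<epsilon> * y) * exp (\<epsilon> * t)"
            using far[OF True] by (simp add: eq exp_add distrib_left mult.commute)
          also have "\<dots> \<le> K * exp (\<epsilon> * t)" by (intro mult_right_mono) (auto simp: K_def)
          finally show ?thesis .
        next
          case False
          then have "cmod (G (\<i> * of_real t)) \<le> \<bar>B\<bar> * 1" using B[of "t + y"] that y_pos by (simp add: eq)
          also have "\<dots> \<le> K * exp (\<epsilon> * t)" using that \<open>0 < \<epsilon>\<close> by (intro mult_mono) (auto simp: K_def)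
          finally show ?thesis .
        qed
      qed
      then show "\<exists>K. \<forall>t\<ge>0. cmod (G (\<i> * of_real t)) \<le> K * exp (\<epsilon> * t)" by blast
    qed (use assms M_pos in auto)
  qed
  then show ?thesis by (simp add: G_def)
qed

text \<open>
  The upper limit of \<open>log |F(it)| / t\<close> provides arbitrarily large heights at which \<open>|F|\<close> is not exponentially
  small. Harnack's inequality, applied to \<open>- log |F|\<close>, extends this to all larger heights.
\<close>

lemma F_imaginary_subexponential:
  assumes "0 < \<epsilon>"
  obtains t0 where "0 < t0" "\<And>t. t0 \<le> t \<Longrightarrow> exp (- \<epsilon> * t) \<le> cmod (F (\<i> * of_real (t + y)))"
proof -
  \<comment> \<open>The summand 1 makes the logarithm of \<open>|f|\<close> strictly negative.\<close>
  define c where "c = sqrt M + 1"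
  have c: "1 < c" using M_pos by (simp add: c_def)
  define f where "f z = F (z + \<i> * of_real y) / of_real c" for z
  have holf: "f holomorphic_on {z. 0 < Im z}"
    unfolding f_def using c by (intro holomorphic_intros holomorphic_F_shift) auto
  have fnz: "f z \<noteq> 0" if "z \<in> {z. 0 < Im z}" for z
    using that c y_pos F_nonzero[of "z + \<i> * of_real y"] by (auto simp: f_def complex_eq_iff)
  obtain g where g: "g holomorphic_on {z. 0 < Im z}" "\<And>z. 0 < Im z \<Longrightarrow> f z = exp (g z)"
    by (rule contractible_imp_holomorphic_log[OF holf convex_imp_contractible[OF convex_halfspace_Im_gt] fnz]) auto
  have Reg: "Re (g z) = ln (cmod (f z))" if "0 < Im z" for z
    using g(2)[OF that] by simp
  have neg: "0 < Re (- g z)" if "0 < Im z" for z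
  proof -
    have "cmod (F (z + \<i> * of_real y)) \<le> sqrt M" using that by (intro F_upper_bound) auto
    then have "cmod (F (z + \<i> * of_real y)) < c" by (simp add: c_def)
    then have "cmod (f z) < 1" using c by (simp add: f_def norm_divide divide_less_eq)
    moreover have "0 < cmod (f z)" using fnz that by simp
    ultimately show ?thesis using Reg[OF that] by simp
  qed
  \<comment> \<open>The first threshold allows replacing \<open>s\<close> by \<open>s - y \<ge> s/2\<close>, the second absorbs the constant \<open>ln c\<close>.\<close>
  have "\<exists>s\<ge>max (2 * y) (4 * ln c / \<epsilon>). - (\<epsilon> / 4) < ln (cmod (F (\<i> * of_real s))) / s"
  proof (rule ccontr)
    assume "\<not> ?thesis"
    then have "ln (cmod (F (\<i> * of_real t))) / t \<le> - (\<epsilon> / 4)" if "max (2 * y) (4 * ln c / \<epsilon>) \<le> t" for t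
      using that by (meson not_le)
    then have "eventually (\<lambda>t. ereal (ln (cmod (F (\<i> * of_real t))) / t) \<le> ereal (- (\<epsilon> / 4))) at_top"
      by (intro eventually_at_top_linorderI[of "max (2 * y) (4 * ln c / \<epsilon>)"]) simp
    then have "Limsup at_top (\<lambda>t::real. ereal (ln (cmod (F (\<i> * of_real t))) / t)) \<le> ereal (- (\<epsilon> / 4))"
      by (rule Limsup_bounded)
    then show False using sine_type \<open>0 < \<epsilon>\<close> by (simp add: sine_type_zero_set_def)
  qed
  then obtain s where s: "2 * y \<le> s" "4 * ln c / \<epsilon> \<le> s" "- (\<epsilon> / 4) < ln (cmod (F (\<i> * of_real s))) / s"
    by auto
  have s0: "0 < s" using s(1) y_pos by linarith
  define t0 where "t0 = s - y"
  have t0: "0 < t0" "s \<le> 2 * t0" using s(1) y_pos by (auto simp: t0_def)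
  have "Re (- g (\<i> * of_real t0)) \<le> \<epsilon> * t0"
  proof -
    have "f (\<i> * of_real t0) = F (\<i> * of_real s) / of_real c" by (simp add: f_def t0_def algebra_simps)
    then have "Re (- g (\<i> * of_real t0)) = ln c - ln (cmod (F (\<i> * of_real s)))"
      using Reg[of "\<i> * of_real t0"] t0 c F_imaginary_nonzero[OF s0] by (simp add: norm_divide ln_div)
    moreover have "- ln (cmod (F (\<i> * of_real s))) \<le> \<epsilon> / 4 * s"
      using s(3) s0 by (simp add: pos_less_divide_eq)
    moreover have "ln c \<le> \<epsilon> / 4 * s" using s(2) \<open>0 < \<epsilon>\<close> by (simp add: field_simps)
    ultimately have "Re (- g (\<i> * of_real t0)) \<le> \<epsilon> / 2 * s" by linarith
    also have "\<dots> \<le> \<epsilon> / 2 * (2 * t0)" using t0 \<open>0 < \<epsilon>\<close> by (intro mult_left_mono) auto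
    finally show ?thesis by simp
  qed
  then have base: "Re (- g (\<i> * of_real t0)) / t0 \<le> \<epsilon>" unfolding pos_divide_le_eq[OF t0(1)] .
  show ?thesis
  proof (rule that[OF t0(1)])
    fix t assume t: "t0 \<le> t"
    have "Re (- g (\<i> * of_real t)) / t \<le> Re (- g (\<i> * of_real t0)) / t0"
      by (rule Harnack_imaginary_axis[where g = "\<lambda>z. - g z"]) (use neg t t0 g(1) in \<open>auto intro!: holomorphic_intros\<close>)
    then have "Re (- g (\<i> * of_real t)) / t \<le> \<epsilon>" using base by linarith
    moreover have "0 < t" using t t0 by linarith
    ultimately have "Re (- g (\<i> * of_real t)) \<le> \<epsilon> * t" by (simp only: pos_divide_le_eq)
    then have "- ln (cmod (f (\<i> * of_real t))) \<le> \<epsilon> * t"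
      using \<open>0 < t\<close> Reg[of "\<i> * of_real t"] by simp
    then have "exp (- \<epsilon> * t) \<le> exp (ln (cmod (f (\<i> * of_real t))))" by simp
    also have "\<dots> = cmod (f (\<i> * of_real t))" using fnz t t0 by simp
    also have "\<dots> \<le> cmod (F (\<i> * of_real (t + y)))"
      using c by (simp add: f_def norm_divide divide_le_eq distrib_left mult_le_cancel_left1)
    finally show "exp (- \<epsilon> * t) \<le> cmod (F (\<i> * of_real (t + y)))" .
  qed
qed

text \<open>
  The Phragmen-Lindelof principle for \<open>1/F\<close>.
\<close>

theorem F_lower_bound:
  assumes "y \<le> Im z"
  shows "sqrt m \<le> cmod (F z)"
proof -
  define G where "G z = 1 / F (z + \<i> * of_real y)" for z
  have nz: "F (z + \<i> * of_real y) \<noteq> 0" if "0 \<le> Im z" for z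
    using that y_pos by (intro F_nonzero) (auto simp: complex_eq_iff)
  have sm: "0 < sqrt m" using m_pos by simp
  have crude: "cmod (G z) \<le> exp (pi * Im z) / sqrt m" if "0 \<le> Im z" for z
  proof -
    have "exp (- pi * Im z) * sqrt m \<le> cmod (F (z + \<i> * of_real y))"
      using F_crude_lower[of "z + \<i> * of_real y"] that by simp
    then have "1 / cmod (F (z + \<i> * of_real y)) \<le> 1 / (exp (- pi * Im z) * sqrt m)"
      using sm by (intro divide_left_mono mult_pos_pos) (auto simp: nz[OF that])
    then show ?thesis by (simp add: G_def norm_divide exp_minus field_simps)
  qed
  have "cmod (G (z - \<i> * of_real y)) \<le> 1 / sqrt m"
  proof (rule phragmen_lindelof_half_plane[where f = G and C = "max pi (1 / sqrt m)"])
    show "G holomorphic_on {z. 0 \<le> Im z}"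
      unfolding G_def using nz by (intro holomorphic_intros holomorphic_F_shift) auto
    show "cmod (G z) \<le> max pi (1 / sqrt m) * exp (max pi (1 / sqrt m) * cmod z)" if "0 \<le> Im z" for z
    proof -
      have "cmod (G z) \<le> (1 / sqrt m) * exp (pi * Im z)" using crude[OF that] by simp
      also have "\<dots> \<le> max pi (1 / sqrt m) * exp (max pi (1 / sqrt m) * cmod z)"
        using that abs_Im_le_cmod[of z] by (intro mult_mono) (auto intro!: mult_mono intro: order_trans[OF pi_ge_zero])
      finally show ?thesis .
    qed
    show "cmod (G (of_real x)) \<le> 1 / sqrt m" for x
      using crude[of "of_real x"] by simp
    show "\<exists>K. \<forall>t\<ge>0. cmod (G (\<i> * of_real t)) \<le> K * exp (\<epsilon> * t)" if \<epsilon>: "0 < \<epsilon>" for \<epsilon>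
    proof -
      obtain t0 where t0: "0 < t0" "\<And>t. t0 \<le> t \<Longrightarrow> exp (- \<epsilon> * t) \<le> cmod (F (\<i> * of_real (t + y)))"
        using F_imaginary_subexponential[OF \<epsilon>] by blast
      define K where "K = exp (pi * t0) / sqrt m + 1"
      have "cmod (G (\<i> * of_real t)) \<le> K * exp (\<epsilon> * t)" if "0 \<le> t" for t
      proof (cases "t0 \<le> t")
        case True
        have "cmod (G (\<i> * of_real t)) = 1 / cmod (F (\<i> * of_real (t + y)))"
          by (simp add: G_def norm_divide distrib_left)
        also have "\<dots> \<le> 1 / exp (- \<epsilon> * t)"
          using t0(2)[OF True] by (intro divide_left_mono mult_pos_pos) (auto intro: less_le_trans)
        also have "\<dots> = 1 * exp (\<epsilon> * t)" by (simp add: exp_minus field_simps)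
        also have "\<dots> \<le> K * exp (\<epsilon> * t)" using sm by (intro mult_right_mono) (auto simp: K_def)
        finally show ?thesis .
      next
        case False
        have "cmod (G (\<i> * of_real t)) \<le> exp (pi * t) / sqrt m" using crude[of "\<i> * of_real t"] that by simp
        also have "\<dots> \<le> exp (pi * t0) / sqrt m" using False sm by (intro divide_right_mono) auto
        also have "\<dots> \<le> K * 1" by (simp add: K_def)
        also have "\<dots> \<le> K * exp (\<epsilon> * t)" using that \<epsilon> sm by (intro mult_left_mono) (auto simp: K_def intro!: add_nonneg_nonneg)
        finally show ?thesis .
      qed
      then show ?thesis by blast
    qed
  qed (use assms sm in auto)
  then have "1 / cmod (F z) \<le> 1 / sqrt m" by (simp add: G_def norm_divide)
  moreover have "0 < cmod (F z)" using nz[of "z - \<i> * of_real y"] assms by simp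
  ultimately show ?thesis using sm by (simp add: field_simps)
qed

lemma L_lower_bound: "y \<le> \<eta> \<Longrightarrow> exp (pi * \<eta>) * sqrt m \<le> cmod (L (Complex x \<eta>))"
  using F_lower_bound[of "Complex x \<eta>"] by (simp add: cmod_F exp_minus field_simps)

text \<open>
  The difference quotient of \<open>F\<close> at the zero \<open>\<kappa>\<close> in the direction \<open>i\<close> is bounded below by comparison with
  the point \<open>\<kappa> + iY\<close>. The freedom in \<open>Y\<close> is what yields the bound on the separation.
\<close>

lemma F_deriv_lower_bound:
  assumes \<kappa>: "\<kappa> \<in> \<Lambda>" and Y: "y \<le> Y"
  shows "exp (pi * Y) * exp (- pi * Y / d) * sqrt m / Y \<le> cmod (deriv F (of_real \<kappa>))"
proof -
  have Y0: "0 < Y" using Y y_pos by linarith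
  have "((\<lambda>\<eta>. (F (of_real \<kappa> + \<i> * of_real \<eta>) - F (of_real \<kappa>)) / (\<i> * of_real \<eta>)) \<longlongrightarrow> deriv F (of_real \<kappa>)) (at_right 0)"
  proof -
    have "(F has_field_derivative deriv F (of_real \<kappa>)) (at (of_real \<kappa>))"
      using holomorphic_derivI[OF holomorphic_F[of UNIV]] by simp
    then have "((\<lambda>h. (F (of_real \<kappa> + h) - F (of_real \<kappa>)) / h) \<longlongrightarrow> deriv F (of_real \<kappa>)) (at 0)"
      by (simp add: DERIV_def)
    moreover have "filterlim (\<lambda>\<eta>::real. \<i> * complex_of_real \<eta>) (at 0) (at_right 0)"
    proof (rule filterlim_atI)
      show "((\<lambda>\<eta>. \<i> * complex_of_real \<eta>) \<longlongrightarrow> 0) (at_right 0)"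
        by (rule tendsto_eq_intros refl)+ simp
      show "eventually (\<lambda>\<eta>. \<i> * complex_of_real \<eta> \<noteq> 0) (at_right 0)"
        using eventually_at_right_less[of "0::real"] by eventually_elim simp
    qed
    ultimately show ?thesis by (rule filterlim_compose)
  qed
  then have lim: "((\<lambda>\<eta>. cmod ((F (of_real \<kappa> + \<i> * of_real \<eta>) - F (of_real \<kappa>)) / (\<i> * of_real \<eta>))) \<longlongrightarrow> cmod (deriv F (of_real \<kappa>))) (at_right 0)"
    by (rule tendsto_norm)
  have lim': "((\<lambda>\<eta>. exp (- pi * \<eta>) * (exp (pi * Y) * exp (- pi * Y / d) * sqrt m / Y)) \<longlongrightarrow>
      exp (- pi * 0) * (exp (pi * Y) * exp (- pi * Y / d) * sqrt m / Y)) (at_right 0)"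
    by (intro tendsto_intros)
  have "exp (- pi * \<eta>) * (exp (pi * Y) * exp (- pi * Y / d) * sqrt m / Y)
      \<le> cmod ((F (of_real \<kappa> + \<i> * of_real \<eta>) - F (of_real \<kappa>)) / (\<i> * of_real \<eta>))" if \<eta>: "0 < \<eta>" for \<eta>
  proof -
    have "\<eta> / Y * exp (- pi * Y / d) * (exp (pi * Y) * sqrt m) \<le> \<eta> / Y * exp (- pi * Y / d) * cmod (L (Complex \<kappa> Y))"
      using \<eta> Y0 by (intro mult_left_mono L_lower_bound Y) auto
    also have "\<dots> \<le> cmod (L (Complex \<kappa> \<eta>))"
      using L_near_zero_ge[OF \<kappa> Y0, of \<eta>] \<eta> by simp
    finally have "(\<eta> / Y * exp (- pi * Y / d) * (exp (pi * Y) * sqrt m)) / \<eta> \<le> cmod (L (Complex \<kappa> \<eta>)) / \<eta>"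
      using \<eta> by (intro divide_right_mono) auto
    then have "exp (pi * Y) * exp (- pi * Y / d) * sqrt m / Y \<le> cmod (L (Complex \<kappa> \<eta>)) / \<eta>"
      using \<eta> by (simp add: mult_ac)
    then have "exp (- pi * \<eta>) * (exp (pi * Y) * exp (- pi * Y / d) * sqrt m / Y) \<le> exp (- pi * \<eta>) * (cmod (L (Complex \<kappa> \<eta>)) / \<eta>)"
      by (intro mult_left_mono) auto
    also have "\<dots> = cmod (F (Complex \<kappa> \<eta>)) / \<eta>" by (simp add: cmod_F)
    finally show ?thesis using \<eta> by (simp add: F_zero[OF \<kappa>] Complex_split norm_divide norm_mult)
  qed
  then have "eventually (\<lambda>\<eta>. exp (- pi * \<eta>) * (exp (pi * Y) * exp (- pi * Y / d) * sqrt m / Y)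
      \<le> cmod ((F (of_real \<kappa> + \<i> * of_real \<eta>) - F (of_real \<kappa>)) / (\<i> * of_real \<eta>))) (at_right 0)"
    using eventually_at_right_less[of "0::real"] by (auto elim: eventually_mono)
  then show ?thesis using tendsto_le[OF _ lim lim'] by simp
qed

lemma F_deriv_nonzero: "\<kappa> \<in> \<Lambda> \<Longrightarrow> deriv F (of_real \<kappa>) \<noteq> 0"
proof -
  assume "\<kappa> \<in> \<Lambda>"
  have "0 < exp (pi * y) * exp (- pi * y / d) * sqrt m / y" using y_pos m_pos by simp
  also have "\<dots> \<le> cmod (deriv F (of_real \<kappa>))" by (rule F_deriv_lower_bound[OF \<open>\<kappa> \<in> \<Lambda>\<close>]) simp
  finally show ?thesis by auto
qed

text \<open>
  For \<open>d > 1\<close> the lower bound for \<open>F'\<close> at a fixed zero would grow exponentially in \<open>Y\<close>.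
\<close>

lemma separation_le_one:
  assumes "\<Lambda> \<noteq> {}"
  shows "d \<le> 1"
proof (rule ccontr)
  assume "\<not> d \<le> 1"
  obtain \<kappa> where \<kappa>: "\<kappa> \<in> \<Lambda>" using assms by blast
  define c where "c = pi * (1 - 1 / d)"
  have c: "0 < c" using \<open>\<not> d \<le> 1\<close> by (simp add: c_def)
  define D where "D = cmod (deriv F (of_real \<kappa>)) / sqrt m"
  have *: "exp (c * Y) \<le> D * Y" if "y \<le> Y" for Y
  proof -
    have "0 < Y" using that y_pos by linarith
    have "exp (pi * Y) * exp (- pi * Y / d) = exp (c * Y)"
      by (simp add: c_def exp_add[symmetric] algebra_simps)
    then show ?thesis using F_deriv_lower_bound[OF \<kappa> that] \<open>0 < Y\<close> m_pos by (simp add: D_def field_simps)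
  qed
  \<comment> \<open>The quadratic Taylor polynomial of the exponential already beats the linear right-hand side.\<close>
  have quad: "(c * Y)\<^sup>2 / 2 \<le> exp (c * Y)" if "0 \<le> Y" for Y
    using exp_lower_Taylor_quadratic[of "c * Y"] that c by (smt (verit) mult_nonneg_nonneg)
  define Y where "Y = max y (2 * \<bar>D\<bar> / c\<^sup>2 + 1)"
  have Y: "y \<le> Y" "2 * \<bar>D\<bar> / c\<^sup>2 < Y" "0 < Y" using y_pos by (auto simp: Y_def)
  have "c\<^sup>2 * Y\<^sup>2 / 2 \<le> D * Y" using *[OF Y(1)] quad[of Y] Y(3) by (simp add: power_mult_distrib)
  then have "(c\<^sup>2 * Y / 2) * Y \<le> D * Y" by (simp add: power2_eq_square mult_ac)
  then have "c\<^sup>2 * Y / 2 \<le> D" using Y(3) by (rule mult_right_le_imp_le)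
  moreover have "\<bar>D\<bar> < c\<^sup>2 * Y / 2" using Y(2) c by (simp add: field_simps)
  ultimately show False by linarith
qed

text \<open>
  Below the line, \<open>F(z)\<close> behaves like \<open>exp(2\<pi>iz)\<close>: reflection in the real axis preserves \<open>|L|\<close> and reduces the
  claim to the upper half-plane, and in the strip \<open>|L|\<close> is largest on the boundary.
\<close>

lemma F_lower_half_plane_upper:
  assumes "Im z \<le> y"
  shows "cmod (F z * exp (- 2 * of_real pi * \<i> * z)) \<le> exp (4 * pi * y) * sqrt M"
proof -
  define x \<eta> where "x = Re z" and "\<eta> = Im z"
  have z: "z = Complex x \<eta>" by (simp add: x_def \<eta>_def)
  have eq: "cmod (F z * exp (- 2 * of_real pi * \<i> * z)) = exp (pi * \<eta>) * cmod (L (Complex x \<eta>))"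
    by (simp add: z norm_mult norm_exp_eq_Re cmod_F mult.assoc[symmetric] exp_add[symmetric])
  have Lu: "cmod (L (Complex x t)) \<le> exp (pi * t) * sqrt M" if "y \<le> t" for t
    using F_upper_bound[of "Complex x t"] that by (simp add: cmod_F exp_minus field_simps)
  show ?thesis
  proof (cases "- y \<le> \<eta>")
    case True
    have "exp (pi * \<eta>) * cmod (L (Complex x \<eta>)) \<le> exp (pi * y) * (exp (pi * y) * sqrt M)"
    proof (rule mult_mono)
      show "cmod (L (Complex x \<eta>)) \<le> exp (pi * y) * sqrt M"
      proof -
        have "\<bar>\<eta>\<bar> \<le> \<bar>y\<bar>" using True assms y_pos by (auto simp: \<eta>_def)
        from L_mono[OF this] show ?thesis using Lu[of y] by (rule order_trans) simp
      qed
    qed (use assms in \<open>auto simp: \<eta>_def\<close>)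
    also have "\<dots> = exp (2 * pi * y) * sqrt M" by (simp add: exp_add[symmetric] mult.assoc[symmetric])
    also have "\<dots> \<le> exp (4 * pi * y) * sqrt M" using y_pos M_pos by (intro mult_right_mono) auto
    finally show ?thesis using eq by simp
  next
    case False
    have "cmod (L (Complex x \<eta>)) \<le> exp (pi * - \<eta>) * sqrt M" using L_cnj[of x \<eta>] Lu[of "- \<eta>"] False by simp
    then have "exp (pi * \<eta>) * cmod (L (Complex x \<eta>)) \<le> exp (pi * \<eta>) * (exp (pi * - \<eta>) * sqrt M)"
      by (intro mult_left_mono) auto
    also have "\<dots> = 1 * sqrt M" by (simp add: mult.assoc[symmetric] exp_add[symmetric])
    also have "\<dots> \<le> exp (4 * pi * y) * sqrt M" using y_pos M_pos by (intro mult_right_mono) auto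
    finally show ?thesis using eq by simp
  qed
qed

text \<open>
  These are the points over which the rectangles of the residue argument run: outside the strip the
  lower bound for \<open>F\<close> applies, inside it the point has to stay away from the zeros.
\<close>

lemma F_contour_lower:
  assumes off: "y \<le> \<bar>Im z\<bar> \<or> (\<forall>\<mu>\<in>\<Lambda>. d / 2 \<le> \<bar>\<mu> - Re z\<bar>)"
  shows "exp (- 2 * pi * y / d) * sqrt m * exp (pi * (\<bar>Im z\<bar> - Im z)) \<le> exp (2 * pi * y) * cmod (F z)"
proof -
  define x \<eta> where "x = Re z" and "\<eta> = Im z"
  have z: "z = Complex x \<eta>" by (simp add: x_def \<eta>_def)
  have sm: "0 \<le> sqrt m" using m_pos by simp
  have e1: "exp (- 2 * pi * y / d) \<le> 1" using y_pos d_pos by simp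
  have L: "exp (- 2 * pi * y / d) * sqrt m * exp (pi * \<bar>\<eta>\<bar>) \<le> exp (2 * pi * y) * cmod (L (Complex x \<eta>))"
  proof (cases "y \<le> \<bar>\<eta>\<bar>")
    case True
    have "exp (- 2 * pi * y / d) * sqrt m * exp (pi * \<bar>\<eta>\<bar>) \<le> 1 * (exp (pi * \<bar>\<eta>\<bar>) * sqrt m)"
      using mult_right_mono[OF e1, of "sqrt m * exp (pi * \<bar>\<eta>\<bar>)"] sm by (simp add: mult_ac)
    also have "\<dots> \<le> 1 * cmod (L (Complex x \<eta>))"
      using L_lower_bound[OF True, of x] L_cnj[of x \<eta>] by (auto simp: abs_if split: if_splits)
    also have "\<dots> \<le> exp (2 * pi * y) * cmod (L (Complex x \<eta>))" using y_pos by (intro mult_right_mono) auto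
    finally show ?thesis .
  next
    case False
    then have "\<And>\<mu>. \<mu> \<in> \<Lambda> \<Longrightarrow> d / 2 \<le> \<bar>\<mu> - x\<bar>" using off by (auto simp: x_def \<eta>_def)
    moreover have "separated (d / 2) \<Lambda>" using separated d_pos by (force simp: separated_def)
    ultimately have "exp (- pi * y / (d / 2)) * cmod (L (Complex x y)) \<le> cmod (L (Complex x \<eta>))"
      using d_pos y_pos by (intro L_off_zeros_ge) auto
    then have 1: "exp (- 2 * pi * y / d) * cmod (L (Complex x y)) \<le> cmod (L (Complex x \<eta>))" by (simp add: mult_ac)
    have "exp (- 2 * pi * y / d) * sqrt m * exp (pi * \<bar>\<eta>\<bar>) \<le> exp (- 2 * pi * y / d) * sqrt m * exp (pi * y)"
      using False sm by (intro mult_left_mono) auto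
    also have "\<dots> \<le> exp (- 2 * pi * y / d) * cmod (L (Complex x y))"
      using mult_left_mono[OF L_lower_bound[of y x], of "exp (- 2 * pi * y / d)"] by (simp add: mult_ac)
    also note 1
    also have "cmod (L (Complex x \<eta>)) \<le> exp (2 * pi * y) * cmod (L (Complex x \<eta>))"
      using y_pos mult_right_mono[of 1 "exp (2 * pi * y)" "cmod (L (Complex x \<eta>))"] by simp
    finally show ?thesis .
  qed
  then have "(exp (- 2 * pi * y / d) * sqrt m * exp (pi * \<bar>\<eta>\<bar>)) * exp (- pi * \<eta>) \<le> (exp (2 * pi * y) * cmod (L (Complex x \<eta>))) * exp (- pi * \<eta>)"
    by (rule mult_right_mono) simp
  moreover have "exp (pi * (\<bar>\<eta>\<bar> - \<eta>)) = exp (pi * \<bar>\<eta>\<bar>) * exp (- pi * \<eta>)"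
    by (simp add: exp_add[symmetric] algebra_simps)
  ultimately show ?thesis by (simp add: z cmod_F mult_ac)
qed

end

section \<open>Cauchy's formula on a line\<close>

lemma integrable_inverse_one_plus_square: "integrable lborel (\<lambda>x::real. 1 / (1 + x\<^sup>2))"
  using integrable_inverse_1_plus_square by (simp add: set_integrable_def einterval_def inverse_eq_divide)

lemma integrable_line:
  fixes f :: "real \<Rightarrow> complex"
  assumes cont: "continuous_on UNIV f"
    and decay: "\<And>x. r \<le> \<bar>x\<bar> \<Longrightarrow> cmod (f x) \<le> C / x\<^sup>2"
  shows "integrable lborel f"
proof -
  define r' where "r' = max 1 r"
  obtain B where B: "\<And>x. x \<in> {-r'..r'} \<Longrightarrow> cmod (f x) \<le> B"
  proof -
    have "compact (f ` {-r'..r'})" by (intro compact_continuous_image continuous_on_subset[OF cont]) auto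
    then show ?thesis using that by (meson bounded_iff compact_imp_bounded imageI)
  qed
  define K where "K = max 0 B * (1 + r'\<^sup>2) + 2 * \<bar>C\<bar>"
  show ?thesis
  proof (rule Bochner_Integration.integrable_bound)
    show "integrable lborel (\<lambda>x::real. K * (1 / (1 + x\<^sup>2)))"
      by (intro integrable_mult_right integrable_inverse_one_plus_square)
    show "f \<in> borel_measurable lborel" using cont by (simp add: borel_measurable_continuous_onI)
    have "cmod (f x) \<le> K / (1 + x\<^sup>2)" for x
    proof (cases "\<bar>x\<bar> \<le> r'")
      case True
      then have "cmod (f x) \<le> B" using B[of x] by (auto simp: abs_le_iff)
      then have "cmod (f x) \<le> max 0 B" by simp
      moreover have "1 + x\<^sup>2 \<le> 1 + r'\<^sup>2" using True power_mono[of "\<bar>x\<bar>" r' 2] by simp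
      ultimately have "cmod (f x) * (1 + x\<^sup>2) \<le> max 0 B * (1 + r'\<^sup>2)" by (intro mult_mono) auto
      also have "\<dots> \<le> K" by (simp add: K_def)
      finally show ?thesis by (subst pos_le_divide_eq) (auto simp: add_pos_nonneg)
    next
      case False
      then have x: "1 \<le> x\<^sup>2" "r \<le> \<bar>x\<bar>" "0 < x\<^sup>2" using power_mono[of 1 "\<bar>x\<bar>" 2] by (auto simp: r'_def)
      have "cmod (f x) \<le> \<bar>C\<bar> / x\<^sup>2" using decay[OF x(2)] x(3) by (meson abs_ge_self divide_right_mono order_trans zero_le_power2)
      also have "\<dots> \<le> 2 * \<bar>C\<bar> / (1 + x\<^sup>2)"
      proof -
        have "\<bar>C\<bar> * (1 + x\<^sup>2) \<le> \<bar>C\<bar> * (2 * x\<^sup>2)" using x by (intro mult_left_mono) auto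
        then show ?thesis using x by (simp add: divide_simps add_pos_nonneg mult_ac)
      qed
      also have "\<dots> \<le> K / (1 + x\<^sup>2)" by (intro divide_right_mono) (auto simp: K_def)
      finally show ?thesis .
    qed
    then show "AE x in lborel. norm (f x) \<le> norm (K * (1 / (1 + x\<^sup>2)))"
      by (auto intro!: AE_I2 simp: K_def abs_mult)
  qed
qed

text \<open>
  The bottom side is kept because on the real axis it carries the integral of interest.
\<close>

lemma contour_integral_rectpath_minus_bottom:
  assumes ab: "Re a < Re b" "Im a < Im b"
    and cont: "continuous_on (path_image (rectpath a b)) f"
    and nonneg: "0 \<le> V" "0 \<le> U"
    and V: "\<And>z. Re z \<in> {Re a, Re b} \<Longrightarrow> Im z \<in> {Im a..Im b} \<Longrightarrow> cmod (f z) \<le> V"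
    and U: "\<And>z. Im z = Im b \<Longrightarrow> Re z \<in> {Re a..Re b} \<Longrightarrow> cmod (f z) \<le> U"
  shows "f contour_integrable_on linepath a (Complex (Re b) (Im a))"
    and "cmod (contour_integral (rectpath a b) f - contour_integral (linepath a (Complex (Re b) (Im a))) f)
      \<le> 2 * V * (Im b - Im a) + U * (Re b - Re a)"
proof -
  define a2 where "a2 = Complex (Re b) (Im a)"
  define a4 where "a4 = Complex (Re a) (Im b)"
  have rp: "rectpath a b = linepath a a2 +++ linepath a2 b +++ linepath b a4 +++ linepath a4 a"
    by (simp add: rectpath_def Let_def a2_def a4_def)
  have fc: "f contour_integrable_on p" if "p \<in> {linepath a a2, linepath a2 b, linepath b a4, linepath a4 a}" for p
  proof -
    have "path_image p \<subseteq> path_image (rectpath a b)"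
      using that by (auto simp: rp path_image_join)
    then have "continuous_on (path_image p) f" by (rule continuous_on_subset[OF cont])
    then show ?thesis using that by (auto intro: contour_integrable_continuous_linepath)
  qed
  then show "f contour_integrable_on linepath a (Complex (Re b) (Im a))" by (simp add: a2_def)
  have sum: "contour_integral (rectpath a b) f - contour_integral (linepath a a2) f
      = contour_integral (linepath a2 b) f + contour_integral (linepath b a4) f + contour_integral (linepath a4 a) f"
    unfolding rp using fc by (simp add: contour_integrable_join)
  have len: "cmod (b - a2) = Im b - Im a" "cmod (a4 - b) = Re b - Re a" "cmod (a - a4) = Im b - Im a"
    using ab by (simp_all add: a2_def a4_def cmod_def)
  have s2: "cmod (contour_integral (linepath a2 b) f) \<le> V * cmod (b - a2)"
  proof (rule contour_integral_bound_linepath[OF fc nonneg(1)])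
    fix z assume "z \<in> closed_segment a2 b"
    then show "cmod (f z) \<le> V" using ab
      by (intro V) (auto simp: a2_def closed_segment_same_Re closed_segment_eq_real_ivl)
  qed simp
  have s3: "cmod (contour_integral (linepath b a4) f) \<le> U * cmod (a4 - b)"
  proof (rule contour_integral_bound_linepath[OF fc nonneg(2)])
    fix z assume "z \<in> closed_segment b a4"
    then show "cmod (f z) \<le> U" using ab
      by (intro U) (auto simp: a4_def closed_segment_same_Im closed_segment_eq_real_ivl)
  qed simp
  have s4: "cmod (contour_integral (linepath a4 a) f) \<le> V * cmod (a - a4)"
  proof (rule contour_integral_bound_linepath[OF fc nonneg(1)])
    fix z assume "z \<in> closed_segment a4 a"
    then show "cmod (f z) \<le> V" using ab
      by (intro V) (auto simp: a4_def closed_segment_same_Re closed_segment_eq_real_ivl)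
  qed simp
  have "cmod (contour_integral (rectpath a b) f - contour_integral (linepath a a2) f)
      \<le> cmod (contour_integral (linepath a2 b) f) + cmod (contour_integral (linepath b a4) f) + cmod (contour_integral (linepath a4 a) f)"
    unfolding sum by (intro norm_triangle_mono order_refl)
  also have "\<dots> \<le> V * (Im b - Im a) + U * (Re b - Re a) + V * (Im b - Im a)"
    using s2 s3 s4 unfolding len by (intro add_mono)
  also have "\<dots> = 2 * V * (Im b - Im a) + U * (Re b - Re a)" by (simp add: algebra_simps)
  finally show "cmod (contour_integral (rectpath a b) f - contour_integral (linepath a (Complex (Re b) (Im a))) f)
      \<le> 2 * V * (Im b - Im a) + U * (Re b - Re a)" by (simp add: a2_def)
qed

text \<open>
  Cauchy's formula on the rectangle over \<open>[-R, R]\<close> of height \<open>R\<close>; the integrand is \<open>O(1/R\<^sup>2)\<close> on the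
  other three sides, whose total length is \<open>4R\<close>.
\<close>

lemma upper_half_plane_Cauchy:
  fixes g :: "complex \<Rightarrow> complex"
  assumes hol: "g holomorphic_on {z. 0 \<le> Im z}"
    and decay: "\<And>z. 0 \<le> Im z \<Longrightarrow> r \<le> cmod z \<Longrightarrow> cmod (g z) \<le> C / cmod z"
    and "Im w \<noteq> 0"
  shows "has_bochner_integral lborel (\<lambda>x. g (of_real x) / (of_real x - w)) (if 0 < Im w then 2 * of_real pi * \<i> * g w else 0)"
proof -
  define f where "f z = g z / (z - w)" for z
  define I where "I = (if 0 < Im w then 2 * of_real pi * \<i> * g w else 0)"
  have C0: "0 \<le> C"
  proof -
    have "cmod (g (of_real (\<bar>r\<bar> + 1))) \<le> C / cmod (complex_of_real (\<bar>r\<bar> + 1))"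
      by (rule decay) (auto simp only: Im_complex_of_real norm_of_real)
    then have "0 \<le> C / cmod (complex_of_real (\<bar>r\<bar> + 1))" by (rule order_trans[OF norm_ge_zero])
    then show ?thesis unfolding norm_of_real zero_le_divide_iff by linarith
  qed
  have far: "cmod (f z) \<le> 2 * C / (cmod z)\<^sup>2" if "0 \<le> Im z" "max r (2 * cmod w + 1) \<le> cmod z" for z
  proof -
    have z: "0 < cmod z" using that(2) norm_ge_zero[of w] by linarith
    have "cmod z / 2 \<le> cmod (z - w)" using that(2) norm_triangle_ineq2[of z w] by auto
    then have "cmod (f z) \<le> (C / cmod z) / (cmod z / 2)"
      unfolding f_def norm_divide using decay[of z] that z C0
      by (intro frac_le) auto
    also have "\<dots> = 2 * C / (cmod z)\<^sup>2" by (simp add: power2_eq_square)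
    finally show ?thesis .
  qed
  have cont: "continuous_on UNIV (\<lambda>x. f (of_real x))"
    unfolding f_def
    by (intro continuous_intros continuous_on_compose2[OF holomorphic_on_imp_continuous_on[OF hol]]) (use \<open>Im w \<noteq> 0\<close> in auto)
  have int: "integrable lborel (\<lambda>x. f (of_real x))"
    by (rule integrable_line[OF cont, of "max r (2 * cmod w + 1)" "2 * C"]) (use far[of "of_real _"] in auto)
  have rect: "cmod (integral {-R..R} (\<lambda>x. f (of_real x)) - I) \<le> 8 * C / R"
    if R: "max r (2 * cmod w + 1) \<le> R" for R
  proof -
    have R0: "0 < R" using R norm_ge_zero[of w] by linarith
    define a where "a = complex_of_real (- R)"
    define b where "b = Complex R R"
    have pim: "path_image (rectpath a b) \<subseteq> {z. 0 \<le> Im z} - {w}"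
      using R0 R \<open>Im w \<noteq> 0\<close> abs_Re_le_cmod[of w] abs_Im_le_cmod[of w]
      by (subst path_image_rectpath) (auto simp: a_def b_def)
    have I: "(f has_contour_integral I) (rectpath a b)"
    proof (cases "0 < Im w")
      case True
      have "w \<in> box a b"
        using R0 R True abs_Re_le_cmod[of w] abs_Im_le_cmod[of w] norm_ge_zero[of w]
        by (auto simp: in_box_complex_iff a_def b_def)
      then have "winding_number (rectpath a b) w = 1" by (rule winding_number_rectpath)
      moreover have "w \<in> interior {z. 0 \<le> Im z}"
      proof -
        have "{z. 0 < Im z} \<subseteq> interior {z. 0 \<le> Im z}"
          by (intro interior_maximal) (auto simp: open_halfspace_Im_gt)
        then show ?thesis using True by auto
      qed
      ultimately show ?thesis
        using Cauchy_integral_formula_convex_simple[OF convex_halfspace_Im_ge[of 0] hol _ _ pim] True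
        by (simp add: f_def[abs_def] I_def)
    next
      case False
      have "f holomorphic_on {z. 0 \<le> Im z}"
        unfolding f_def using False \<open>Im w \<noteq> 0\<close> by (intro holomorphic_intros hol) auto
      then show ?thesis
        using Cauchy_theorem_convex_simple[OF _ convex_halfspace_Im_ge[of 0] valid_path_rectpath, of f a b] pim False
        by (simp add: I_def subset_Diff_insert)
    qed
    have bnd: "cmod (f z) \<le> 2 * C / R\<^sup>2" if "0 \<le> Im z" "R \<le> cmod z" for z
    proof -
      have "cmod (f z) \<le> 2 * C / (cmod z)\<^sup>2" using far[of z] that R by auto
      also have "\<dots> \<le> 2 * C / R\<^sup>2" using that R0 C0 by (intro divide_left_mono power_mono mult_pos_pos) auto
      finally show ?thesis .
    qed
    have "continuous_on (path_image (rectpath a b)) f"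
      unfolding f_def using pim
      by (intro continuous_intros continuous_on_subset[OF holomorphic_on_imp_continuous_on[OF hol]]) auto
    then have "cmod (contour_integral (rectpath a b) f - contour_integral (linepath a (Complex (Re b) (Im a))) f)
        \<le> 2 * (2 * C / R\<^sup>2) * (Im b - Im a) + 2 * C / R\<^sup>2 * (Re b - Re a)"
    proof (rule contour_integral_rectpath_minus_bottom(2)[rotated 2])
      fix z assume "Re z \<in> {Re a, Re b}" "Im z \<in> {Im a..Im b}"
      then show "cmod (f z) \<le> 2 * C / R\<^sup>2"
        using R0 abs_Re_le_cmod[of z] by (intro bnd) (auto simp: a_def b_def)
    next
      fix z assume "Im z = Im b"
      then show "cmod (f z) \<le> 2 * C / R\<^sup>2"
        using R0 abs_Im_le_cmod[of z] by (intro bnd) (auto simp: b_def)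
    qed (use R0 C0 in \<open>auto simp: a_def b_def\<close>)
    also have "\<dots> = 8 * C / R"
      using R0 by (simp add: a_def b_def power2_eq_square)
    finally have "cmod (I - contour_integral (linepath a (Complex (Re b) (Im a))) f) \<le> 8 * C / R"
      using contour_integral_unique[OF I] by simp
    moreover have "contour_integral (linepath a (Complex (Re b) (Im a))) f = integral {-R..R} (\<lambda>x. f (of_real x))"
      using R0 contour_integral_linepath_Reals_eq[of a "Complex (Re b) (Im a)" f] by (simp add: a_def b_def complex_is_Real_iff)
    ultimately show ?thesis by (simp add: norm_minus_commute)
  qed
  have "(\<lambda>n. integral {-real n..real n} (\<lambda>x. f (of_real x))) \<longlonglongrightarrow> I"
  proof (rule LIM_zero_cancel, rule Lim_null_comparison)
    show "eventually (\<lambda>n. norm (integral {-real n..real n} (\<lambda>x. f (of_real x)) - I) \<le> 8 * C / real n) sequentially"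
      using eventually_ge_at_top[of "nat \<lceil>max r (2 * cmod w + 1)\<rceil>"]
    proof eventually_elim
      case (elim n)
      then show ?case by (intro rect) linarith
    qed
    show "(\<lambda>n. 8 * C / real n) \<longlonglongrightarrow> 0" by (intro tendsto_divide_0[OF tendsto_const] filterlim_real_at_infinity_sequentially)
  qed
  moreover have "(\<lambda>n. integral {-real n..real n} (\<lambda>x. f (of_real x))) \<longlonglongrightarrow> (LINT x|lborel. f (of_real x))"
  proof -
    have "(\<lambda>n. LINT x|lborel. indicator {-real n..real n} x *\<^sub>R f (of_real x)) \<longlonglongrightarrow> (LINT x|lborel. f (of_real x))"
    proof (rule integral_dominated_convergence[where w = "\<lambda>x. cmod (f (of_real x))"])
      show "AE x in lborel. (\<lambda>n. indicator {-real n..real n} x *\<^sub>R f (of_real x)) \<longlonglongrightarrow> f (of_real x)"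
      proof (intro AE_I2 tendsto_eventually)
        fix x :: real
        show "\<forall>\<^sub>F n in sequentially. indicator {-real n..real n} x *\<^sub>R f (of_real x) = f (of_real x)"
          using eventually_ge_at_top[of "nat \<lceil>\<bar>x\<bar>\<rceil>"] by eventually_elim (auto simp: indicator_def abs_le_iff)
      qed
    qed (use int in \<open>auto simp: indicator_def borel_measurable_integrable\<close>)
    moreover have "(LINT x|lborel. indicator {-real n..real n} x *\<^sub>R f (of_real x)) = integral {-real n..real n} (\<lambda>x. f (of_real x))" for n
    proof -
      have "set_integrable lborel {-real n..real n} (\<lambda>x. f (of_real x))"
        using int by (rule integrable_mult_indicator[of _ lborel, folded set_integrable_def, rotated]) simp
      from set_borel_integral_eq_integral(2)[OF this] show ?thesis by (simp add: set_lebesgue_integral_def)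
    qed
    ultimately show ?thesis by simp
  qed
  ultimately have "(LINT x|lborel. f (of_real x)) = I" using LIMSEQ_unique by blast
  then show ?thesis using int unfolding f_def I_def by (simp add: has_bochner_integral_iff)
qed

text \<open>
  The reflection \<open>z \<mapsto> - z\<close> exchanges the two half-planes.
\<close>

lemma lower_half_plane_Cauchy:
  fixes g :: "complex \<Rightarrow> complex"
  assumes hol: "g holomorphic_on {z. Im z \<le> 0}"
    and decay: "\<And>z. Im z \<le> 0 \<Longrightarrow> r \<le> cmod z \<Longrightarrow> cmod (g z) \<le> C / cmod z"
    and "Im w < 0"
  shows "has_bochner_integral lborel (\<lambda>x. g (of_real x) / (of_real x - w)) (- 2 * of_real pi * \<i> * g w)"
proof -
  have "has_bochner_integral lborel (\<lambda>x. (g \<circ> uminus) (of_real x) / (of_real x - - w))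
      (if 0 < Im (- w) then 2 * of_real pi * \<i> * (g \<circ> uminus) (- w) else 0)"
  proof (rule upper_half_plane_Cauchy)
    show "(g \<circ> uminus) holomorphic_on {z. 0 \<le> Im z}"
      by (rule holomorphic_on_compose_gen[OF _ hol]) (auto intro!: holomorphic_intros)
    show "cmod ((g \<circ> uminus) z) \<le> C / cmod z" if "0 \<le> Im z" "r \<le> cmod z" for z
      using decay[of "- z"] that by simp
  qed (use assms in auto)
  then have "has_bochner_integral lborel (\<lambda>x. g (of_real (0 + (-1) * x)) / (of_real (0 + (-1) * x) - w)) ((- 2 * of_real pi * \<i> * g w) /\<^sub>R \<bar>-1\<bar>)"
    using \<open>Im w < 0\<close> has_bochner_integral_minus
    by (fastforce simp: minus_divide_right minus_divide_left dest: has_bochner_integral_minus)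
  then show ?thesis
    by (subst (asm) lborel_has_bochner_integral_real_affine_iff[of "-1" _ _ 0, symmetric]) auto
qed

section \<open>Reproducing kernels and Cauchy kernels\<close>

abbreviation exp_sum :: "(real \<Rightarrow> complex) \<Rightarrow> real set \<Rightarrow> real \<Rightarrow> complex" where
  "exp_sum a S t \<equiv> \<Sum>\<mu>\<in>S. a \<mu> * exponential \<mu> t"

text \<open>
  The Laplace transform \<open>z \<mapsto> \<integral> exp(-2\<pi>izt) dt\<close> of the indicator of \<open>[0,1]\<close>; the singularity at 0 is removable.
\<close>

definition box_kernel :: "complex \<Rightarrow> complex" where
  "box_kernel z = (if z = 0 then 1 else (1 - exp (- 2 * of_real pi * \<i> * z)) / (2 * of_real pi * \<i> * z))"

lemma holomorphic_box_kernel: "box_kernel holomorphic_on A"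
proof -
  let ?g = "\<lambda>z. (1 - exp (- 2 * of_real pi * \<i> * z)) / (2 * of_real pi * \<i>)"
  have g: "?g holomorphic_on UNIV" by (intro holomorphic_intros) auto
  have "(?g has_field_derivative 1) (at 0)"
    by (rule derivative_eq_intros refl | simp)+
  then have d: "deriv ?g 0 = 1" by (rule DERIV_imp_deriv)
  have "box_kernel holomorphic_on UNIV"
  proof (rule pole_theorem_open_0[OF g open_UNIV])
    show "box_kernel 0 = deriv ?g 0" unfolding d by (simp add: box_kernel_def)
  qed (auto simp: box_kernel_def field_simps)
  then show ?thesis by (rule holomorphic_on_subset) auto
qed

lemma exp_mult_has_integral:
  fixes k :: complex
  assumes "k \<noteq> 0" "0 \<le> R"
  shows "((\<lambda>t. exp (k * of_real t)) has_integral (exp (k * of_real R) - 1) / k) {0..R}"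
proof -
  have "((\<lambda>t. exp (k * of_real t)) has_integral (exp (k * of_real R) / k - exp (k * of_real 0) / k)) {0..R}"
  proof (rule fundamental_theorem_of_calculus)
    fix t :: real
    have "((\<lambda>z. exp (k * z) / k) has_field_derivative exp (k * of_real t)) (at (of_real t))"
      by (rule derivative_eq_intros refl | use assms(1) in simp)+
    then show "((\<lambda>t. exp (k * of_real t) / k) has_vector_derivative exp (k * of_real t)) (at t within {0..R})"
      using has_vector_derivative_real_field has_vector_derivative_at_within by blast
  qed (rule assms(2))
  then show ?thesis by (simp add: diff_divide_distrib)
qed

lemma box_kernel_has_integral:
  "((\<lambda>t. exp (- 2 * of_real pi * \<i> * z * of_real t)) has_integral box_kernel z) {0..1}"
proof (cases "z = 0")
  case True
  then show ?thesis using has_integral_const_real[of "1::complex" 0 1] by (simp add: box_kernel_def)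
next
  case False
  define k where "k = - 2 * of_real pi * \<i> * z"
  have k: "k \<noteq> 0" using False by (simp add: k_def)
  have "((\<lambda>t. exp (k * of_real t)) has_integral (exp (k * of_real 1) - 1) / k) {0..1}"
    by (rule exp_mult_has_integral[OF k]) simp
  moreover have "(exp (k * of_real 1) - 1) / k = box_kernel z"
    using False by (simp add: box_kernel_def k_def field_simps)
  ultimately show ?thesis by (simp add: k_def)
qed

lemma cnj_box_kernel: "cnj (box_kernel z) = box_kernel (- cnj z)"
  by (simp add: box_kernel_def exp_cnj)

lemma decay_shift:
  fixes f :: "complex \<Rightarrow> complex"
  assumes "\<And>z. P z \<Longrightarrow> r \<le> cmod z \<Longrightarrow> cmod (f z) \<le> C / cmod z" "0 \<le> C" "P (z + a)"
    and "max (r + cmod a) (2 * cmod a + 1) \<le> cmod z"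
  shows "cmod (f (z + a)) \<le> 2 * C / cmod z"
proof -
  have tri: "cmod z - cmod a \<le> cmod (z + a)" using norm_triangle_ineq2[of z "- a"] by simp
  have z: "1 \<le> cmod z" "2 * cmod a \<le> cmod z" "r + cmod a \<le> cmod z" using assms(4) norm_ge_zero[of a] by (auto simp del: norm_ge_zero)
  have half: "cmod z / 2 \<le> cmod (z + a)" using tri z(2) by linarith
  have "cmod (f (z + a)) \<le> C / cmod (z + a)" using tri z(3) assms(3) by (intro assms(1)) auto
  also have "\<dots> \<le> C / (cmod z / 2)" using half z(1) \<open>0 \<le> C\<close> by (intro divide_left_mono mult_pos_pos) auto
  finally show ?thesis by (simp add: mult.commute)
qed

text \<open>
  A Paley-Wiener function with spectrum in \<open>[0,1]\<close> is recovered from its values on a horizontal line. Of the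
  two terms of the kernel, the constant one is integrated by closing the line upwards, where no pole lies,
  and the exponential one by closing it downwards, which picks up the pole at \<open>\<mu>\<close>. The two growth conditions are
  those under which the closing contours contribute nothing in the limit.
\<close>

lemma reproducing_formula:
  fixes \<Phi> :: "complex \<Rightarrow> complex"
  assumes hol: "\<Phi> holomorphic_on UNIV" and "0 < y" "0 \<le> C"
    and up: "\<And>z. y \<le> Im z \<Longrightarrow> r \<le> cmod z \<Longrightarrow> cmod (\<Phi> z) \<le> C / cmod z"
    and low: "\<And>z. Im z \<le> y \<Longrightarrow> r \<le> cmod z \<Longrightarrow> cmod (\<Phi> z * exp (- 2 * of_real pi * \<i> * z)) \<le> C / cmod z"
  shows "has_bochner_integral lborel (\<lambda>x. \<Phi> (Complex x y) * box_kernel (Complex x y - of_real \<mu>)) (\<Phi> (of_real \<mu>))"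
proof -
  define iy where "iy = \<i> * complex_of_real y"
  define w where "w = complex_of_real \<mu> - iy"
  have Imw: "Im w < 0" using \<open>0 < y\<close> by (simp add: w_def iy_def)
  have line: "Complex x y = of_real x + iy" for x by (simp add: iy_def complex_eq_iff)
  define c where "c = 2 * of_real pi * \<i>"
  have c: "c \<noteq> 0" by (simp add: c_def)
  define e where "e z = exp (- 2 * of_real pi * \<i> * z)" for z
  define r' where "r' = max (r + cmod iy) (2 * cmod iy + 1)"
  have shift: "(\<lambda>z. h (z + iy)) holomorphic_on A" if "h holomorphic_on UNIV" for h A
  proof -
    have "(\<lambda>z. z + iy) holomorphic_on A" by (intro holomorphic_intros)
    from holomorphic_on_compose[OF this] holomorphic_on_subset[OF that] show ?thesis by (auto simp: o_def)
  qed
  have "has_bochner_integral lborel (\<lambda>x. \<Phi> (of_real x + iy) / (of_real x - w))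
      (if 0 < Im w then 2 * of_real pi * \<i> * \<Phi> (w + iy) else 0)"
  proof (rule upper_half_plane_Cauchy[where C = "2 * C" and r = r'])
    show "cmod (\<Phi> (z + iy)) \<le> 2 * C / cmod z" if "0 \<le> Im z" "r' \<le> cmod z" for z
      by (rule decay_shift[where P = "\<lambda>z. y \<le> Im z" and r = r]) (use that up \<open>0 \<le> C\<close> in \<open>auto simp: r'_def iy_def\<close>)
  qed (use hol Imw in \<open>auto intro: shift\<close>)
  then have 1: "has_bochner_integral lborel (\<lambda>x. \<Phi> (of_real x + iy) / (of_real x - w)) 0"
    using Imw by simp
  have "has_bochner_integral lborel (\<lambda>x. (\<Phi> (of_real x + iy) * e (of_real x + iy)) / (of_real x - w))
      (- 2 * of_real pi * \<i> * (\<Phi> (w + iy) * e (w + iy)))"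
  proof (rule lower_half_plane_Cauchy[where C = "2 * C" and r = r'])
    show "cmod (\<Phi> (z + iy) * e (z + iy)) \<le> 2 * C / cmod z" if "Im z \<le> 0" "r' \<le> cmod z" for z
      using decay_shift[where P = "\<lambda>z. Im z \<le> y" and r = r and f = "\<lambda>z. \<Phi> z * e z" and C = C and a = iy and z = z] low \<open>0 \<le> C\<close> that
      by (simp add: r'_def iy_def e_def)
    have "(\<lambda>z. \<Phi> z * e z) holomorphic_on UNIV" unfolding e_def by (intro holomorphic_intros hol)
    then show "(\<lambda>z. \<Phi> (z + iy) * e (z + iy)) holomorphic_on {z. Im z \<le> 0}" by (rule shift)
  qed (rule Imw)
  then have 2: "has_bochner_integral lborel (\<lambda>x. (\<Phi> (of_real x + iy) * e (of_real x + iy)) / (of_real x - w))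
      (- c * (\<Phi> (of_real \<mu>) * e (of_real \<mu>)))"
    by (simp add: w_def c_def)
  have "has_bochner_integral lborel (\<lambda>x. (1 / c) * (\<Phi> (of_real x + iy) / (of_real x - w))
      - (e (- of_real \<mu>) / c) * ((\<Phi> (of_real x + iy) * e (of_real x + iy)) / (of_real x - w)))
      ((1 / c) * 0 - (e (- of_real \<mu>) / c) * (- c * (\<Phi> (of_real \<mu>) * e (of_real \<mu>))))"
    by (intro has_bochner_integral_diff has_bochner_integral_mult_right) (use 1 2 in auto)
  moreover have "(1 / c) * (\<Phi> (of_real x + iy) / (of_real x - w))
      - (e (- of_real \<mu>) / c) * ((\<Phi> (of_real x + iy) * e (of_real x + iy)) / (of_real x - w))
      = \<Phi> (Complex x y) * box_kernel (Complex x y - of_real \<mu>)" for x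
  proof -
    have ne: "of_real x + iy - of_real \<mu> \<noteq> 0" using \<open>0 < y\<close> by (auto simp: iy_def complex_eq_iff)
    \<comment> \<open>This splits the numerator of the kernel into the term that is closed upwards and the one closed downwards.\<close>
    have ee: "e (of_real x + iy - of_real \<mu>) = e (- of_real \<mu>) * e (of_real x + iy)"
      by (simp add: e_def exp_add[symmetric] algebra_simps)
    have "box_kernel (of_real x + iy - of_real \<mu>) = (1 - e (- of_real \<mu>) * e (of_real x + iy)) / (c * (of_real x - w))"
      using ne unfolding box_kernel_def e_def[symmetric] c_def[symmetric] ee by (simp add: w_def algebra_simps)
    then show ?thesis unfolding line using c by (simp add: diff_divide_distrib right_diff_distrib mult_ac)
  qed
  moreover have "(1 / c) * 0 - (e (- of_real \<mu>) / c) * (- c * (\<Phi> (of_real \<mu>) * e (of_real \<mu>))) = \<Phi> (of_real \<mu>)"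
  proof -
    have "e (- of_real \<mu>) * e (of_real \<mu>) = 1" by (simp add: e_def exp_add[symmetric])
    then show ?thesis using c by (simp add: mult.left_commute[of _ "\<Phi> _"] mult.commute)
  qed
  ultimately show ?thesis by simp
qed

lemma cmod_sum_square:
  fixes a b :: "'i \<Rightarrow> complex"
  shows "complex_of_real ((cmod (\<Sum>i\<in>S. a i))\<^sup>2) = (\<Sum>i\<in>S. \<Sum>j\<in>S. a i * cnj (a j))"
  by (simp only: complex_norm_square cnj_sum sum_product)

text \<open>
  The conjugate of \<open>box_kernel (z - \<nu>)\<close> on the line is again a function to which the reproducing
  formula applies, so the inner product of two kernels is the value of one of them, which is the
  integral over \<open>[0,1]\<close> of the product of the two exponentials.
\<close>

lemma Plancherel_exponential_sum:
  fixes S :: "real set" and a :: "real \<Rightarrow> complex"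
  assumes "0 < y"
  shows "has_bochner_integral lborel (\<lambda>x. (cmod (\<Sum>\<mu>\<in>S. a \<mu> * box_kernel (Complex x y - of_real \<mu>)))\<^sup>2)
    (integral {0..1} (\<lambda>t. (cmod (exp_sum a S t))\<^sup>2 * exp (4 * pi * y * t)))"
proof -
  define c where "c \<mu> \<nu> = a \<mu> * cnj (a \<nu>) * box_kernel (of_real \<nu> - of_real \<mu> + 2 * \<i> * of_real y)" for \<mu> \<nu>
  have pair: "has_bochner_integral lborel
      (\<lambda>x. a \<mu> * box_kernel (Complex x y - of_real \<mu>) * cnj (a \<nu> * box_kernel (Complex x y - of_real \<nu>))) (c \<mu> \<nu>)" for \<mu> \<nu>
  proof -
    define p where "p = complex_of_real \<nu> + 2 * \<i> * of_real y"
    \<comment> \<open>On the line at height \<open>y\<close> this is the conjugate of \<open>box_kernel (z - \<nu>)\<close>.\<close>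
    define \<Psi> where "\<Psi> z = box_kernel (p - z)" for z
    define r where "r = 2 * cmod p + 1"
    define C where "C = (exp (4 * pi * y) + 1) / pi * exp (2 * pi * y)"
    have C: "0 \<le> C" by (simp add: C_def)
    have dist: "p - z \<noteq> 0" "cmod z / 2 \<le> cmod (p - z)" "0 < cmod z" if "r \<le> cmod z" for z
    proof -
      have "cmod z - cmod p \<le> cmod (p - z)" using norm_triangle_ineq2[of z p] by (simp add: norm_minus_commute)
      then show "cmod z / 2 \<le> cmod (p - z)" "0 < cmod z" using that norm_ge_zero[of p] unfolding r_def by linarith+
      then show "p - z \<noteq> 0" by auto
    qed
    have frac: "cmod (u / (2 * of_real pi * \<i> * (p - z))) \<le> C / cmod z"
      if "r \<le> cmod z" "cmod u \<le> (exp (4 * pi * y) + 1) * exp (2 * pi * y)" for u z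
    proof -
      have "cmod (u / (2 * of_real pi * \<i> * (p - z))) = cmod u / (2 * pi * cmod (p - z))"
        by (simp add: norm_divide norm_mult)
      also have "\<dots> \<le> ((exp (4 * pi * y) + 1) * exp (2 * pi * y)) / (2 * pi * (cmod z / 2))"
        using that(2) dist[OF that(1)] by (intro frac_le mult_left_mono) auto
      also have "\<dots> = C / cmod z" by (simp add: C_def)
      finally show ?thesis .
    qed
    have "has_bochner_integral lborel (\<lambda>x. \<Psi> (Complex x y) * box_kernel (Complex x y - of_real \<mu>)) (\<Psi> (of_real \<mu>))"
    proof (rule reproducing_formula[where r = r and C = C])
      have "(\<lambda>z. p - z) holomorphic_on UNIV" by (intro holomorphic_intros)
      from holomorphic_on_compose[OF this holomorphic_box_kernel]
      show "\<Psi> holomorphic_on UNIV" by (simp add: o_def \<Psi>_def[abs_def])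
    next
      fix z assume z: "y \<le> Im z" "r \<le> cmod z"
      have "cmod (1 - exp (- 2 * of_real pi * \<i> * (p - z))) \<le> 1 + exp (2 * pi * Im (p - z))"
        using norm_triangle_ineq4[of 1 "exp (- 2 * of_real pi * \<i> * (p - z))"] by (simp add: norm_exp_eq_Re)
      also have "\<dots> \<le> 1 + exp (4 * pi * y)" using z(1) \<open>0 < y\<close> by (simp add: p_def)
      also have "\<dots> \<le> (exp (4 * pi * y) + 1) * exp (2 * pi * y)"
      proof -
        have "(exp (4 * pi * y) + 1) * 1 \<le> (exp (4 * pi * y) + 1) * exp (2 * pi * y)"
          using \<open>0 < y\<close> by (intro mult_left_mono) auto
        then show ?thesis by simp
      qed
      finally show "cmod (\<Psi> z) \<le> C / cmod z"
        using frac[OF z(2)] dist[OF z(2)] by (simp add: \<Psi>_def box_kernel_def)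
    next
      fix z assume z: "Im z \<le> y" "r \<le> cmod z"
      have "cmod ((1 - exp (- 2 * of_real pi * \<i> * (p - z))) * exp (- 2 * of_real pi * \<i> * z))
          = cmod (exp (- 2 * of_real pi * \<i> * z) - exp (- 2 * of_real pi * \<i> * p))"
        by (simp add: left_diff_distrib exp_add[symmetric] algebra_simps)
      also have "\<dots> \<le> exp (2 * pi * Im z) + exp (2 * pi * Im p)"
        using norm_triangle_ineq4[of "exp (- 2 * of_real pi * \<i> * z)" "exp (- 2 * of_real pi * \<i> * p)"] by (simp add: norm_exp_eq_Re)
      also have "\<dots> \<le> exp (2 * pi * y) + exp (4 * pi * y)"
      proof (rule add_mono)
        show "exp (2 * pi * Im z) \<le> exp (2 * pi * y)" using z(1) by simp
        show "exp (2 * pi * Im p) \<le> exp (4 * pi * y)" by (simp add: p_def)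
      qed
      also have "\<dots> \<le> (exp (4 * pi * y) + 1) * exp (2 * pi * y)"
        using \<open>0 < y\<close> by (simp add: distrib_right mult_le_cancel_left1)
      finally have "cmod (((1 - exp (- 2 * of_real pi * \<i> * (p - z))) * exp (- 2 * of_real pi * \<i> * z)) / (2 * of_real pi * \<i> * (p - z))) \<le> C / cmod z"
        by (rule frac[OF z(2)])
      then show "cmod (\<Psi> z * exp (- 2 * of_real pi * \<i> * z)) \<le> C / cmod z"
        using dist[OF z(2)] by (simp add: \<Psi>_def box_kernel_def)
    qed (use C \<open>0 < y\<close> in auto)
    then have "has_bochner_integral lborel (\<lambda>x. a \<mu> * cnj (a \<nu>) * (\<Psi> (Complex x y) * box_kernel (Complex x y - of_real \<mu>))) (a \<mu> * cnj (a \<nu>) * \<Psi> (of_real \<mu>))"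
      by (intro has_bochner_integral_mult_right) auto
    moreover have "\<Psi> (Complex x y) = cnj (box_kernel (Complex x y - of_real \<nu>))" for x
    proof -
      have "- cnj (Complex x y - of_real \<nu>) = p - Complex x y" by (simp add: p_def complex_eq_iff)
      then show ?thesis unfolding cnj_box_kernel \<Psi>_def by simp
    qed
    moreover have "\<Psi> (of_real \<mu>) = box_kernel (of_real \<nu> - of_real \<mu> + 2 * \<i> * of_real y)"
      by (simp add: \<Psi>_def p_def algebra_simps)
    ultimately show ?thesis by (simp add: c_def mult_ac)
  qed
  have "has_bochner_integral lborel (\<lambda>x. complex_of_real ((cmod (\<Sum>\<mu>\<in>S. a \<mu> * box_kernel (Complex x y - of_real \<mu>)))\<^sup>2))
      (\<Sum>\<mu>\<in>S. \<Sum>\<nu>\<in>S. c \<mu> \<nu>)"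
    unfolding cmod_sum_square by (intro has_bochner_integral_sum pair)
  then have 1: "has_bochner_integral lborel (\<lambda>x. (cmod (\<Sum>\<mu>\<in>S. a \<mu> * box_kernel (Complex x y - of_real \<mu>)))\<^sup>2)
      (Re (\<Sum>\<mu>\<in>S. \<Sum>\<nu>\<in>S. c \<mu> \<nu>))"
    by (drule_tac has_bochner_integral_bounded_linear[OF bounded_linear_Re]) simp
  have "((\<lambda>t. a \<mu> * exponential \<mu> t * cnj (a \<nu> * exponential \<nu> t) * exp (of_real (4 * pi * y * t))) has_integral c \<mu> \<nu>) {0..1}" for \<mu> \<nu>
  proof -
    have "a \<mu> * exponential \<mu> t * cnj (a \<nu> * exponential \<nu> t) * exp (of_real (4 * pi * y * t))
       = a \<mu> * cnj (a \<nu>) * exp (- 2 * of_real pi * \<i> * (of_real \<nu> - of_real \<mu> + 2 * \<i> * of_real y) * of_real t)" for t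
      by (simp add: exponential_def exp_cnj exp_add[symmetric] algebra_simps flip: exp_of_real)
    then show ?thesis unfolding c_def by (simp only:) (intro has_integral_mult_right box_kernel_has_integral)
  qed
  then have "((\<lambda>t. (\<Sum>\<mu>\<in>S. \<Sum>\<nu>\<in>S. a \<mu> * exponential \<mu> t * cnj (a \<nu> * exponential \<nu> t) * exp (of_real (4 * pi * y * t)))) has_integral (\<Sum>\<mu>\<in>S. \<Sum>\<nu>\<in>S. c \<mu> \<nu>)) {0..1}"
    if "finite S" using that by (intro has_integral_sum) auto
  then have "((\<lambda>t. complex_of_real ((cmod (exp_sum a S t))\<^sup>2 * exp (4 * pi * y * t))) has_integral (\<Sum>\<mu>\<in>S. \<Sum>\<nu>\<in>S. c \<mu> \<nu>)) {0..1}"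
    unfolding of_real_mult cmod_sum_square exp_of_real[symmetric] sum_distrib_right
    by (cases "finite S") auto
  then have "((\<lambda>t. (cmod (exp_sum a S t))\<^sup>2 * exp (4 * pi * y * t)) has_integral Re (\<Sum>\<mu>\<in>S. \<Sum>\<nu>\<in>S. c \<mu> \<nu>)) {0..1}"
    by (drule_tac has_integral_linear[OF _ bounded_linear_Re]) (simp add: o_def)
  then show ?thesis using 1 by (simp add: integral_unique)
qed

lemma Cauchy_kernel_pairing:
  assumes "0 < y"
  shows "has_bochner_integral lborel (\<lambda>x. 1 / ((Complex x y - of_real \<kappa>) * (Complex x (- y) - of_real \<mu>)))
    (2 * of_real pi * \<i> / (of_real (\<mu> - \<kappa>) + 2 * \<i> * of_real y))"
proof -
  define p where "p = of_real \<kappa> - \<i> * complex_of_real y"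
  define w where "w = of_real \<mu> + \<i> * complex_of_real y"
  have "has_bochner_integral lborel (\<lambda>x. (1 / (of_real x - p)) / (of_real x - w)) (if 0 < Im w then 2 * of_real pi * \<i> * (1 / (w - p)) else 0)"
  proof (rule upper_half_plane_Cauchy[where C = 2 and r = "2 * cmod p + 1"])
    have "z - p \<noteq> 0" if "0 \<le> Im z" for z using that assms by (auto simp: p_def complex_eq_iff)
    then show "(\<lambda>z. 1 / (z - p)) holomorphic_on {z. 0 \<le> Im z}" by (intro holomorphic_intros) auto
    fix z assume z: "2 * cmod p + 1 \<le> cmod z"
    have "cmod z / 2 \<le> cmod (z - p)" "0 < cmod z" using z norm_triangle_ineq2[of z p] norm_ge_zero[of p] by linarith+
    then have "1 / cmod (z - p) \<le> 1 / (cmod z / 2)" by (intro divide_left_mono mult_pos_pos) auto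
    then show "cmod (1 / (z - p)) \<le> 2 / cmod z" by (simp add: norm_divide)
  qed (use assms in \<open>simp add: w_def\<close>)
  moreover have "Complex x y - of_real \<kappa> = of_real x - p" "Complex x (- y) - of_real \<mu> = of_real x - w" for x
    by (simp_all add: p_def w_def complex_eq_iff)
  moreover have "w - p = of_real (\<mu> - \<kappa>) + 2 * \<i> * of_real y" by (simp add: w_def p_def)
  moreover have "0 < Im w" using assms by (simp add: w_def)
  ultimately show ?thesis by simp
qed

lemma Cauchy_kernel_sum_norm:
  fixes c :: "real \<Rightarrow> complex"
  assumes "0 < y" "\<bar>\<sigma>\<bar> = 1"
  shows "has_bochner_integral lborel (\<lambda>x. (cmod (\<Sum>\<kappa>\<in>S. c \<kappa> / (Complex x (\<sigma> * y) - of_real \<kappa>)))\<^sup>2)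
    (Re (\<Sum>\<kappa>\<in>S. \<Sum>\<mu>\<in>S. c \<kappa> * cnj (c \<mu>) * (2 * of_real pi * \<i> / (of_real (\<sigma> * (\<mu> - \<kappa>)) + 2 * \<i> * of_real y))))"
proof -
  have pair: "has_bochner_integral lborel
      (\<lambda>x. c \<kappa> / (Complex x (\<sigma> * y) - of_real \<kappa>) * cnj (c \<mu> / (Complex x (\<sigma> * y) - of_real \<mu>)))
      (c \<kappa> * cnj (c \<mu>) * (2 * of_real pi * \<i> / (of_real (\<sigma> * (\<mu> - \<kappa>)) + 2 * \<i> * of_real y)))" for \<kappa> \<mu>
  proof -
    have eq: "c \<kappa> / (Complex x (\<sigma> * y) - of_real \<kappa>) * cnj (c \<mu> / (Complex x (\<sigma> * y) - of_real \<mu>))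
      = c \<kappa> * cnj (c \<mu>) * (1 / ((Complex x (\<sigma> * y) - of_real \<kappa>) * (Complex x (- (\<sigma> * y)) - of_real \<mu>)))" for x
    proof -
      have "cnj (Complex x (\<sigma> * y)) = Complex x (- (\<sigma> * y))" by (simp add: complex_eq_iff)
      then show ?thesis by simp
    qed
    consider "\<sigma> = 1" | "\<sigma> = -1" using assms(2) by linarith
    then show ?thesis
    proof cases
      case 1
      then show ?thesis unfolding eq using Cauchy_kernel_pairing[OF assms(1), of \<kappa> \<mu>]
        by (intro has_bochner_integral_mult_right) auto
    next
      case 2
      then show ?thesis unfolding eq using Cauchy_kernel_pairing[OF assms(1), of \<mu> \<kappa>]
        by (intro has_bochner_integral_mult_right) (auto simp: mult.commute)
    qed
  qed
  have "has_bochner_integral lborel (\<lambda>x. complex_of_real ((cmod (\<Sum>\<kappa>\<in>S. c \<kappa> / (Complex x (\<sigma> * y) - of_real \<kappa>)))\<^sup>2))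
      (\<Sum>\<kappa>\<in>S. \<Sum>\<mu>\<in>S. c \<kappa> * cnj (c \<mu>) * (2 * of_real pi * \<i> / (of_real (\<sigma> * (\<mu> - \<kappa>)) + 2 * \<i> * of_real y)))"
    unfolding cmod_sum_square by (intro has_bochner_integral_sum pair)
  then show ?thesis
    by (drule_tac has_bochner_integral_bounded_linear[OF bounded_linear_Re]) simp
qed

text \<open>
  The Gram matrix \<open>2\<pi>i / (\<mu> - \<kappa> + 2iy)\<close> decays too slowly for Schur's test. The squared norm on the conjugate
  line is nonnegative and has the conjugate matrix, and the sum of the two matrices is the
  Poisson kernel, which is positive and decays quadratically.
\<close>

lemma Cauchy_kernel_sum_le:
  fixes S :: "real set" and c :: "real \<Rightarrow> complex"
  assumes "finite S" "0 < d" "separated d S" "0 < y" "\<bar>\<sigma>\<bar> = 1"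
  shows "(LINT x|lborel. (cmod (\<Sum>\<kappa>\<in>S. c \<kappa> / (Complex x (\<sigma> * y) - of_real \<kappa>)))\<^sup>2)
    \<le> 2 * pi * (1 / y + 16 * y / d\<^sup>2) * (\<Sum>\<kappa>\<in>S. (cmod (c \<kappa>))\<^sup>2)"
proof -
  let ?I = "\<lambda>\<sigma>. LINT x|lborel. (cmod (\<Sum>\<kappa>\<in>S. c \<kappa> / (Complex x (\<sigma> * y) - of_real \<kappa>)))\<^sup>2"
  have I: "?I \<sigma> = Re (\<Sum>\<kappa>\<in>S. \<Sum>\<mu>\<in>S. c \<kappa> * cnj (c \<mu>) * (2 * of_real pi * \<i> / (of_real (\<sigma> * (\<mu> - \<kappa>)) + 2 * \<i> * of_real y)))"
    if "\<bar>\<sigma>\<bar> = 1" for \<sigma>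
    using Cauchy_kernel_sum_norm[OF assms(4) that] by (rule has_bochner_integral_integral_eq)
  have k: "2 * of_real pi * \<i> / (of_real \<Delta> + 2 * \<i> * of_real y) + 2 * of_real pi * \<i> / (of_real (- \<Delta>) + 2 * \<i> * of_real y)
      = of_real (8 * pi * y / (4 * y\<^sup>2 + \<Delta>\<^sup>2))" for \<Delta> :: real
  proof -
    have ne: "of_real \<Delta> + 2 * \<i> * of_real y \<noteq> 0" "of_real (- \<Delta>) + 2 * \<i> * of_real y \<noteq> 0"
      using assms(4) by (auto simp: complex_eq_iff)
    have prod: "(of_real \<Delta> + 2 * \<i> * of_real y) * (of_real (- \<Delta>) + 2 * \<i> * of_real y) = - of_real (4 * y\<^sup>2 + \<Delta>\<^sup>2)"
      by (simp add: power2_eq_square algebra_simps)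
    have "2 * of_real pi * \<i> / (of_real \<Delta> + 2 * \<i> * of_real y) + 2 * of_real pi * \<i> / (of_real (- \<Delta>) + 2 * \<i> * of_real y)
        = (2 * of_real pi * \<i> * (4 * \<i> * of_real y)) / ((of_real \<Delta> + 2 * \<i> * of_real y) * (of_real (- \<Delta>) + 2 * \<i> * of_real y))"
      unfolding add_frac_eq[OF ne] by (simp add: algebra_simps)
    also have "\<dots> = of_real (8 * pi * y / (4 * y\<^sup>2 + \<Delta>\<^sup>2))"
    proof -
      have "2 * of_real pi * \<i> * (4 * \<i> * of_real y) = - complex_of_real (8 * pi * y)" by (simp add: mult_ac)
      then show ?thesis unfolding prod by (simp only: minus_divide_divide of_real_divide)
    qed
    finally show ?thesis .
  qed
  have "?I 1 + ?I (-1) = Re (\<Sum>\<kappa>\<in>S. \<Sum>\<mu>\<in>S. c \<kappa> * cnj (c \<mu>) * of_real (8 * pi * y / (4 * y\<^sup>2 + (\<mu> - \<kappa>)\<^sup>2)))"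
  proof -
    let ?q = "\<lambda>\<Delta>. 2 * of_real pi * \<i> / (of_real \<Delta> + 2 * \<i> * complex_of_real y)"
    have "?I 1 = Re (\<Sum>\<kappa>\<in>S. \<Sum>\<mu>\<in>S. c \<kappa> * cnj (c \<mu>) * ?q (\<mu> - \<kappa>))"
      and "?I (-1) = Re (\<Sum>\<kappa>\<in>S. \<Sum>\<mu>\<in>S. c \<kappa> * cnj (c \<mu>) * ?q (- (\<mu> - \<kappa>)))"
      by (subst I; simp)+
    then have "?I 1 + ?I (-1) = Re (\<Sum>\<kappa>\<in>S. \<Sum>\<mu>\<in>S. c \<kappa> * cnj (c \<mu>) * (?q (\<mu> - \<kappa>) + ?q (- (\<mu> - \<kappa>))))"
      by (simp only: plus_complex.sel[symmetric] sum.distrib[symmetric] distrib_left[symmetric])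
    then show ?thesis by (simp only: k)
  qed
  also have "\<dots> \<le> 2 * pi * (1 / y + 16 * y / d\<^sup>2) * (\<Sum>\<kappa>\<in>S. (cmod (c \<kappa>))\<^sup>2)"
    using Schur_test_separated[OF assms(1-4)] by simp
  finally have sum: "?I 1 + ?I (-1) \<le> 2 * pi * (1 / y + 16 * y / d\<^sup>2) * (\<Sum>\<kappa>\<in>S. (cmod (c \<kappa>))\<^sup>2)" .
  have nonneg: "0 \<le> ?I s" for s by simp
  consider "\<sigma> = 1" | "\<sigma> = -1" using assms(5) by linarith
  then show ?thesis
  proof cases
    case 1
    show ?thesis unfolding 1 using sum nonneg[of "-1"] by linarith
  next
    case 2
    show ?thesis unfolding 2 using sum nonneg[of 1] by linarith
  qed
qed

section \<open>Riesz inequalities for exponential sums\<close>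

lemma continuous_exponential: "continuous_on A (exponential \<mu>)"
  unfolding exponential_def by (intro continuous_intros)

lemma L2_norm_square_continuous:
  fixes f :: "real \<Rightarrow> complex"
  assumes "continuous_on {0..1} f"
  shows "(L2_norm (lebesgue_on {0..1}) f)\<^sup>2 = integral {0..1} (\<lambda>t. (cmod (f t))\<^sup>2)"
proof -
  have "integrable (lebesgue_on {0..1}) (\<lambda>t. (cmod (f t))\<^sup>2)"
    by (intro continuous_imp_integrable_real continuous_intros assms)
  then have "(LINT t|lebesgue_on {0..1}. (cmod (f t))\<^sup>2) = integral {0..1} (\<lambda>t. (cmod (f t))\<^sup>2)"
    by (rule lebesgue_integral_eq_integral) simp
  moreover have "0 \<le> (LINT t|lebesgue_on {0..1}. (cmod (f t))\<^sup>2)" by simp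
  ultimately show ?thesis by (simp add: L2_norm_def)
qed

text \<open>
  On \<open>[0,1]\<close> the weight \<open>exp(-4\<pi>t)\<close> is bounded below, and the weighted integral over the half-line is the
  Gram form of the Cauchy kernels at distance 1 from the real axis.
\<close>

lemma exponential_sum_upper_bound:
  fixes S :: "real set" and a :: "real \<Rightarrow> complex"
  assumes "finite S" "0 < d" "separated d S"
  shows "integral {0..1} (\<lambda>t. (cmod (exp_sum a S t))\<^sup>2)
    \<le> exp (4 * pi) * (1 + 16 / d\<^sup>2) / (2 * pi) * (\<Sum>\<mu>\<in>S. (cmod (a \<mu>))\<^sup>2)"
proof -
  define h where "h t = exp_sum a S t" for t
  define k where "k \<mu> \<nu> = 2 * of_real pi * \<i> * (of_real (\<mu> - \<nu>) + 2 * \<i>)" for \<mu> \<nu> :: real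
  have k0: "k \<mu> \<nu> \<noteq> 0" for \<mu> \<nu> by (auto simp: k_def complex_eq_iff)
  have Rek: "Re (k \<mu> \<nu>) = - 4 * pi" for \<mu> \<nu> by (simp add: k_def)
  have conth: "continuous_on A h" for A
    unfolding h_def by (intro continuous_intros continuous_exponential)
  have int: "((\<lambda>t. (cmod (h t))\<^sup>2 * exp (- 4 * pi * t)) has_integral
      Re (\<Sum>\<mu>\<in>S. \<Sum>\<nu>\<in>S. a \<mu> * cnj (a \<nu>) * ((exp (k \<mu> \<nu> * of_real R) - 1) / k \<mu> \<nu>))) {0..R}" if "0 \<le> R" for R
  proof -
    have "((\<lambda>t. a \<mu> * exponential \<mu> t * cnj (a \<nu> * exponential \<nu> t) * exp (of_real (- 4 * pi * t)))
        has_integral a \<mu> * cnj (a \<nu>) * ((exp (k \<mu> \<nu> * of_real R) - 1) / k \<mu> \<nu>)) {0..R}" for \<mu> \<nu>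
    proof -
      have "((\<lambda>t. exp (k \<mu> \<nu> * of_real t)) has_integral ((exp (k \<mu> \<nu> * of_real R) - 1) / k \<mu> \<nu>)) {0..R}"
        by (rule exp_mult_has_integral[OF k0 that])
      moreover have "a \<mu> * exponential \<mu> t * cnj (a \<nu> * exponential \<nu> t) * exp (of_real (- 4 * pi * t))
          = a \<mu> * cnj (a \<nu>) * exp (k \<mu> \<nu> * of_real t)" for t
        by (simp add: exponential_def exp_cnj exp_add[symmetric] k_def algebra_simps flip: exp_of_real)
      ultimately show ?thesis by (simp only:) (rule has_integral_mult_right)
    qed
    then have "((\<lambda>t. \<Sum>\<mu>\<in>S. \<Sum>\<nu>\<in>S. a \<mu> * exponential \<mu> t * cnj (a \<nu> * exponential \<nu> t) * exp (of_real (- 4 * pi * t)))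
        has_integral (\<Sum>\<mu>\<in>S. \<Sum>\<nu>\<in>S. a \<mu> * cnj (a \<nu>) * ((exp (k \<mu> \<nu> * of_real R) - 1) / k \<mu> \<nu>))) {0..R}"
      using assms(1) by (intro has_integral_sum) auto
    then have "((\<lambda>t. complex_of_real ((cmod (h t))\<^sup>2 * exp (- 4 * pi * t)))
        has_integral (\<Sum>\<mu>\<in>S. \<Sum>\<nu>\<in>S. a \<mu> * cnj (a \<nu>) * ((exp (k \<mu> \<nu> * of_real R) - 1) / k \<mu> \<nu>))) {0..R}"
      unfolding h_def of_real_mult cmod_sum_square exp_of_real[symmetric] sum_distrib_right .
    then show ?thesis
      by (drule_tac has_integral_linear[OF _ bounded_linear_Re]) (simp add: o_def)
  qed
  define I where "I = integral {0..1} (\<lambda>t. (cmod (h t))\<^sup>2)"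
  have "exp (- 4 * pi) * I \<le> Re (\<Sum>\<mu>\<in>S. \<Sum>\<nu>\<in>S. a \<mu> * cnj (a \<nu>) * ((exp (k \<mu> \<nu> * of_real (real n)) - 1) / k \<mu> \<nu>))" if "1 \<le> n" for n
  proof -
    have "((\<lambda>t. exp (- 4 * pi) * (cmod (h t))\<^sup>2) has_integral exp (- 4 * pi) * I) {0..1}"
      unfolding I_def by (intro has_integral_mult_right integrable_integral integrable_continuous_real continuous_intros conth)
    moreover have "((\<lambda>t. if t \<in> {0..1} then exp (- 4 * pi) * (cmod (h t))\<^sup>2 else 0) has_integral exp (- 4 * pi) * I) {0..real n}"
      using calculation that by (subst has_integral_restrict) auto
    ultimately show ?thesis
      by (intro has_integral_le[OF _ int[of "real n"]]) (auto simp: mult.commute intro!: mult_left_mono)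
  qed
  moreover have "(\<lambda>n. Re (\<Sum>\<mu>\<in>S. \<Sum>\<nu>\<in>S. a \<mu> * cnj (a \<nu>) * ((exp (k \<mu> \<nu> * of_real (real n)) - 1) / k \<mu> \<nu>)))
      \<longlonglongrightarrow> Re (\<Sum>\<mu>\<in>S. \<Sum>\<nu>\<in>S. a \<mu> * cnj (a \<nu>) * ((0 - 1) / k \<mu> \<nu>))"
  proof (intro tendsto_intros)
    fix \<mu> \<nu>
    show "(\<lambda>n. exp (k \<mu> \<nu> * of_real (real n))) \<longlonglongrightarrow> 0"
    proof (rule tendsto_norm_zero_cancel)
      have "(\<lambda>n. exp (- (4 * pi)) ^ n) \<longlonglongrightarrow> 0" by (intro LIMSEQ_power_zero) auto
      moreover have "norm (exp (k \<mu> \<nu> * of_real (real n))) = exp (- (4 * pi)) ^ n" for n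
        by (simp add: norm_exp_eq_Re Rek mult.commute flip: exp_of_nat_mult)
      ultimately show "(\<lambda>n. norm (exp (k \<mu> \<nu> * of_real (real n)))) \<longlonglongrightarrow> 0" by simp
    qed
  qed (rule k0)
  ultimately have "exp (- 4 * pi) * I \<le> Re (\<Sum>\<mu>\<in>S. \<Sum>\<nu>\<in>S. a \<mu> * cnj (a \<nu>) * ((0 - 1) / k \<mu> \<nu>))"
    by (intro LIMSEQ_le_const) auto
  also have "\<dots> = 1 / (4 * pi\<^sup>2) * (LINT x|lborel. (cmod (\<Sum>\<mu>\<in>S. a \<mu> / (Complex x (-1 * 1) - of_real \<mu>)))\<^sup>2)"
  proof -
    have q: "(0 - 1) / k \<mu> \<nu> = of_real (1 / (4 * pi\<^sup>2)) * (2 * of_real pi * \<i> / (of_real (-1 * (\<nu> - \<mu>)) + 2 * \<i> * of_real 1))" for \<mu> \<nu>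
    proof -
      define v where "v = of_real (\<mu> - \<nu>) + 2 * \<i>"
      have v: "v \<noteq> 0" by (auto simp: v_def complex_eq_iff)
      have eq: "of_real (-1 * (\<nu> - \<mu>)) + 2 * \<i> * of_real 1 = v" by (simp add: v_def)
      show ?thesis unfolding k_def eq v_def[symmetric] using v by (simp add: field_simps power2_eq_square)
    qed
    have "Re (\<Sum>\<mu>\<in>S. \<Sum>\<nu>\<in>S. a \<mu> * cnj (a \<nu>) * ((0 - 1) / k \<mu> \<nu>))
      = Re (of_real (1 / (4 * pi\<^sup>2)) * (\<Sum>\<mu>\<in>S. \<Sum>\<nu>\<in>S. a \<mu> * cnj (a \<nu>) * (2 * of_real pi * \<i> / (of_real (-1 * (\<nu> - \<mu>)) + 2 * \<i> * of_real 1))))"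
      unfolding q by (simp only: sum_distrib_left mult.left_commute mult.assoc)
    also have "\<dots> = 1 / (4 * pi\<^sup>2) * Re (\<Sum>\<mu>\<in>S. \<Sum>\<nu>\<in>S. a \<mu> * cnj (a \<nu>) * (2 * of_real pi * \<i> / (of_real (-1 * (\<nu> - \<mu>)) + 2 * \<i> * of_real 1)))"
      by (simp only: times_complex.sel Re_complex_of_real Im_complex_of_real)
    also have "Re (\<Sum>\<mu>\<in>S. \<Sum>\<nu>\<in>S. a \<mu> * cnj (a \<nu>) * (2 * of_real pi * \<i> / (of_real (-1 * (\<nu> - \<mu>)) + 2 * \<i> * of_real 1)))
        = (LINT x|lborel. (cmod (\<Sum>\<mu>\<in>S. a \<mu> / (Complex x (-1 * 1) - of_real \<mu>)))\<^sup>2)"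
      using Cauchy_kernel_sum_norm[of 1 "-1" a S] by (subst has_bochner_integral_integral_eq) auto
    finally show ?thesis .
  qed
  also have "\<dots> \<le> 1 / (4 * pi\<^sup>2) * (2 * pi * (1 / 1 + 16 * 1 / d\<^sup>2) * (\<Sum>\<mu>\<in>S. (cmod (a \<mu>))\<^sup>2))"
    by (intro mult_left_mono Cauchy_kernel_sum_le) (use assms in auto)
  also have "\<dots> = (1 + 16 / d\<^sup>2) / (2 * pi) * (\<Sum>\<mu>\<in>S. (cmod (a \<mu>))\<^sup>2)"
    by (simp add: power2_eq_square)
  finally have "exp (4 * pi) * (exp (- 4 * pi) * I) \<le> exp (4 * pi) * ((1 + 16 / d\<^sup>2) / (2 * pi) * (\<Sum>\<mu>\<in>S. (cmod (a \<mu>))\<^sup>2))"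
    by (intro mult_left_mono) auto
  then show ?thesis by (simp add: I_def h_def mult.assoc[symmetric] exp_add[symmetric])
qed

lemma seven_exp_bound:
  fixes q :: real
  assumes "0 \<le> q"
  shows "2 * pi * (q + 16 * q ^ 3) \<le> 7 * exp (4 * pi * q)"
proof -
  define w where "w = 4 * pi * q"
  have w: "0 \<le> w" using assms by (simp add: w_def)
  \<comment> \<open>A cubic lower bound for \<open>exp w\<close>, where \<open>32 \<pi> q\<^sup>3 = w\<^sup>3 / (2 \<pi>\<^sup>2)\<close>.\<close>
  have "(1 + w / 3) ^ 3 \<le> exp (w / 3) ^ 3" using w by (intro power_mono) auto
  also have "\<dots> = exp w" by (simp add: exp_of_nat_mult[symmetric])
  finally have "(1 + w / 3) ^ 3 \<le> exp w" .
  moreover have "(1 + w / 3) ^ 3 = 1 + w + w\<^sup>2 / 3 + w ^ 3 / 27"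
    by (simp add: power3_eq_cube power2_eq_square field_simps)
  ultimately have "w + w ^ 3 / 27 \<le> exp w" using zero_le_power2[of w] by linarith
  moreover have "32 * pi * q ^ 3 \<le> w ^ 3 / 18"
  proof -
    have "9 \<le> pi\<^sup>2" using pi_gt3 power_mono[of 3 pi 2] by simp
    then have "(32 * pi * q ^ 3) * 9 \<le> (32 * pi * q ^ 3) * pi\<^sup>2" using assms by (intro mult_left_mono) auto
    then show ?thesis by (simp add: w_def power_mult_distrib power3_eq_cube power2_eq_square mult_ac)
  qed
  moreover have "2 * pi * q = w / 2" by (simp add: w_def)
  moreover have "0 \<le> w ^ 3" using w by simp
  ultimately have "2 * pi * q + 32 * pi * q ^ 3 \<le> 7 * exp w" using w by linarith
  then show ?thesis by (simp add: w_def algebra_simps)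
qed

context sine_type begin

text \<open>
  The pairing of \<open>\<Phi>\<close> with the Laplace transform of the exponential sum equals \<open>N = \<Sum> |a\<^sub>\<mu>|\<^sup>2\<close>, while the
  squared norms of the two factors are at most multiples of \<open>N\<close> and of the squared norm of the exponential sum.
\<close>

theorem exponential_sum_lower_bound:
  fixes a :: "real \<Rightarrow> complex"
  assumes "finite S" "S \<subseteq> \<Lambda>"
  shows "(\<Sum>\<mu>\<in>S. (cmod (a \<mu>))\<^sup>2) \<le> 7 * d * (M / m) * exp (8 * pi * y / d) *
    integral {0..1} (\<lambda>t. (cmod (exp_sum a S t))\<^sup>2)"
proof (cases "S = {}")
  case False
  then have "d \<le> 1" using assms(2) separation_le_one by blast
  define N where "N = (\<Sum>\<mu>\<in>S. (cmod (a \<mu>))\<^sup>2)"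
  define c where "c \<kappa> = cnj (a \<kappa>) / deriv F (of_real \<kappa>)" for \<kappa>
  \<comment> \<open>The quotient is entire because \<open>F\<close> vanishes at \<open>\<kappa>\<close>; its value at \<open>\<kappa>\<close> is the derivative.\<close>
  define Q where "Q \<kappa> z = (if z = of_real \<kappa> then deriv F (of_real \<kappa>) else F z / (z - of_real \<kappa>))" for \<kappa> z
  define \<Phi> where "\<Phi> z = (\<Sum>\<kappa>\<in>S. c \<kappa> * Q \<kappa> z)" for z
  define H where "H x = (\<Sum>\<mu>\<in>S. a \<mu> * box_kernel (Complex x y - of_real \<mu>))" for x
  define P where "P x = (\<Sum>\<kappa>\<in>S. c \<kappa> / (Complex x y - of_real \<kappa>))" for x
  have zero: "F (of_real \<kappa>) = 0" if "\<kappa> \<in> S" for \<kappa> using F_zero assms(2) that by blast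
  have hol\<Phi>: "\<Phi> holomorphic_on UNIV"
  proof -
    have "Q \<kappa> holomorphic_on UNIV" if "\<kappa> \<in> S" for \<kappa>
      by (rule pole_theorem_open_0[OF holomorphic_F open_UNIV]) (auto simp: Q_def zero[OF that])
    then show ?thesis unfolding \<Phi>_def by (intro holomorphic_intros) auto
  qed
  have \<Phi>_value: "\<Phi> (of_real \<mu>) = cnj (a \<mu>)" if "\<mu> \<in> S" for \<mu>
  proof -
    have "\<Phi> (of_real \<mu>) = (\<Sum>\<kappa>\<in>S. if \<kappa> = \<mu> then cnj (a \<mu>) else 0)"
      unfolding \<Phi>_def
    proof (intro sum.cong refl)
      fix \<kappa> assume "\<kappa> \<in> S"
      then have "deriv F (of_real \<kappa>) \<noteq> 0" using F_deriv_nonzero assms(2) by blast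
      then show "c \<kappa> * Q \<kappa> (of_real \<mu>) = (if \<kappa> = \<mu> then cnj (a \<mu>) else 0)"
        using zero[OF that] by (auto simp: c_def Q_def)
    qed
    then show ?thesis using that assms(1) by simp
  qed
  define r where "r = 2 * (\<Sum>\<kappa>\<in>S. \<bar>\<kappa>\<bar>) + 1"
  define C0 where "C0 = exp (4 * pi * y) * sqrt M"
  define C where "C = 2 * C0 * (\<Sum>\<kappa>\<in>S. cmod (c \<kappa>))"
  have C0: "0 \<le> C0" "sqrt M \<le> C0" using M_pos y_pos by (auto simp: C0_def)
  have C: "0 \<le> C" using C0 by (auto simp: C_def intro!: mult_nonneg_nonneg sum_nonneg)
  have decay: "cmod (\<Phi> z * u) \<le> C / cmod z" if "r \<le> cmod z" and Fu: "cmod (F z * u) \<le> C0" for z u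
  proof -
    have "cmod (c \<kappa> * Q \<kappa> z * u) \<le> cmod (c \<kappa>) * (C0 / (cmod z / 2))" if \<kappa>: "\<kappa> \<in> S" for \<kappa>
    proof -
      have "\<bar>\<kappa>\<bar> \<le> (\<Sum>\<kappa>\<in>S. \<bar>\<kappa>\<bar>)" using \<kappa> assms(1) by (intro member_le_sum) auto
      then have k: "2 * \<bar>\<kappa>\<bar> + 1 \<le> cmod z" using \<open>r \<le> cmod z\<close> by (simp add: r_def)
      have "cmod z / 2 \<le> cmod (z - of_real \<kappa>)" using k norm_triangle_ineq2[of z "of_real \<kappa>"] unfolding norm_of_real by linarith
      moreover have "0 < cmod z" using k by linarith
      ultimately have gap: "0 < cmod z / 2" "cmod z / 2 \<le> cmod (z - of_real \<kappa>)" by auto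
      then have "cmod (F z * u) / cmod (z - of_real \<kappa>) \<le> C0 / (cmod z / 2)"
        using Fu C0 by (intro frac_le) auto
      moreover have "z \<noteq> of_real \<kappa>" using gap by auto
      ultimately have "cmod (Q \<kappa> z * u) \<le> C0 / (cmod z / 2)" by (simp add: Q_def norm_mult norm_divide)
      then show ?thesis unfolding norm_mult mult.assoc by (intro mult_left_mono) (auto simp: norm_mult)
    qed
    then have "cmod (\<Phi> z * u) \<le> (\<Sum>\<kappa>\<in>S. cmod (c \<kappa>) * (C0 / (cmod z / 2)))"
      unfolding \<Phi>_def sum_distrib_right by (intro sum_norm_le)
    also have "\<dots> = C / cmod z" by (simp add: C_def sum_distrib_right[symmetric] sum_distrib_left[symmetric] mult_ac sum_divide_distrib[symmetric])
    finally show ?thesis .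
  qed
  have "has_bochner_integral lborel (\<lambda>x. \<Phi> (Complex x y) * box_kernel (Complex x y - of_real \<mu>)) (cnj (a \<mu>))" if "\<mu> \<in> S" for \<mu>
  proof -
    have "has_bochner_integral lborel (\<lambda>x. \<Phi> (Complex x y) * box_kernel (Complex x y - of_real \<mu>)) (\<Phi> (of_real \<mu>))"
    proof (rule reproducing_formula[where r = r and C = C, OF hol\<Phi> y_pos C])
      fix z assume "y \<le> Im z" "r \<le> cmod z"
      then show "cmod (\<Phi> z) \<le> C / cmod z" using decay[of z 1] F_upper_bound[of z] C0 by simp
    next
      fix z assume "Im z \<le> y" "r \<le> cmod z"
      then show "cmod (\<Phi> z * exp (- 2 * of_real pi * \<i> * z)) \<le> C / cmod z"
        using decay[of z] F_lower_half_plane_upper[of z] unfolding C0_def by blast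
    qed
    then show ?thesis using \<Phi>_value[OF that] by simp
  qed
  then have "has_bochner_integral lborel (\<lambda>x. \<Sum>\<mu>\<in>S. a \<mu> * (\<Phi> (Complex x y) * box_kernel (Complex x y - of_real \<mu>))) (\<Sum>\<mu>\<in>S. a \<mu> * cnj (a \<mu>))"
    by (intro has_bochner_integral_sum has_bochner_integral_mult_right) auto
  moreover have "(\<Sum>\<mu>\<in>S. a \<mu> * (\<Phi> (Complex x y) * box_kernel (Complex x y - of_real \<mu>))) = \<Phi> (Complex x y) * H x" for x
    by (simp add: H_def sum_distrib_left mult.left_commute)
  moreover have "(\<Sum>\<mu>\<in>S. a \<mu> * cnj (a \<mu>)) = of_real N" by (simp only: N_def of_real_sum complex_norm_square)
  ultimately have "has_bochner_integral lborel (\<lambda>x. \<Phi> (Complex x y) * H x) (of_real N)" by simp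
  then have N_int: "has_bochner_integral lborel (\<lambda>x. Re (\<Phi> (Complex x y) * H x)) N"
    by (drule_tac has_bochner_integral_bounded_linear[OF bounded_linear_Re]) simp
  define IH where "IH = integral {0..1} (\<lambda>t. (cmod (exp_sum a S t))\<^sup>2 * exp (4 * pi * y * t))"
  have H_int: "has_bochner_integral lborel (\<lambda>x. (cmod (H x))\<^sup>2) IH"
    unfolding H_def IH_def by (rule Plancherel_exponential_sum[OF y_pos])
  define IP where "IP = (LINT x|lborel. (cmod (P x))\<^sup>2)"
  have P_int: "has_bochner_integral lborel (\<lambda>x. (cmod (P x))\<^sup>2) IP"
    unfolding IP_def using Cauchy_kernel_sum_norm[OF y_pos, of 1 c S] by (auto simp: P_def has_bochner_integral_iff)
  define B where "B = 2 * pi * (1 / y + 16 * y / d\<^sup>2)"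
  define E where "E = y\<^sup>2 * exp (2 * pi * y / d - 2 * pi * y) / m"
  have B: "0 < B" unfolding B_def using y_pos d_pos by (intro mult_pos_pos add_pos_pos) auto
  have E: "0 < E" using y_pos m_pos by (simp add: E_def)
  have IP_le: "IP \<le> B * (E * N)"
  proof -
    have "(cmod (c \<kappa>))\<^sup>2 \<le> E * (cmod (a \<kappa>))\<^sup>2" if "\<kappa> \<in> S" for \<kappa>
    proof -
      have \<kappa>: "\<kappa> \<in> \<Lambda>" using assms(2) that by blast
      define D where "D = exp (pi * y) * exp (- pi * y / d) * sqrt m / y"
      have D: "0 < D" "D \<le> cmod (deriv F (of_real \<kappa>))"
        using F_deriv_lower_bound[OF \<kappa> order_refl] y_pos m_pos by (auto simp: D_def)
      have "cmod (c \<kappa>) \<le> cmod (a \<kappa>) / D"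
      proof -
        have "0 < cmod (deriv F (of_real \<kappa>))" using D by linarith
        then show ?thesis unfolding c_def norm_divide complex_mod_cnj
          using D by (intro divide_left_mono mult_pos_pos) auto
      qed
      then have "(cmod (c \<kappa>))\<^sup>2 \<le> (cmod (a \<kappa>) / D)\<^sup>2" by (intro power_mono) auto
      also have "\<dots> = E * (cmod (a \<kappa>))\<^sup>2"
      proof -
        have "D\<^sup>2 = (exp (pi * y))\<^sup>2 * (exp (- pi * y / d))\<^sup>2 * m / y\<^sup>2"
          using m_pos by (simp add: D_def power_divide power_mult_distrib)
        also have "(exp (pi * y))\<^sup>2 * (exp (- pi * y / d))\<^sup>2 = exp (2 * (pi * y) + 2 * (- pi * y / d))"
          by (simp only: exp_add exp_double)
        also have "2 * (pi * y) + 2 * (- pi * y / d) = - (2 * pi * y / d - 2 * pi * y)" by simp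
        finally have "1 / D\<^sup>2 = E"
          by (simp only: E_def exp_minus) (simp add: field_simps)
        from this[symmetric] show ?thesis by (simp add: power_divide)
      qed
      finally show ?thesis .
    qed
    then have "(\<Sum>\<kappa>\<in>S. (cmod (c \<kappa>))\<^sup>2) \<le> E * N" unfolding N_def sum_distrib_left by (intro sum_mono)
    moreover have "IP \<le> B * (\<Sum>\<kappa>\<in>S. (cmod (c \<kappa>))\<^sup>2)"
      using Cauchy_kernel_sum_le[OF assms(1) d_pos separated_subset[OF separated assms(2)] y_pos, of 1 c]
      by (simp add: IP_def P_def B_def)
    ultimately show ?thesis using B by (meson less_imp_le mult_left_mono order_trans)
  qed
  \<comment> \<open>With this weight the part of the arithmetic mean that comes from \<open>\<Phi>\<close> is at most \<open>N/2\<close> and can be absorbed.\<close>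
  define X where "X = M * B * E"
  have X: "0 < X" using M_pos B E by (simp add: X_def)
  have "N \<le> (1 / X * M * IP + X * IH) / 2"
  proof -
    have W_int: "has_bochner_integral lborel (\<lambda>x. (1 / X * M * (cmod (P x))\<^sup>2 + X * (cmod (H x))\<^sup>2) / 2) ((1 / X * M * IP + X * IH) / 2)"
      by (intro has_bochner_integral_divide has_bochner_integral_add has_bochner_integral_mult_right) (use P_int H_int in auto)
    have "Re (\<Phi> (Complex x y) * H x) \<le> (1 / X * M * (cmod (P x))\<^sup>2 + X * (cmod (H x))\<^sup>2) / 2" for x
    proof -
    have ne: "Complex x y \<noteq> of_real \<kappa>" for \<kappa> using y_pos by (auto simp: complex_eq_iff)
    have "\<Phi> (Complex x y) = F (Complex x y) * P x"
      by (simp add: \<Phi>_def Q_def P_def ne sum_distrib_left mult_ac)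
    then have "(cmod (\<Phi> (Complex x y)))\<^sup>2 = (cmod (F (Complex x y)))\<^sup>2 * (cmod (P x))\<^sup>2"
      by (simp add: norm_mult power_mult_distrib)
    also have "\<dots> \<le> M * (cmod (P x))\<^sup>2"
      using line by (intro mult_right_mono) (auto simp: bounded_on_line_def)
    finally have \<Phi>2: "(cmod (\<Phi> (Complex x y)))\<^sup>2 \<le> M * (cmod (P x))\<^sup>2" .
    define u where "u = cmod (\<Phi> (Complex x y))"
    define v where "v = cmod (H x)"
    have "Re (\<Phi> (Complex x y) * H x) \<le> u * v"
      unfolding u_def v_def using complex_Re_le_cmod norm_mult by metis
    also have "u * v \<le> (1 / X * u\<^sup>2 + X * v\<^sup>2) / 2"
    proof -
      have "0 \<le> (u - X * v)\<^sup>2 / X" using X by simp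
      also have "\<dots> = 1 / X * u\<^sup>2 - 2 * (u * v) + X * v\<^sup>2" using X by (simp add: power2_eq_square field_simps)
      finally show ?thesis by simp
    qed
    also have "\<dots> \<le> (1 / X * (M * (cmod (P x))\<^sup>2) + X * v\<^sup>2) / 2"
      using \<Phi>2 X by (intro divide_right_mono add_right_mono mult_left_mono) (auto simp: u_def)
    finally show "Re (\<Phi> (Complex x y) * H x) \<le> (1 / X * M * (cmod (P x))\<^sup>2 + X * (cmod (H x))\<^sup>2) / 2"
      by (simp add: v_def mult.assoc)
    qed
    then show ?thesis
      using integral_mono[OF integrable.intros[OF N_int] integrable.intros[OF W_int]]
      by (simp only: has_bochner_integral_integral_eq[OF N_int] has_bochner_integral_integral_eq[OF W_int])
  qed
  moreover have "1 / X * M * IP \<le> N"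
  proof -
    have "1 / X * M * IP \<le> 1 / X * M * (B * (E * N))" using IP_le X M_pos by (intro mult_left_mono) auto
    also have "\<dots> = N" using M_pos B E by (simp add: X_def)
    finally show ?thesis .
  qed
  moreover have "N \<le> s" if "N \<le> (t + s) / 2" "t \<le> N" for s t
  proof -
    have "2 * N \<le> t + s" using that(1) by simp
    then show ?thesis using that(2) by simp
  qed
  ultimately have N_le: "N \<le> X * IH" by blast
  define I where "I = integral {0..1} (\<lambda>t. (cmod (exp_sum a S t))\<^sup>2)"
  have "IH \<le> integral {0..1} (\<lambda>t. (cmod (exp_sum a S t))\<^sup>2 * exp (4 * pi * y))"
    unfolding IH_def using y_pos
    by (intro integral_le integrable_continuous_real continuous_intros continuous_exponential mult_left_mono) auto
  also have "\<dots> = I * exp (4 * pi * y)" by (simp add: I_def)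
  finally have "X * IH \<le> X * (I * exp (4 * pi * y))" using X by (intro mult_left_mono) auto
  also have "\<dots> = (X * exp (4 * pi * y)) * I" by simp
  also have "\<dots> \<le> (7 * d * (M / m) * exp (8 * pi * y / d)) * I"
  proof (rule mult_right_mono)
    define q where "q = y / d"
    have q: "0 \<le> q" "y = q * d" "y \<le> q" using y_pos d_pos \<open>d \<le> 1\<close> by (auto simp: q_def field_simps)
    have By: "B * y\<^sup>2 = d * (2 * pi * (q + 16 * q ^ 3))"
      using y_pos d_pos by (simp add: B_def q_def power2_eq_square power3_eq_cube field_simps)
    have "X * exp (4 * pi * y) = (M / m) * (B * y\<^sup>2) * (exp (2 * pi * y / d - 2 * pi * y) * exp (4 * pi * y))"
      by (simp add: X_def E_def)
    also have "\<dots> \<le> (M / m) * (d * (7 * exp (4 * pi * q))) * exp (4 * pi * q)"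
    proof (rule mult_mono)
      have "B * y\<^sup>2 \<le> d * (7 * exp (4 * pi * q))"
        unfolding By using seven_exp_bound[OF q(1)] d_pos by (intro mult_left_mono) auto
      then show "(M / m) * (B * y\<^sup>2) \<le> (M / m) * (d * (7 * exp (4 * pi * q)))"
        using M_pos m_pos by (intro mult_left_mono) auto
      have "pi * y \<le> pi * q" using q(3) by (intro mult_left_mono) auto
      then have "2 * pi * y / d - 2 * pi * y + 4 * pi * y \<le> 4 * pi * q" by (simp add: q_def)
      then show "exp (2 * pi * y / d - 2 * pi * y) * exp (4 * pi * y) \<le> exp (4 * pi * q)"
        unfolding exp_add[symmetric] by simp
    qed (use M_pos m_pos d_pos B in \<open>auto intro!: mult_nonneg_nonneg\<close>)
    also have "\<dots> = 7 * d * (M / m) * (exp (4 * pi * q) * exp (4 * pi * q))" by simp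
    also have "exp (4 * pi * q) * exp (4 * pi * q) = exp (8 * pi * y / d)"
      by (simp add: exp_add[symmetric] q_def)
    finally show "X * exp (4 * pi * y) \<le> 7 * d * (M / m) * exp (8 * pi * y / d)" .
    show "0 \<le> I" unfolding I_def
      by (intro integral_nonneg integrable_continuous_real continuous_intros continuous_exponential) auto
  qed
  finally show ?thesis using N_le by (simp add: N_def I_def)
qed simp

end

section \<open>Density of exponentials in the square-integrable functions\<close>

abbreviation unit_measure :: "real measure" where "unit_measure \<equiv> lebesgue_on {0..1}"

lemma L2_space_continuous:
  fixes f :: "real \<Rightarrow> complex"
  assumes "continuous_on {0..1} f"
  shows "f \<in> L2_space unit_measure"
  unfolding L2_space_def using assms
  by (auto intro!: continuous_imp_measurable_on_sets_lebesgue continuous_imp_integrable_real continuous_intros)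

lemma L2_space_add:
  assumes "f \<in> L2_space N" "g \<in> L2_space N"
  shows "(\<lambda>x. f x + g x) \<in> L2_space N"
    and "(LINT x|N. (cmod (f x + g x))\<^sup>2) \<le> 2 * (LINT x|N. (cmod (f x))\<^sup>2) + 2 * (LINT x|N. (cmod (g x))\<^sup>2)"
proof -
  have [measurable]: "f \<in> borel_measurable N" "g \<in> borel_measurable N"
    and int: "integrable N (\<lambda>x. (cmod (f x))\<^sup>2)" "integrable N (\<lambda>x. (cmod (g x))\<^sup>2)"
    using assms by (auto simp: L2_space_def)
  have le: "(cmod (u + v))\<^sup>2 \<le> 2 * (cmod u)\<^sup>2 + 2 * (cmod v)\<^sup>2" for u v :: complex
  proof -
    have "(cmod (u + v))\<^sup>2 \<le> (cmod u + cmod v)\<^sup>2" by (intro power_mono norm_triangle_ineq) auto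
    also have "\<dots> \<le> 2 * (cmod u)\<^sup>2 + 2 * (cmod v)\<^sup>2"
      using sum_squares_bound[of "cmod u" "cmod v"] by (simp add: power2_sum)
    finally show ?thesis .
  qed
  have int2: "integrable N (\<lambda>x. 2 * (cmod (f x))\<^sup>2 + 2 * (cmod (g x))\<^sup>2)" using int by auto
  have int3: "integrable N (\<lambda>x. (cmod (f x + g x))\<^sup>2)"
    by (rule Bochner_Integration.integrable_bound[OF int2]) (use le in \<open>auto intro!: AE_I2\<close>)
  then show "(\<lambda>x. f x + g x) \<in> L2_space N" by (simp add: L2_space_def)
  have "(LINT x|N. (cmod (f x + g x))\<^sup>2) \<le> (LINT x|N. 2 * (cmod (f x))\<^sup>2 + 2 * (cmod (g x))\<^sup>2)"
    by (rule integral_mono[OF int3 int2 le])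
  then show "(LINT x|N. (cmod (f x + g x))\<^sup>2) \<le> 2 * (LINT x|N. (cmod (f x))\<^sup>2) + 2 * (LINT x|N. (cmod (g x))\<^sup>2)"
    using int by simp
qed

lemma L2_space_scale:
  assumes "f \<in> L2_space N"
  shows "(\<lambda>x. c * f x) \<in> L2_space N"
    and "(LINT x|N. (cmod (c * f x))\<^sup>2) = (cmod c)\<^sup>2 * (LINT x|N. (cmod (f x))\<^sup>2)"
  using assms by (auto simp: L2_space_def norm_mult power_mult_distrib)

lemma L2_space_sum:
  assumes "\<And>n. n \<in> S \<Longrightarrow> f n \<in> L2_space N"
  shows "(\<lambda>x. \<Sum>n\<in>S. f n x) \<in> L2_space N"
proof (cases "finite S")
  case True
  then show ?thesis using assms
  proof (induction S)
    case (insert s S)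
    then show ?case using L2_space_add(1)[of "f s" N "\<lambda>x. \<Sum>n\<in>S. f n x"] by simp
  qed (simp add: L2_space_def)
qed (simp add: L2_space_def)

lemma L2_space_diff:
  assumes "f \<in> L2_space N" "g \<in> L2_space N"
  shows "(\<lambda>x. f x - g x) \<in> L2_space N"
  using L2_space_add(1)[OF assms(1) L2_space_scale(1)[OF assms(2), of "-1"]] by simp

text \<open>
  Approximation is measured by the squared distance, for which the estimate
  \<open>|u + v|\<^sup>2 \<le> 2|u|\<^sup>2 + 2|v|\<^sup>2\<close> replaces the triangle inequality.
\<close>

definition L2_closed_span :: "'a measure \<Rightarrow> 'i set \<Rightarrow> ('i \<Rightarrow> 'a \<Rightarrow> complex) \<Rightarrow> ('a \<Rightarrow> complex) set" where
  "L2_closed_span N I \<phi> = {f\<in>L2_space N. \<forall>\<epsilon>>0. \<exists>S a. finite S \<and> S \<subseteq> I \<and>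
     (LINT x|N. (cmod (f x - (\<Sum>n\<in>S. a n * \<phi> n x)))\<^sup>2) < \<epsilon>}"

lemma L2_closed_span_limit:
  assumes \<phi>: "\<And>n. n \<in> I \<Longrightarrow> \<phi> n \<in> L2_space N" and f: "f \<in> L2_space N"
    and lim: "\<And>\<epsilon>. 0 < \<epsilon> \<Longrightarrow> \<exists>g\<in>L2_closed_span N I \<phi>. (LINT x|N. (cmod (f x - g x))\<^sup>2) < \<epsilon>"
  shows "f \<in> L2_closed_span N I \<phi>"
proof -
  have "\<exists>S a. finite S \<and> S \<subseteq> I \<and> (LINT x|N. (cmod (f x - (\<Sum>n\<in>S. a n * \<phi> n x)))\<^sup>2) < \<epsilon>" if "0 < \<epsilon>" for \<epsilon>
  proof -
    obtain g where g: "g \<in> L2_closed_span N I \<phi>" "(LINT x|N. (cmod (f x - g x))\<^sup>2) < \<epsilon> / 4"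
      using lim[of "\<epsilon> / 4"] \<open>0 < \<epsilon>\<close> by auto
    have "0 < \<epsilon> / 4" using \<open>0 < \<epsilon>\<close> by simp
    then obtain S a where S: "finite S" "S \<subseteq> I" "(LINT x|N. (cmod (g x - (\<Sum>n\<in>S. a n * \<phi> n x)))\<^sup>2) < \<epsilon> / 4"
      using g(1) unfolding L2_closed_span_def by blast
    have gL: "g \<in> L2_space N" using g by (simp add: L2_closed_span_def)
    have "(\<lambda>x. \<Sum>n\<in>S. a n * \<phi> n x) \<in> L2_space N" using S(2) \<phi> by (intro L2_space_sum L2_space_scale) auto
    then have "(LINT x|N. (cmod ((f x - g x) + (g x - (\<Sum>n\<in>S. a n * \<phi> n x))))\<^sup>2) \<le> 2 * (LINT x|N. (cmod (f x - g x))\<^sup>2) + 2 * (LINT x|N. (cmod (g x - (\<Sum>n\<in>S. a n * \<phi> n x)))\<^sup>2)"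
      by (intro L2_space_add(2) L2_space_diff f gL)
    then have "(LINT x|N. (cmod (f x - (\<Sum>n\<in>S. a n * \<phi> n x)))\<^sup>2) < \<epsilon>" using g(2) S(3) by simp
    then show ?thesis using S by blast
  qed
  then show ?thesis using f by (simp add: L2_closed_span_def)
qed

lemma L2_closed_span_scale:
  assumes "f \<in> L2_closed_span N I \<phi>"
  shows "(\<lambda>x. c * f x) \<in> L2_closed_span N I \<phi>"
proof -
  have f: "f \<in> L2_space N" using assms by (simp add: L2_closed_span_def)
  have "\<exists>S a. finite S \<and> S \<subseteq> I \<and> (LINT x|N. (cmod (c * f x - (\<Sum>n\<in>S. a n * \<phi> n x)))\<^sup>2) < \<epsilon>" if "0 < \<epsilon>" for \<epsilon>
  proof -
    have "0 < \<epsilon> / ((cmod c)\<^sup>2 + 1)" using that by (simp add: add_nonneg_pos)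
    then obtain S a where S: "finite S" "S \<subseteq> I" "(LINT x|N. (cmod (f x - (\<Sum>n\<in>S. a n * \<phi> n x)))\<^sup>2) < \<epsilon> / ((cmod c)\<^sup>2 + 1)"
      using assms unfolding L2_closed_span_def by blast
    let ?i = "LINT x|N. (cmod (f x - (\<Sum>n\<in>S. a n * \<phi> n x)))\<^sup>2"
    have "(cmod (c * f x - (\<Sum>n\<in>S. c * a n * \<phi> n x)))\<^sup>2 = (cmod c)\<^sup>2 * (cmod (f x - (\<Sum>n\<in>S. a n * \<phi> n x)))\<^sup>2" for x
      by (simp add: mult.assoc flip: sum_distrib_left right_diff_distrib norm_mult power_mult_distrib)
    then have "(LINT x|N. (cmod (c * f x - (\<Sum>n\<in>S. c * a n * \<phi> n x)))\<^sup>2) = (cmod c)\<^sup>2 * ?i"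
      by simp
    also have "\<dots> \<le> ((cmod c)\<^sup>2 + 1) * ?i" by (intro mult_right_mono) auto
    also have "\<dots> < \<epsilon>" using S(3) by (simp add: pos_less_divide_eq add_nonneg_pos mult.commute)
    finally show ?thesis using S(1,2) by (intro exI[of _ S] exI[of _ "\<lambda>n. c * a n"] conjI)
  qed
  then show ?thesis using L2_space_scale(1)[OF f] by (simp add: L2_closed_span_def)
qed

lemma L2_closed_span_add:
  assumes \<phi>: "\<And>n. n \<in> I \<Longrightarrow> \<phi> n \<in> L2_space N"
    and "f \<in> L2_closed_span N I \<phi>" "g \<in> L2_closed_span N I \<phi>"
  shows "(\<lambda>x. f x + g x) \<in> L2_closed_span N I \<phi>"
proof -
  have fg: "f \<in> L2_space N" "g \<in> L2_space N" using assms by (auto simp: L2_closed_span_def)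
  have "\<exists>S a. finite S \<and> S \<subseteq> I \<and> (LINT x|N. (cmod (f x + g x - (\<Sum>n\<in>S. a n * \<phi> n x)))\<^sup>2) < \<epsilon>" if "0 < \<epsilon>" for \<epsilon>
  proof -
    have "0 < \<epsilon> / 4" using that by simp
    then obtain S a where S: "finite S" "S \<subseteq> I" "(LINT x|N. (cmod (f x - (\<Sum>n\<in>S. a n * \<phi> n x)))\<^sup>2) < \<epsilon> / 4"
      using assms(2) unfolding L2_closed_span_def by blast
    obtain T b where T: "finite T" "T \<subseteq> I" "(LINT x|N. (cmod (g x - (\<Sum>n\<in>T. b n * \<phi> n x)))\<^sup>2) < \<epsilon> / 4"
      using assms(3) \<open>0 < \<epsilon> / 4\<close> unfolding L2_closed_span_def by blast
    define c where "c n = (if n \<in> S then a n else 0) + (if n \<in> T then b n else 0)" for n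
    have "(\<Sum>n\<in>S. a n * \<phi> n x) = (\<Sum>n\<in>S \<union> T. (if n \<in> S then a n else 0) * \<phi> n x)"
      and "(\<Sum>n\<in>T. b n * \<phi> n x) = (\<Sum>n\<in>S \<union> T. (if n \<in> T then b n else 0) * \<phi> n x)" for x
      using S(1) T(1) by (auto intro!: sum.mono_neutral_cong_left)
    then have eq: "(f x - (\<Sum>n\<in>S. a n * \<phi> n x)) + (g x - (\<Sum>n\<in>T. b n * \<phi> n x)) = f x + g x - (\<Sum>n\<in>S \<union> T. c n * \<phi> n x)" for x
      by (simp add: c_def distrib_right sum.distrib)
    have "(\<lambda>x. \<Sum>n\<in>S. a n * \<phi> n x) \<in> L2_space N" "(\<lambda>x. \<Sum>n\<in>T. b n * \<phi> n x) \<in> L2_space N"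
      using S(2) T(2) \<phi> by (auto intro!: L2_space_sum L2_space_scale)
    then have "(LINT x|N. (cmod ((f x - (\<Sum>n\<in>S. a n * \<phi> n x)) + (g x - (\<Sum>n\<in>T. b n * \<phi> n x))))\<^sup>2)
      \<le> 2 * (LINT x|N. (cmod (f x - (\<Sum>n\<in>S. a n * \<phi> n x)))\<^sup>2) + 2 * (LINT x|N. (cmod (g x - (\<Sum>n\<in>T. b n * \<phi> n x)))\<^sup>2)"
      by (intro L2_space_add(2) L2_space_diff fg)
    then have "(LINT x|N. (cmod (f x + g x - (\<Sum>n\<in>S \<union> T. c n * \<phi> n x)))\<^sup>2) < \<epsilon>"
      unfolding eq using S(3) T(3) by simp
    then show ?thesis using S(1,2) T(1,2) by (intro exI[of _ "S \<union> T"] exI[of _ c]) auto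
  qed
  then show ?thesis using L2_space_add(1)[OF fg] by (simp add: L2_closed_span_def)
qed

lemma L2_unit_uniform_bound:
  fixes f :: "real \<Rightarrow> complex"
  assumes "f \<in> L2_space unit_measure" "\<And>x. x \<in> {0..1} \<Longrightarrow> cmod (f x) \<le> e"
  shows "(LINT x|unit_measure. (cmod (f x))\<^sup>2) \<le> e\<^sup>2"
proof -
  have "(LINT x|unit_measure. (cmod (f x))\<^sup>2) \<le> (LINT x|unit_measure. e\<^sup>2)"
  proof (rule integral_mono)
    show "integrable unit_measure (\<lambda>x. (cmod (f x))\<^sup>2)" using assms(1) by (simp add: L2_space_def)
    show "integrable unit_measure (\<lambda>x. e\<^sup>2)" by (intro continuous_imp_integrable_real continuous_intros)
    show "(cmod (f x))\<^sup>2 \<le> e\<^sup>2" if "x \<in> space unit_measure" for x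
      using assms(2)[of x] that by (intro power_mono) (auto simp: space_restrict_space)
  qed
  also have "\<dots> = integral {0..1::real} (\<lambda>x. e\<^sup>2)"
    by (intro lebesgue_integral_eq_integral continuous_imp_integrable_real continuous_intros) simp
  also have "\<dots> = e\<^sup>2" by simp
  finally show ?thesis .
qed

inductive trig_polynomial :: "(real \<Rightarrow> complex) \<Rightarrow> bool" where
  exponential: "trig_polynomial (\<lambda>x. c * exponential \<mu> x)"
| add: "trig_polynomial f \<Longrightarrow> trig_polynomial g \<Longrightarrow> trig_polynomial (\<lambda>x. f x + g x)"

lemma trig_polynomial_mult:
  assumes "trig_polynomial f" "trig_polynomial g"
  shows "trig_polynomial (\<lambda>x. f x * g x)"
  using assms
proof (induction f)
  case (exponential c \<mu>)
  then show ?case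
  proof (induction g)
    case (exponential c' \<nu>)
    have "c * exponential \<mu> x * (c' * exponential \<nu> x) = (c * c') * exponential (\<mu> + \<nu>) x" for x
      by (simp add: exponential_def exp_add[symmetric] algebra_simps)
    then show ?case by (simp only:) (rule trig_polynomial.exponential)
  next
    case (add g h)
    then show ?case by (simp only: distrib_left) (rule trig_polynomial.add)
  qed
next
  case (add f h)
  then show ?case by (simp only: distrib_right) (intro trig_polynomial.add; blast)
qed

lemma continuous_trig_polynomial: "trig_polynomial f \<Longrightarrow> continuous_on A f"
  by (induction rule: trig_polynomial.induct) (auto simp: exponential_def intro!: continuous_intros)

text \<open>
  Since all real frequencies are admitted, the algebra separates also the two endpoints of the
  interval, by \<open>cos (\<pi>t)\<close>.
\<close>

lemma trig_polynomials_uniformly_dense: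
  fixes f :: "real \<Rightarrow> real"
  assumes "continuous_on {0..1} f" "0 < e"
  shows "\<exists>g. trig_polynomial (\<lambda>x. of_real (g x)) \<and> (\<forall>x\<in>{0..1}. \<bar>f x - g x\<bar> < e)"
proof (rule Stone_Weierstrass_HOL[where P = "\<lambda>g. trig_polynomial (\<lambda>x. of_real (g x))"])
  show "trig_polynomial (\<lambda>x. of_real c)" for c
    using trig_polynomial.exponential[of "of_real c" 0] by (simp add: exponential_def)
  show "continuous_on {0..1} g" if "trig_polynomial (\<lambda>x. of_real (g x))" for g
    using continuous_on_Re[OF continuous_trig_polynomial[OF that]] by simp
  show "\<exists>g. trig_polynomial (\<lambda>x. of_real (g x)) \<and> g x \<noteq> g y" if "x \<in> {0..1} \<and> y \<in> {0..1} \<and> x \<noteq> y" for x y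
  proof (intro exI conjI)
    have "complex_of_real (cos (pi * t)) = (1/2) * exponential (1/2) t + (1/2) * exponential (-1/2) t" for t
      by (simp add: exponential_def cos_exp_eq mult_ac flip: cos_of_real)
    then show "trig_polynomial (\<lambda>t. of_real (cos (pi * t)))"
      by (simp only:) (intro trig_polynomial.intros)
    show "cos (pi * x) \<noteq> cos (pi * y)"
      using that cos_inj_pi[of "pi * x" "pi * y"] by auto
  qed
qed (use assms in \<open>auto simp: trig_polynomial.add trig_polynomial_mult\<close>)

text \<open>
  Trigonometric polynomials are uniformly dense in the continuous functions. A bounded measurable
  function is an almost everywhere limit of continuous functions, which may be clipped to the same bound,
  and a square-integrable function is the limit of its truncations; both limits are dominated.
\<close>

lemma complete_if_spans_exponentials:
  assumes \<phi>: "\<And>n. n \<in> I \<Longrightarrow> \<phi> n \<in> L2_space unit_measure"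
    and span: "\<And>\<mu>. exponential \<mu> \<in> L2_closed_span unit_measure I \<phi>"
  shows "complete_system unit_measure I \<phi>"
proof -
  let ?V = "L2_closed_span unit_measure I \<phi>"
  note add = L2_closed_span_add[OF \<phi>]
  note limit = L2_closed_span_limit[OF \<phi>]
  have trig: "f \<in> ?V" if "trig_polynomial f" for f
    using that by induction (auto intro: add L2_closed_span_scale span)
  have real_cont: "(\<lambda>x. of_real (f x)) \<in> ?V" if f: "continuous_on {0..1} f" for f
  proof (rule limit)
    show L: "(\<lambda>x. complex_of_real (f x)) \<in> L2_space unit_measure"
      by (intro L2_space_continuous continuous_intros f)
    fix \<epsilon> :: real assume "0 < \<epsilon>"
    define e where "e = sqrt \<epsilon> / 2"
    have e: "0 < e" "e\<^sup>2 < \<epsilon>" using \<open>0 < \<epsilon>\<close> by (auto simp: e_def power_divide)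
    obtain g where g: "trig_polynomial (\<lambda>x. of_real (g x))" "\<And>x. x \<in> {0..1} \<Longrightarrow> \<bar>f x - g x\<bar> < e"
      using trig_polynomials_uniformly_dense[OF f e(1)] by blast
    have gV: "(\<lambda>x. complex_of_real (g x)) \<in> ?V" using trig[OF g(1)] .
    then have gL: "(\<lambda>x. complex_of_real (g x)) \<in> L2_space unit_measure" by (simp add: L2_closed_span_def)
    have "(LINT x|unit_measure. (cmod (of_real (f x) - of_real (g x)))\<^sup>2) \<le> e\<^sup>2"
    proof (rule L2_unit_uniform_bound)
      show "cmod (of_real (f x) - of_real (g x)) \<le> e" if "x \<in> {0..1}" for x
        using g(2)[OF that] by (simp flip: of_real_diff)
    qed (rule L2_space_diff[OF L gL])
    then show "\<exists>g\<in>?V. (LINT x|unit_measure. (cmod (of_real (f x) - g x))\<^sup>2) < \<epsilon>"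
      using gV e(2) by (intro bexI[of _ "\<lambda>x. of_real (g x)"]) auto
  qed
  have cont: "f \<in> ?V" if f: "continuous_on {0..1} f" for f
  proof -
    have "(\<lambda>x. of_real (Re (f x)) + \<i> * of_real (Im (f x))) \<in> ?V"
      by (intro add L2_closed_span_scale real_cont continuous_intros f)
    then show ?thesis by (simp add: complex_eq[symmetric])
  qed
  \<comment> \<open>Radial projection onto the disc of radius \<open>n\<close>.\<close>
  define clip where "clip n u = u * of_real (real n / max (real n) (cmod u))" for n :: nat and u :: complex
  have clip_le: "cmod (clip n u) \<le> real n" for n u
  proof (cases "max (real n) (cmod u) = 0")
    case False
    then have "0 < max (real n) (cmod u)" by (simp add: less_max_iff_disj max_def split: if_splits)
    then have "real n * (cmod u / max (real n) (cmod u)) \<le> real n * 1"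
      by (intro mult_left_mono) (auto simp: divide_le_eq)
    moreover have "cmod (clip n u) = cmod u * (real n / max (real n) (cmod u))"
      unfolding clip_def norm_mult norm_of_real by (subst abs_of_nonneg) (auto simp: le_max_iff_disj)
    ultimately show ?thesis by (simp add: mult.commute)
  qed (auto simp: clip_def max_def split: if_splits)
  have clip_eq: "clip n u = u" if "cmod u \<le> real n" for n u
    using that by (cases "n = 0") (auto simp: clip_def max_def)
  have clip_cont: "continuous_on UNIV (clip n)" if "0 < n" for n
    unfolding clip_def using that by (intro continuous_intros) (auto simp: max_def)
  have all: "f \<in> ?V" if fL: "f \<in> L2_space unit_measure" for f
  proof (rule limit[OF _ fL])
    have meas: "f \<in> borel_measurable unit_measure" and int: "integrable unit_measure (\<lambda>x. (cmod (f x))\<^sup>2)"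
      using fL by (auto simp: L2_space_def)
    have clip_meas: "(\<lambda>x. clip n (f x)) \<in> borel_measurable unit_measure" if "0 < n" for n
      by (rule measurable_compose[OF meas]) (rule borel_measurable_continuous_onI[OF clip_cont[OF that]])
    have const_int: "integrable unit_measure (\<lambda>x. c)" for c :: real
      by (intro continuous_imp_integrable_real continuous_intros)
    have bounded_L2: "g \<in> L2_space unit_measure" if "g \<in> borel_measurable unit_measure" "\<And>x. cmod (g x) \<le> B" for g B
    proof -
      have "integrable unit_measure (\<lambda>x. (cmod (g x))\<^sup>2)"
        by (rule Bochner_Integration.integrable_bound[OF const_int[of "B\<^sup>2"]])
           (use that in \<open>auto intro!: AE_I2 power_mono\<close>)
      then show ?thesis using that by (simp add: L2_space_def)
    qed
    have clipV: "(\<lambda>x. clip n (f x)) \<in> ?V" if n: "0 < n" for n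
    proof (rule limit)
      show cL: "(\<lambda>x. clip n (f x)) \<in> L2_space unit_measure"
        by (rule bounded_L2[OF clip_meas[OF n] clip_le])
      fix \<epsilon> :: real assume "0 < \<epsilon>"
      have "f measurable_on {0..1}" using meas by (simp add: measurable_on_iff_borel_measurable)
      then obtain Z g where Z: "negligible Z" and g: "\<And>k. continuous_on UNIV (g k)"
        and lim: "\<And>x. x \<notin> Z \<Longrightarrow> (\<lambda>k. g k x) \<longlonglongrightarrow> (if x \<in> {0..1} then f x else 0)"
        unfolding measurable_on_def by blast
      have gc: "continuous_on A (\<lambda>x. clip n (g k x))" for k A
        by (rule continuous_on_compose2[OF clip_cont[OF n] continuous_on_subset[OF g]]) auto
      have AE: "AE x in unit_measure. x \<notin> Z"
      proof -
        have "AE x in lebesgue. x \<notin> Z" using Z by (intro AE_not_in) (simp add: negligible_iff_null_sets)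
        then show ?thesis by (subst AE_restrict_space_iff) auto
      qed
      have "(\<lambda>k. LINT x|unit_measure. (cmod (clip n (f x) - clip n (g k x)))\<^sup>2) \<longlonglongrightarrow> (LINT x|unit_measure. 0)"
      proof (rule integral_dominated_convergence[where w = "\<lambda>x. (2 * real n)\<^sup>2"])
        show "(\<lambda>x. (cmod (clip n (f x) - clip n (g k x)))\<^sup>2) \<in> borel_measurable unit_measure" for k
          using clip_meas[OF n] continuous_imp_measurable_on_sets_lebesgue[OF gc[of "{0..1}" k]] by simp
        show "AE x in unit_measure. (\<lambda>k. (cmod (clip n (f x) - clip n (g k x)))\<^sup>2) \<longlonglongrightarrow> 0"
          using AE AE_space
        proof eventually_elim
          case (elim x)
          then have "(\<lambda>k. g k x) \<longlonglongrightarrow> f x" using lim[of x] by (simp add: space_restrict_space)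
          then have "(\<lambda>k. clip n (g k x)) \<longlonglongrightarrow> clip n (f x)"
            using clip_cont[OF n] by (auto simp: continuous_on_eq_continuous_at intro: isCont_tendsto_compose)
          then have "(\<lambda>k. (cmod (clip n (f x) - clip n (g k x)))\<^sup>2) \<longlonglongrightarrow> (cmod (clip n (f x) - clip n (f x)))\<^sup>2"
            by (intro tendsto_intros)
          then show ?case by simp
        qed
        have "cmod (clip n u - clip n v) \<le> 2 * real n" for u v
          using norm_triangle_ineq4[of "clip n u" "clip n v"] clip_le[of n u] clip_le[of n v] by linarith
        then have "(cmod (clip n u - clip n v))\<^sup>2 \<le> (2 * real n)\<^sup>2" for u v
          by (rule power_mono) simp
        then have "norm ((cmod (clip n u - clip n v))\<^sup>2) \<le> (2 * real n)\<^sup>2" for u v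
          by (simp only: real_norm_def abs_power2)
        then show "AE x in unit_measure. norm ((cmod (clip n (f x) - clip n (g k x)))\<^sup>2) \<le> (2 * real n)\<^sup>2" for k
          by (intro AE_I2)
      qed (use const_int in auto)
      then have "eventually (\<lambda>k. (LINT x|unit_measure. (cmod (clip n (f x) - clip n (g k x)))\<^sup>2) < \<epsilon>) sequentially"
        using \<open>0 < \<epsilon>\<close> by (intro order_tendstoD) auto
      then obtain k where "(LINT x|unit_measure. (cmod (clip n (f x) - clip n (g k x)))\<^sup>2) < \<epsilon>"
        by (auto simp: eventually_sequentially)
      then show "\<exists>g\<in>?V. (LINT x|unit_measure. (cmod (clip n (f x) - g x))\<^sup>2) < \<epsilon>"
        using cont[OF gc] by (intro bexI[of _ "\<lambda>x. clip n (g k x)"]) auto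
    qed
    fix \<epsilon> :: real assume "0 < \<epsilon>"
    have "(\<lambda>n. LINT x|unit_measure. (cmod (f x - clip (Suc n) (f x)))\<^sup>2) \<longlonglongrightarrow> (LINT x|unit_measure. 0)"
    proof (rule integral_dominated_convergence[where w = "\<lambda>x. (cmod (f x))\<^sup>2"])
      show "(\<lambda>x. (cmod (f x - clip (Suc n) (f x)))\<^sup>2) \<in> borel_measurable unit_measure" for n
        using clip_meas[of "Suc n"] meas by simp
      show "AE x in unit_measure. (\<lambda>n. (cmod (f x - clip (Suc n) (f x)))\<^sup>2) \<longlonglongrightarrow> 0"
      proof (intro AE_I2 tendsto_eventually)
        fix x
        show "eventually (\<lambda>n. (cmod (f x - clip (Suc n) (f x)))\<^sup>2 = 0) sequentially"
          using eventually_ge_at_top[of "nat \<lceil>cmod (f x)\<rceil>"]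
        proof eventually_elim
          case (elim n)
          then have "cmod (f x) \<le> real (Suc n)" by linarith
          then show ?case by (simp add: clip_eq)
        qed
      qed
      have "cmod (u - clip n u) \<le> cmod u" for n u
      proof -
        define s where "s = real n / max (real n) (cmod u)"
        have s: "0 \<le> s" "s \<le> 1" by (auto simp: s_def divide_le_eq_1 max_def)
        have "u - clip n u = u * of_real (1 - s)" by (simp add: clip_def s_def algebra_simps)
        then have "cmod (u - clip n u) = cmod u * (1 - s)" using s by (simp only: norm_mult norm_of_real abs_of_nonneg diff_ge_0_iff_ge)
        also have "\<dots> \<le> cmod u * 1" using s by (intro mult_left_mono) auto
        finally show ?thesis by simp
      qed
      then show "AE x in unit_measure. norm ((cmod (f x - clip (Suc n) (f x)))\<^sup>2) \<le> (cmod (f x))\<^sup>2" for n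
        by (auto intro!: AE_I2 power_mono)
    qed (use int in auto)
    then have "eventually (\<lambda>n. (LINT x|unit_measure. (cmod (f x - clip (Suc n) (f x)))\<^sup>2) < \<epsilon>) sequentially"
      using \<open>0 < \<epsilon>\<close> by (intro order_tendstoD) auto
    then obtain n where "(LINT x|unit_measure. (cmod (f x - clip (Suc n) (f x)))\<^sup>2) < \<epsilon>"
      by (auto simp: eventually_sequentially)
    then show "\<exists>g\<in>?V. (LINT x|unit_measure. (cmod (f x - g x))\<^sup>2) < \<epsilon>"
      using clipV[of "Suc n"] by (intro bexI[of _ "\<lambda>x. clip (Suc n) (f x)"]) auto
  qed
  have "\<exists>S a. finite S \<and> S \<subseteq> I \<and> L2_norm unit_measure (\<lambda>x. f x - (\<Sum>n\<in>S. a n * \<phi> n x)) < \<epsilon>"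
    if f: "f \<in> L2_space unit_measure" and "0 < \<epsilon>" for f \<epsilon>
  proof -
    have "0 < \<epsilon>\<^sup>2" using \<open>0 < \<epsilon>\<close> by simp
    then obtain S a where S: "finite S" "S \<subseteq> I" "(LINT x|unit_measure. (cmod (f x - (\<Sum>n\<in>S. a n * \<phi> n x)))\<^sup>2) < \<epsilon>\<^sup>2"
      using all[OF f] unfolding L2_closed_span_def by blast
    then have "L2_norm unit_measure (\<lambda>x. f x - (\<Sum>n\<in>S. a n * \<phi> n x)) < \<epsilon>"
      unfolding L2_norm_def using \<open>0 < \<epsilon>\<close> by (intro real_less_lsqrt) auto
    then show ?thesis using S by blast
  qed
  then show ?thesis by (simp add: complete_system_def)
qed

section \<open>Expansion of an exponential over the zeros\<close>

lemma contour_integral_rectpath_bound: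
  assumes ab: "Re a < Re b" "Im a < Im b"
    and cont: "continuous_on (path_image (rectpath a b)) f"
    and nonneg: "0 \<le> V" "0 \<le> U" "0 \<le> W"
    and V: "\<And>z. Re z \<in> {Re a, Re b} \<Longrightarrow> Im z \<in> {Im a..Im b} \<Longrightarrow> cmod (f z) \<le> V"
    and U: "\<And>z. Im z = Im b \<Longrightarrow> Re z \<in> {Re a..Re b} \<Longrightarrow> cmod (f z) \<le> U"
    and W: "\<And>z. Im z = Im a \<Longrightarrow> Re z \<in> {Re a..Re b} \<Longrightarrow> cmod (f z) \<le> W"
  shows "cmod (contour_integral (rectpath a b) f) \<le> 2 * V * (Im b - Im a) + (U + W) * (Re b - Re a)"
proof -
  let ?bottom = "linepath a (Complex (Re b) (Im a))"
  note three = contour_integral_rectpath_minus_bottom[OF ab cont nonneg(1,2) V U]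
  have "cmod (contour_integral ?bottom f) \<le> W * cmod (Complex (Re b) (Im a) - a)"
  proof (rule contour_integral_bound_linepath[OF three(1) nonneg(3)])
    fix z assume "z \<in> closed_segment a (Complex (Re b) (Im a))"
    then show "cmod (f z) \<le> W" using ab
      by (intro W) (auto simp: closed_segment_same_Im closed_segment_eq_real_ivl)
  qed
  moreover have "cmod (Complex (Re b) (Im a) - a) = Re b - Re a" using ab by (simp add: cmod_def)
  ultimately have "cmod (contour_integral ?bottom f) \<le> W * (Re b - Re a)" by simp
  then show ?thesis
    using three(2) norm_triangle_ineq[of "contour_integral (rectpath a b) f - contour_integral ?bottom f" "contour_integral ?bottom f"]
    by (simp add: algebra_simps)
qed

lemma integral_two_exponentials_le:
  fixes A B c :: real
  assumes "0 < c" "0 \<le> B"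
  shows "integral {0..1} (\<lambda>t. A + B * (exp (- c * t) + exp (- c * (1 - t)))) \<le> A + 2 * B / c"
proof -
  have "((\<lambda>t. A + B * (exp (- c * t) + exp (- c * (1 - t)))) has_integral
      ((A * 1 + B * (- exp (- c * 1) / c + exp (- c * (1 - 1)) / c)) - (A * 0 + B * (- exp (- c * 0) / c + exp (- c * (1 - 0)) / c)))) {0..1}"
  proof (rule fundamental_theorem_of_calculus)
    fix t :: real
    have "((\<lambda>t. A * t + B * (- exp (- c * t) / c + exp (- c * (1 - t)) / c)) has_real_derivative A + B * (exp (- c * t) + exp (- c * (1 - t)))) (at t within {0..1})"
      by (rule derivative_eq_intros refl | use assms in simp)+
    then show "((\<lambda>t. A * t + B * (- exp (- c * t) / c + exp (- c * (1 - t)) / c)) has_vector_derivative A + B * (exp (- c * t) + exp (- c * (1 - t)))) (at t within {0..1})"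
      by (simp add: has_real_derivative_iff_has_vector_derivative)
  qed simp
  then have "integral {0..1} (\<lambda>t. A + B * (exp (- c * t) + exp (- c * (1 - t)))) = A + 2 * B / c - 2 * B * exp (- c) / c"
    by (subst integral_unique) (auto simp: algebra_simps diff_divide_distrib add_divide_distrib)
  moreover have "0 \<le> 2 * B * exp (- c) / c" using assms by simp
  ultimately show ?thesis by linarith
qed

context sine_type begin

text \<open>
  At most one zero is closer than \<open>d/2\<close> to \<open>x0\<close>; the point \<open>d/2\<close> to its right avoids it and all others.
\<close>

lemma gap_in_zeros:
  obtains x where "x0 \<le> x" "x \<le> x0 + d" "\<And>\<mu>. \<mu> \<in> \<Lambda> \<Longrightarrow> d / 2 \<le> \<bar>\<mu> - x\<bar>"
proof (cases "\<exists>\<mu>\<in>\<Lambda>. \<bar>\<mu> - x0\<bar> < d / 2")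
  case False
  then show ?thesis using that[of x0] d_pos by force
next
  case True
  then obtain \<mu> where \<mu>: "\<mu> \<in> \<Lambda>" "\<bar>\<mu> - x0\<bar> < d / 2" by blast
  show ?thesis
  proof (rule that[of "\<mu> + d / 2"])
    fix \<nu> assume "\<nu> \<in> \<Lambda>"
    then have "\<nu> = \<mu> \<or> d \<le> \<bar>\<nu> - \<mu>\<bar>" using separatedD[OF separated] \<mu>(1) by blast
    then show "d / 2 \<le> \<bar>\<nu> - (\<mu> + d / 2)\<bar>" using d_pos by linarith
  qed (use \<mu>(2) d_pos in linarith)+
qed

text \<open>
  The error of the partial expansion is a contour integral over a rectangle through gaps of the
  zero set. On the rectangle \<open>|e\<^sub>z(t) / F(z)|\<close> is bounded by a multiple of \<open>exp(-2\<pi>Yt)\<close> on top and of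
  \<open>exp(-2\<pi>Y(1-t))\<close> at the bottom, which is small in mean square although not uniformly in \<open>t\<close>.
\<close>

lemma exponential_in_span:
  fixes w :: real
  shows "exponential w \<in> L2_closed_span unit_measure \<Lambda> exponential"
proof (cases "w \<in> \<Lambda>")
  case True
  have "\<exists>S a. finite S \<and> S \<subseteq> \<Lambda> \<and> (LINT x|unit_measure. (cmod (exponential w x - (\<Sum>\<mu>\<in>S. a \<mu> * exponential \<mu> x)))\<^sup>2) < \<epsilon>"
    if "0 < \<epsilon>" for \<epsilon>
    using True that by (intro exI[of _ "{w}"] exI[of _ "\<lambda>_. 1"]) auto
  then show ?thesis by (simp add: L2_closed_span_def L2_space_continuous continuous_exponential)
next
  case False
  define k where "k = exp (- 2 * pi * y / d) * sqrt m * exp (- 2 * pi * y)"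
  have k: "0 < k" using m_pos by (simp add: k_def)
  have Fw: "F (of_real w) \<noteq> 0" using False by (intro F_nonzero) auto
  define K where "K = cmod (F (of_real w)) / k"
  have K: "0 < K" using k Fw by (simp add: K_def)
  have lower: "k * exp (pi * (\<bar>Im z\<bar> - Im z)) \<le> cmod (F z)"
    if "y \<le> \<bar>Im z\<bar> \<or> (\<forall>\<mu>\<in>\<Lambda>. d / 2 \<le> \<bar>\<mu> - Re z\<bar>)" for z
  proof -
    have "exp (- 2 * pi * y) * (exp (- 2 * pi * y / d) * sqrt m * exp (pi * (\<bar>Im z\<bar> - Im z))) \<le> exp (- 2 * pi * y) * (exp (2 * pi * y) * cmod (F z))"
      using F_contour_lower[OF that] by (rule mult_left_mono) simp
    also have "\<dots> = cmod (F z)" by (simp add: mult.assoc[symmetric] exp_add[symmetric])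
    finally show ?thesis by (simp only: k_def mult_ac)
  qed
  define c where "c \<mu> = - F (of_real w) / (deriv F (of_real \<mu>) * (of_real \<mu> - of_real w))" for \<mu>
  define g where "g t z = F (of_real w) * exp (2 * of_real pi * \<i> * z * of_real t) / (F z * (z - of_real w))" for t :: real and z
  have g_le: "cmod (g t z) \<le> K * exp (- 2 * pi * t * Im z - pi * (\<bar>Im z\<bar> - Im z)) / r"
    if off: "y \<le> \<bar>Im z\<bar> \<or> (\<forall>\<mu>\<in>\<Lambda>. d / 2 \<le> \<bar>\<mu> - Re z\<bar>)" and r: "0 < r" "r \<le> cmod (z - of_real w)" for t z r
  proof -
    have "cmod (g t z) = cmod (F (of_real w)) * exp (- 2 * pi * t * Im z) / (cmod (F z) * cmod (z - of_real w))"
      by (simp add: g_def norm_mult norm_divide norm_exp_eq_Re mult_ac)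
    also have "\<dots> \<le> cmod (F (of_real w)) * exp (- 2 * pi * t * Im z) / (k * exp (pi * (\<bar>Im z\<bar> - Im z)) * r)"
    proof -
      have p: "0 < k * exp (pi * (\<bar>Im z\<bar> - Im z))" using k by simp
      have A: "k * exp (pi * (\<bar>Im z\<bar> - Im z)) * r \<le> cmod (F z) * cmod (z - of_real w)"
        using p r by (intro mult_mono lower[OF off]) auto
      have "0 < k * exp (pi * (\<bar>Im z\<bar> - Im z)) * r" using p r(1) by (rule mult_pos_pos)
      then show ?thesis using A by (intro divide_left_mono mult_nonneg_nonneg mult_pos_pos[where b = "_ * r"]) auto
    qed
    also have "\<dots> = K * exp (- 2 * pi * t * Im z - pi * (\<bar>Im z\<bar> - Im z)) / r"
      by (simp add: K_def exp_diff)
    finally show ?thesis .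
  qed
  \<comment> \<open>The rectangles have half-width about \<open>n\<^sup>4\<close> and half-height \<open>n\<^sup>3\<close>. Then \<open>\<alpha>\<close>, from the vertical sides, tends to 0, and \<open>\<beta>\<^sup>2 / n\<^sup>3\<close>, the mean square from the horizontal sides, does too.\<close>
  define \<alpha> where "\<alpha> n = 4 * real n ^ 3 / (real n ^ 4 - \<bar>w\<bar>)" for n
  define \<beta> where "\<beta> n = (2 * real n ^ 4 + 2 * d) / real n ^ 3" for n
  define E where "E n = (K / (2 * pi))\<^sup>2 * 3 * (\<alpha> n)\<^sup>2 + 2 * ((K / (2 * pi))\<^sup>2 * 3 * (\<beta> n)\<^sup>2) / (4 * pi * real n ^ 3)" for n
  have approx: "\<exists>S. finite S \<and> S \<subseteq> \<Lambda> \<and> (LINT t|unit_measure. (cmod (exponential w t - exp_sum c S t))\<^sup>2) \<le> E n"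
    if n: "1 \<le> n" "\<bar>w\<bar> < real n ^ 4" "y \<le> real n ^ 3" for n
  proof -
    define R where "R = real n ^ 4"
    define Y where "Y = real n ^ 3"
    have Y: "0 < Y" "y \<le> Y" and R: "\<bar>w\<bar> < R" using n by (auto simp: Y_def R_def)
    obtain x1 where x1: "- R - d \<le> x1" "x1 \<le> - R" "\<And>\<mu>. \<mu> \<in> \<Lambda> \<Longrightarrow> d / 2 \<le> \<bar>\<mu> - x1\<bar>"
      using gap_in_zeros[of "- R - d"] by auto
    obtain x2 where x2: "R \<le> x2" "x2 \<le> R + d" "\<And>\<mu>. \<mu> \<in> \<Lambda> \<Longrightarrow> d / 2 \<le> \<bar>\<mu> - x2\<bar>"
      using gap_in_zeros[of R] by auto
    have w: "x1 < w" "w < x2" "x1 < x2" using R x1(2) x2(1) by auto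
    define a where "a = Complex x1 (- Y)"
    define b where "b = Complex x2 Y"
    define S where "S = {\<mu>\<in>\<Lambda>. x1 < \<mu> \<and> \<mu> < x2}"
    have "S \<subseteq> T (R + d + 1)" using x1(1) x2(2) by (auto simp: S_def T_def)
    then have S: "finite S" "S \<subseteq> \<Lambda>" "w \<notin> S" using finite_T finite_subset False by (auto simp: S_def)
    define pts where "pts = insert (of_real w) (complex_of_real ` S)"
    \<comment> \<open>A convex neighbourhood of the rectangle, still narrow enough to contain no zeros outside it.\<close>
    define D where "D = {z. x1 - d / 4 < Re z} \<inter> {z. Re z < x2 + d / 4}"
    have D: "open D" "convex D"
      by (auto simp: D_def open_halfspace_Re_gt open_halfspace_Re_lt convex_halfspace_Re_gt convex_halfspace_Re_lt intro!: convex_Int)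
    have image: "path_image (rectpath a b) = {z. Re z \<in> {x1, x2} \<and> Im z \<in> {- Y..Y}} \<union> {z. Im z \<in> {- Y, Y} \<and> Re z \<in> {x1..x2}}"
      using w Y(1) by (subst path_image_rectpath) (auto simp: a_def b_def)
    have off: "y \<le> \<bar>Im z\<bar> \<or> (\<forall>\<mu>\<in>\<Lambda>. d / 2 \<le> \<bar>\<mu> - Re z\<bar>)" if "z \<in> path_image (rectpath a b)" for z
      using that Y x1(3) x2(3) unfolding image by auto
    have image_ne: "F z \<noteq> 0" "z \<noteq> of_real w" if "z \<in> path_image (rectpath a b)" for z
    proof -
      have "0 < k * exp (pi * (\<bar>Im z\<bar> - Im z))" using k by simp
      then show "F z \<noteq> 0" using lower[OF off[OF that]] by auto
      show "z \<noteq> of_real w" using that w Y(1) unfolding image by auto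
    qed
    have zeros_D: "z \<in> pts" if "z \<in> D" "F z * (z - of_real w) = 0" for z
    proof (cases "z = of_real w")
      case False
      then have "F z = 0" using that(2) by simp
      then obtain \<mu> where \<mu>: "\<mu> \<in> \<Lambda>" "z = of_real \<mu>" using F_nonzero by blast
      then have "x1 - d / 4 < \<mu>" "\<mu> < x2 + d / 4" using that(1) by (auto simp: D_def)
      then have "x1 < \<mu>" "\<mu> < x2" using x1(3)[OF \<mu>(1)] x2(3)[OF \<mu>(1)] d_pos by linarith+
      then show ?thesis using \<mu> by (auto simp: pts_def S_def)
    qed (simp add: pts_def)
    have error: "exponential w t - exp_sum c S t = contour_integral (rectpath a b) (g t) / (2 * of_real pi * \<i>)" for t
    proof -
      define G where "G z = F z * (z - of_real w)" for z
      define f where "f z = F (of_real w) * exp (2 * of_real pi * \<i> * z * of_real t)" for z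
      have holG: "G holomorphic_on A" for A unfolding G_def by (intro holomorphic_intros holomorphic_F)
      have holf: "f holomorphic_on A" for A unfolding f_def by (intro holomorphic_intros)
      have gfG: "g t = (\<lambda>z. f z / G z)" by (simp add: g_def f_def G_def fun_eq_iff)
      have derivG: "(G has_field_derivative deriv F z * (z - of_real w) + F z) (at z)" for z
        unfolding G_def using holomorphic_derivI[OF holomorphic_F[of UNIV] open_UNIV, of z]
        by (auto intro!: derivative_eq_intros)
      have res: "residue (g t) z = f z / (deriv F z * (z - of_real w) + F z)"
        if "G z = 0" "deriv F z * (z - of_real w) + F z \<noteq> 0" for z
        unfolding gfG
        by (rule residue_simple_pole_deriv[OF holf holG open_UNIV _ _ derivG]) (use that Fw in \<open>auto simp: f_def connected_UNIV\<close>)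
      have res_w: "residue (g t) (of_real w) = exponential w t"
        using Fw by (subst res) (auto simp: G_def f_def exponential_def)
      have res_\<mu>: "residue (g t) (of_real \<mu>) = - (c \<mu> * exponential \<mu> t)" if "\<mu> \<in> S" for \<mu>
      proof -
        have \<mu>: "\<mu> \<in> \<Lambda>" "\<mu> \<noteq> w" using that S by auto
        then show ?thesis
          using F_zero[OF \<mu>(1)] F_deriv_nonzero[OF \<mu>(1)]
          by (subst res) (auto simp: G_def f_def exponential_def c_def)
      qed
      have "contour_integral (rectpath a b) (g t) = 2 * pi * \<i> * (\<Sum>p\<in>pts. winding_number (rectpath a b) p * residue (g t) p)"
      proof (rule Residue_theorem[of D])
        show "connected D" using D(2) by (rule convex_connected)
        show "finite pts" using S by (simp add: pts_def)
        show "g t holomorphic_on D - pts"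
          unfolding gfG by (intro holomorphic_intros holf holG) (use zeros_D in \<open>auto simp: G_def\<close>)
        have "z \<notin> pts" if "z \<in> path_image (rectpath a b)" for z
          using image_ne[OF that] F_zero S(2) by (auto simp: pts_def)
        moreover have "z \<in> D" if "z \<in> path_image (rectpath a b)" for z
          using that w d_pos unfolding image by (auto simp: D_def)
        ultimately show "path_image (rectpath a b) \<subseteq> D - pts" by blast
        then have "path_image (rectpath a b) \<subseteq> D" by blast
        then show "\<forall>z. z \<notin> D \<longrightarrow> winding_number (rectpath a b) z = 0"
          by (intro allI impI winding_number_zero_outside[OF path_rectpath D(2)]) simp_all
      qed (use D in auto)
      also have "(\<Sum>p\<in>pts. winding_number (rectpath a b) p * residue (g t) p) = (\<Sum>p\<in>pts. residue (g t) p)"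
      proof (intro sum.cong refl)
        fix p assume "p \<in> pts"
        then have "p \<in> box a b" using w Y(1) by (auto simp: pts_def S_def in_box_complex_iff a_def b_def)
        then show "winding_number (rectpath a b) p * residue (g t) p = residue (g t) p"
          by (simp add: winding_number_rectpath)
      qed
      also have "\<dots> = residue (g t) (of_real w) + (\<Sum>\<mu>\<in>S. residue (g t) (of_real \<mu>))"
        using S by (simp add: pts_def sum.insert image_iff sum.reindex inj_on_def o_def)
      also have "\<dots> = exponential w t - exp_sum c S t"
        by (simp add: res_w res_\<mu> sum_negf)
      finally show ?thesis by simp
    qed
    have cont_g: "continuous_on (path_image (rectpath a b)) (g t)" for t
      unfolding g_def using image_ne
      by (intro continuous_intros holomorphic_on_imp_continuous_on holomorphic_F) auto
    have bound: "cmod (exponential w t - exp_sum c S t)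
        \<le> K / (2 * pi) * (\<alpha> n + \<beta> n * exp (- 2 * pi * Y * t) + \<beta> n * exp (- 2 * pi * Y * (1 - t)))"
      if t: "t \<in> {0..1}" for t
    proof -
      have im: "\<bar>Im z\<bar> \<le> cmod (z - of_real w)" for z using abs_Im_le_cmod[of "z - of_real w"] by simp
      have re: "\<bar>Re z - w\<bar> \<le> cmod (z - of_real w)" for z using abs_Re_le_cmod[of "z - of_real w"] by simp
      have "cmod (contour_integral (rectpath a b) (g t)) \<le> 2 * (K / (R - \<bar>w\<bar>)) * (Im b - Im a)
          + (K * exp (- 2 * pi * Y * t) / Y + K * exp (- 2 * pi * Y * (1 - t)) / Y) * (Re b - Re a)"
      proof (rule contour_integral_rectpath_bound[OF _ _ cont_g])
        fix z assume z: "Re z \<in> {Re a, Re b}" "Im z \<in> {Im a..Im b}"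
        then have zim: "z \<in> path_image (rectpath a b)" unfolding image by (auto simp: a_def b_def)
        have "R - \<bar>w\<bar> \<le> \<bar>Re z - w\<bar>" using z(1) x1(2) x2(1) w by (auto simp: a_def b_def)
        then have "R - \<bar>w\<bar> \<le> cmod (z - of_real w)" using re[of z] by linarith
        then have "cmod (g t z) \<le> K * exp (- 2 * pi * t * Im z - pi * (\<bar>Im z\<bar> - Im z)) / (R - \<bar>w\<bar>)"
          using R by (intro g_le off[OF zim]) auto
        also have "- 2 * pi * t * Im z - pi * (\<bar>Im z\<bar> - Im z) \<le> 0"
        proof (cases "0 \<le> Im z")
          case True then show ?thesis using t by simp
        next
          case False
          have "- 2 * pi * t * Im z - pi * (\<bar>Im z\<bar> - Im z) = (2 * pi * (1 - t)) * Im z" using False by (simp add: algebra_simps)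
          also have "\<dots> \<le> 0" using False t by (intro mult_nonneg_nonpos) auto
          finally show ?thesis .
        qed
        then have "K * exp (- 2 * pi * t * Im z - pi * (\<bar>Im z\<bar> - Im z)) / (R - \<bar>w\<bar>) \<le> K * 1 / (R - \<bar>w\<bar>)"
          using K R by (intro divide_right_mono mult_left_mono) auto
        finally show "cmod (g t z) \<le> K / (R - \<bar>w\<bar>)" by simp
      next
        fix z assume z: "Im z = Im b" "Re z \<in> {Re a..Re b}"
        then have zim: "z \<in> path_image (rectpath a b)" unfolding image by (auto simp: a_def b_def)
        have "cmod (g t z) \<le> K * exp (- 2 * pi * t * Im z - pi * (\<bar>Im z\<bar> - Im z)) / Y"
          using Y(1) z(1) im[of z] by (intro g_le off[OF zim]) (auto simp: b_def)
        then show "cmod (g t z) \<le> K * exp (- 2 * pi * Y * t) / Y"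
          using Y(1) z(1) by (simp add: b_def mult_ac)
      next
        fix z assume z: "Im z = Im a" "Re z \<in> {Re a..Re b}"
        then have zim: "z \<in> path_image (rectpath a b)" unfolding image by (auto simp: a_def b_def)
        have "cmod (g t z) \<le> K * exp (- 2 * pi * t * Im z - pi * (\<bar>Im z\<bar> - Im z)) / Y"
          using Y(1) z(1) im[of z] by (intro g_le off[OF zim]) (auto simp: a_def)
        also have "- 2 * pi * t * Im z - pi * (\<bar>Im z\<bar> - Im z) = - 2 * pi * Y * (1 - t)"
          using Y(1) z(1) by (simp add: a_def algebra_simps)
        finally show "cmod (g t z) \<le> K * exp (- 2 * pi * Y * (1 - t)) / Y" .
      qed (use w Y R K in \<open>auto simp: a_def b_def\<close>)
      also have "\<dots> \<le> 2 * (K / (R - \<bar>w\<bar>)) * (2 * Y)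
          + (K * exp (- 2 * pi * Y * t) / Y + K * exp (- 2 * pi * Y * (1 - t)) / Y) * (2 * R + 2 * d)"
        using x1(1) x2(2) K Y(1) R
        by (intro add_mono mult_left_mono) (auto simp: a_def b_def intro!: add_nonneg_nonneg divide_nonneg_nonneg)
      also have "\<dots> = K * (\<alpha> n + \<beta> n * exp (- 2 * pi * Y * t) + \<beta> n * exp (- 2 * pi * Y * (1 - t)))"
        unfolding \<alpha>_def \<beta>_def R_def[symmetric] Y_def[symmetric] using Y(1) by (simp add: field_simps)
      finally have "cmod (contour_integral (rectpath a b) (g t)) / (2 * pi) \<le> K * (\<alpha> n + \<beta> n * exp (- 2 * pi * Y * t) + \<beta> n * exp (- 2 * pi * Y * (1 - t))) / (2 * pi)"
        by (rule divide_right_mono) simp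
      then show ?thesis unfolding error by (simp add: norm_divide norm_mult)
    qed
    have contE: "continuous_on {0..1} (\<lambda>t. exponential w t - exp_sum c S t)"
      by (intro continuous_intros continuous_exponential)
    have "(LINT t|unit_measure. (cmod (exponential w t - exp_sum c S t))\<^sup>2)
        = integral {0..1} (\<lambda>t. (cmod (exponential w t - exp_sum c S t))\<^sup>2)"
      using L2_norm_square_continuous[OF contE] by (simp add: L2_norm_def)
    also have "\<dots> \<le> integral {0..1} (\<lambda>t. (K / (2 * pi))\<^sup>2 * 3 * (\<alpha> n)\<^sup>2
        + (K / (2 * pi))\<^sup>2 * 3 * (\<beta> n)\<^sup>2 * (exp (- (4 * pi * Y) * t) + exp (- (4 * pi * Y) * (1 - t))))"
    proof (rule integral_le)
      fix t :: real assume t: "t \<in> {0..1}"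
      define u v where "u = \<beta> n * exp (- 2 * pi * Y * t)" and "v = \<beta> n * exp (- 2 * pi * Y * (1 - t))"
      have "(cmod (exponential w t - exp_sum c S t))\<^sup>2 \<le> (K / (2 * pi) * (\<alpha> n + u + v))\<^sup>2"
        unfolding u_def v_def by (rule power_mono[OF bound[OF t]]) simp
      also have "\<dots> \<le> (K / (2 * pi))\<^sup>2 * (3 * ((\<alpha> n)\<^sup>2 + u\<^sup>2 + v\<^sup>2))"
      proof -
        have "(\<alpha> n + u + v)\<^sup>2 \<le> 3 * ((\<alpha> n)\<^sup>2 + u\<^sup>2 + v\<^sup>2)"
          using sum_squares_bound[of "\<alpha> n" u] sum_squares_bound[of u v] sum_squares_bound[of "\<alpha> n" v]
          by (simp add: power2_eq_square algebra_simps)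
        then show ?thesis unfolding power_mult_distrib by (intro mult_left_mono) auto
      qed
      also have "u\<^sup>2 = (\<beta> n)\<^sup>2 * exp (- (4 * pi * Y) * t)"
        unfolding u_def power_mult_distrib exp_double[symmetric] by simp
      also have "v\<^sup>2 = (\<beta> n)\<^sup>2 * exp (- (4 * pi * Y) * (1 - t))"
        unfolding v_def power_mult_distrib exp_double[symmetric] by simp
      finally show "(cmod (exponential w t - exp_sum c S t))\<^sup>2 \<le> (K / (2 * pi))\<^sup>2 * 3 * (\<alpha> n)\<^sup>2
        + (K / (2 * pi))\<^sup>2 * 3 * (\<beta> n)\<^sup>2 * (exp (- (4 * pi * Y) * t) + exp (- (4 * pi * Y) * (1 - t)))"
        by (simp only: distrib_left mult.assoc add.assoc)
    qed (intro integrable_continuous_real continuous_intros continuous_exponential)+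
    also have "\<dots> \<le> E n"
      unfolding E_def Y_def[symmetric] using Y(1) by (intro integral_two_exponentials_le) auto
    finally show ?thesis using S by blast
  qed
  have "\<exists>S a. finite S \<and> S \<subseteq> \<Lambda> \<and> (LINT x|unit_measure. (cmod (exponential w x - (\<Sum>\<mu>\<in>S. a \<mu> * exponential \<mu> x)))\<^sup>2) < \<epsilon>"
    if "0 < \<epsilon>" for \<epsilon>
  proof -
    have "(\<lambda>n. E n) \<longlonglongrightarrow> 0"
      unfolding E_def \<alpha>_def \<beta>_def by real_asymp
    then have "eventually (\<lambda>n. E n < \<epsilon>) sequentially" using that by (rule order_tendstoD)
    moreover have "filterlim (\<lambda>n. real n ^ 4) at_top sequentially" by real_asymp
    then have "eventually (\<lambda>n. \<bar>w\<bar> < real n ^ 4) sequentially" by (simp add: filterlim_at_top_dense)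
    moreover have "filterlim (\<lambda>n. real n ^ 3) at_top sequentially" by real_asymp
    then have "eventually (\<lambda>n. y \<le> real n ^ 3) sequentially" by (simp add: filterlim_at_top)
    ultimately have "eventually (\<lambda>n. E n < \<epsilon> \<and> \<bar>w\<bar> < real n ^ 4 \<and> y \<le> real n ^ 3 \<and> 1 \<le> n) sequentially"
      using eventually_ge_at_top[of 1] by eventually_elim auto
    then obtain n where "E n < \<epsilon>" "\<bar>w\<bar> < real n ^ 4" "y \<le> real n ^ 3" "1 \<le> n"
      by (auto simp: eventually_sequentially)
    then obtain S where "finite S" "S \<subseteq> \<Lambda>" "(LINT t|unit_measure. (cmod (exponential w t - exp_sum c S t))\<^sup>2) < \<epsilon>"
      using approx[of n] by fastforce
    then show ?thesis by blast
  qed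
  then show ?thesis by (simp add: L2_closed_span_def L2_space_continuous continuous_exponential)
qed

end

section \<open>Optimal constants and the Riesz basis property\<close>

text \<open>
  The greatest separation is the infimum of the distances; two points are needed for this set to be nonempty.
\<close>

lemma separation_constant_properties:
  assumes "separated d \<Lambda>" "0 < d" and two: "\<mu>\<^sub>0 \<in> \<Lambda>" "\<nu>\<^sub>0 \<in> \<Lambda>" "\<mu>\<^sub>0 \<noteq> \<nu>\<^sub>0"
  shows "0 < separation_constant \<Lambda>" "separated (separation_constant \<Lambda>) \<Lambda>"
proof -
  define D where "D = {\<bar>\<mu> - \<nu>\<bar> |\<mu> \<nu>. \<mu> \<in> \<Lambda> \<and> \<nu> \<in> \<Lambda> \<and> \<mu> \<noteq> \<nu>}"
  have D: "D \<noteq> {}" "\<And>x. x \<in> D \<Longrightarrow> d \<le> x" using two assms(1) by (auto simp: D_def separated_def)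
  then have bdd: "bdd_below D" by (meson bdd_belowI)
  have "d \<le> Inf D" using D by (intro cInf_greatest)
  then have pos: "0 < Inf D" using assms(2) by linarith
  have sep: "separated (Inf D) \<Lambda>"
    unfolding separated_def using bdd by (auto intro!: cInf_lower simp: D_def)
  have "separation_constant \<Lambda> = Inf D"
    unfolding separation_constant_def
  proof (rule Greatest_equality)
    show "0 < Inf D \<and> (\<forall>\<mu>\<in>\<Lambda>. \<forall>\<nu>\<in>\<Lambda>. \<mu> \<noteq> \<nu> \<longrightarrow> Inf D \<le> \<bar>\<mu> - \<nu>\<bar>)"
      using pos sep by (simp add: separated_def)
    show "e \<le> Inf D" if "0 < e \<and> (\<forall>\<mu>\<in>\<Lambda>. \<forall>\<nu>\<in>\<Lambda>. \<mu> \<noteq> \<nu> \<longrightarrow> e \<le> \<bar>\<mu> - \<nu>\<bar>)" for e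
      using D(1) that by (intro cInf_greatest) (auto simp: D_def)
  qed
  then show "0 < separation_constant \<Lambda>" "separated (separation_constant \<Lambda>) \<Lambda>"
    using pos sep by simp_all
qed

text \<open>
  The constants satisfying the inequality are bounded by the squared norm of a single element, and their
  supremum satisfies the inequality as well, so the greatest constant exists.
\<close>

lemma lower_riesz_bound_ge:
  assumes n: "n \<in> I" and A: "0 < A" "lower_riesz_inequality N I \<phi> A"
  shows "A \<le> lower_riesz_bound N I \<phi>"
proof -
  define Q where "Q = {A. 0 < A \<and> lower_riesz_inequality N I \<phi> A}"
  have ineq: "B * (\<Sum>n\<in>S. (cmod (a n))\<^sup>2) \<le> (L2_norm N (\<lambda>x. \<Sum>n\<in>S. a n * \<phi> n x))\<^sup>2"
    if "B \<in> Q" "finite S" "S \<subseteq> I" for B S a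
    using that by (auto simp: Q_def lower_riesz_inequality_def)
  have "B \<le> (L2_norm N (\<phi> n))\<^sup>2" if "B \<in> Q" for B
    using ineq[OF that, of "{n}" "\<lambda>_. 1"] n by simp
  then have bdd: "bdd_above Q" by (meson bdd_aboveI)
  have AQ: "A \<in> Q" using A by (simp add: Q_def)
  have le: "B \<le> Sup Q" if "B \<in> Q" for B using that bdd by (rule cSup_upper)
  have "Sup Q * (\<Sum>n\<in>S. (cmod (a n))\<^sup>2) \<le> (L2_norm N (\<lambda>x. \<Sum>n\<in>S. a n * \<phi> n x))\<^sup>2"
    if S: "finite S" "S \<subseteq> I" for S a
  proof (cases "(\<Sum>n\<in>S. (cmod (a n))\<^sup>2) = 0")
    case False
    then have pos: "0 < (\<Sum>n\<in>S. (cmod (a n))\<^sup>2)" by (simp add: sum_nonneg order_less_le)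
    have "Sup Q \<le> (L2_norm N (\<lambda>x. \<Sum>n\<in>S. a n * \<phi> n x))\<^sup>2 / (\<Sum>n\<in>S. (cmod (a n))\<^sup>2)"
      using AQ ineq[OF _ S] pos by (intro cSup_least) (auto simp: pos_le_divide_eq)
    then show ?thesis using pos by (simp add: pos_le_divide_eq)
  qed (simp only: mult_zero_right zero_le_power2)
  then have "0 < Sup Q \<and> lower_riesz_inequality N I \<phi> (Sup Q)"
    using A(1) le[OF AQ] by (auto simp: lower_riesz_inequality_def)
  then have "lower_riesz_bound N I \<phi> = Sup Q"
    unfolding lower_riesz_bound_def by (rule Greatest_equality) (use le in \<open>auto simp: Q_def\<close>)
  then show ?thesis using le[OF AQ] by simp
qed

context sine_type begin

text \<open>
  Without zeros \<open>|L|\<close> is constant, but it grows at least like \<open>exp(\<pi>t)\<close>.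
\<close>

lemma zeros_nonempty: "\<Lambda> \<noteq> {}"
proof
  assume "\<Lambda> = {}"
  then have "partial_zero_product \<Lambda> z = (\<lambda>R. 1)" for z by (simp add: partial_zero_product_def fun_eq_iff)
  then have L1: "L z = 1" for z using tendsto_L[of z] by (simp add: tendsto_const_iff)
  define \<eta> where "\<eta> = max y (1 / sqrt m)"
  have \<eta>: "y \<le> \<eta>" "1 / sqrt m \<le> \<eta>" "0 < \<eta>" using y_pos by (auto simp: \<eta>_def)
  have "1 / sqrt m < exp (pi * \<eta>)"
  proof -
    have "\<eta> < 1 + pi * \<eta>" using \<eta>(3) pi_gt3 by (simp add: add_pos_nonneg mult_le_cancel_right1 less_le_trans[of \<eta> "1 + \<eta>"])
    also have "\<dots> \<le> exp (pi * \<eta>)" by (rule exp_ge_add_one_self)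
    finally show ?thesis using \<eta>(2) by linarith
  qed
  then have "1 < exp (pi * \<eta>) * sqrt m" using m_pos by (simp add: divide_less_eq)
  moreover have "exp (pi * \<eta>) * sqrt m \<le> 1" using L_lower_bound[OF \<eta>(1), of 0] by (simp add: L1)
  ultimately show False by linarith
qed

text \<open>
  A set with at most one point has every separation, in particular 2, which exceeds the bound 1.
\<close>

lemma two_zeros: "\<exists>\<mu>\<in>\<Lambda>. \<exists>\<nu>\<in>\<Lambda>. \<mu> \<noteq> \<nu>"
proof (rule ccontr)
  assume "\<not> ?thesis"
  then have "separated 2 \<Lambda>" by (auto simp: separated_def)
  then interpret two: sine_type \<Lambda> 2 y m M
    using sine_type y_pos m_pos M_pos line by unfold_locales auto
  show False using two.separation_le_one[OF zeros_nonempty] by simp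
qed

lemma lower_riesz_inequality_exponentials:
  "lower_riesz_inequality unit_measure \<Lambda> exponential (1 / (7 * d) * (m / M) * exp (- 8 * pi * y / d))"
  unfolding lower_riesz_inequality_def
proof (intro allI impI)
  fix S and a :: "real \<Rightarrow> complex" assume S: "finite S" "S \<subseteq> \<Lambda>"
  define N where "N = (\<Sum>\<mu>\<in>S. (cmod (a \<mu>))\<^sup>2)"
  define J where "J = integral {0..1} (\<lambda>t. (cmod (exp_sum a S t))\<^sup>2)"
  define A where "A = 1 / (7 * d) * (m / M) * exp (- 8 * pi * y / d)"
  have A: "0 \<le> A" using d_pos m_pos M_pos by (simp add: A_def)
  have "A * N \<le> A * (7 * d * (M / m) * exp (8 * pi * y / d) * J)"
    using exponential_sum_lower_bound[OF S, of a] A unfolding N_def J_def by (rule mult_left_mono)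
  also have "\<dots> = J"
    using d_pos m_pos M_pos by (simp add: A_def exp_minus field_simps)
  also have "J = (L2_norm unit_measure (exp_sum a S))\<^sup>2"
    unfolding J_def by (intro L2_norm_square_continuous[symmetric] continuous_intros continuous_exponential)
  finally show "A * (\<Sum>\<mu>\<in>S. (cmod (a \<mu>))\<^sup>2) \<le> (L2_norm unit_measure (exp_sum a S))\<^sup>2"
    by (simp add: N_def)
qed

lemma upper_riesz_inequality_exponentials:
  "upper_riesz_inequality unit_measure \<Lambda> exponential (exp (4 * pi) * (1 + 16 / d\<^sup>2) / (2 * pi))"
  unfolding upper_riesz_inequality_def
proof (intro allI impI)
  fix S and a :: "real \<Rightarrow> complex" assume S: "finite S" "S \<subseteq> \<Lambda>"
  have "(L2_norm unit_measure (exp_sum a S))\<^sup>2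
      = integral {0..1} (\<lambda>t. (cmod (exp_sum a S t))\<^sup>2)"
    by (intro L2_norm_square_continuous continuous_intros continuous_exponential)
  also have "\<dots> \<le> exp (4 * pi) * (1 + 16 / d\<^sup>2) / (2 * pi) * (\<Sum>\<mu>\<in>S. (cmod (a \<mu>))\<^sup>2)"
    by (rule exponential_sum_upper_bound[OF S(1) d_pos separated_subset[OF separated S(2)]])
  finally show "(L2_norm unit_measure (exp_sum a S))\<^sup>2
      \<le> exp (4 * pi) * (1 + 16 / d\<^sup>2) / (2 * pi) * (\<Sum>\<mu>\<in>S. (cmod (a \<mu>))\<^sup>2)" .
qed

lemma riesz_basis_exponentials: "riesz_basis unit_measure \<Lambda> exponential"
  unfolding riesz_basis_def
proof (intro conjI ballI exI)
  show "exponential \<mu> \<in> L2_space unit_measure" for \<mu>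
    by (intro L2_space_continuous continuous_exponential)
  then show "complete_system unit_measure \<Lambda> exponential"
    by (intro complete_if_spans_exponentials exponential_in_span)
  show "0 < 1 / (7 * d) * (m / M) * exp (- 8 * pi * y / d)" using d_pos m_pos M_pos by simp
  show "0 < exp (4 * pi) * (1 + 16 / d\<^sup>2) / (2 * pi)"
    by (intro divide_pos_pos mult_pos_pos add_pos_nonneg) auto
qed (rule lower_riesz_inequality_exponentials upper_riesz_inequality_exponentials)+

end

theorem corollary4p4:
  fixes \<Lambda> :: "real set"
  assumes "uniform_discrete \<Lambda>"
    and "sine_type_zero_set \<Lambda>"
  shows "riesz_basis (lebesgue_on {0..1}) \<Lambda> exponential \<and>
    (\<forall>y m M :: real. 0 < y \<longrightarrow> 0 < m \<longrightarrow> 0 < M \<longrightarrow> bounded_on_line (sine_fun \<Lambda>) y m M \<longrightarrow>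
       lower_riesz_bound (lebesgue_on {0..1}) \<Lambda> exponential
         \<ge> 1 / (7 * separation_constant \<Lambda>) * (m / M) * exp (- 8 * pi * y / separation_constant \<Lambda>))"
proof -
  obtain d where d: "0 < d" "separated d \<Lambda>"
    using assms(1) by (auto simp: uniform_discrete_def separated_def dist_real_def not_less[symmetric])
  obtain y m M where "0 < y" "0 < m" "0 < M" "bounded_on_line (sine_fun \<Lambda>) y m M"
    using assms(2) by (auto simp: sine_type_zero_set_def)
  then interpret sine_type \<Lambda> d y m M
    using assms(2) d by unfold_locales
  obtain \<mu>\<^sub>0 \<nu>\<^sub>0 where two: "\<mu>\<^sub>0 \<in> \<Lambda>" "\<nu>\<^sub>0 \<in> \<Lambda>" "\<mu>\<^sub>0 \<noteq> \<nu>\<^sub>0" using two_zeros by blast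
  define \<delta> where "\<delta> = separation_constant \<Lambda>"
  have \<delta>: "0 < \<delta>" "separated \<delta> \<Lambda>"
    unfolding \<delta>_def using separation_constant_properties[OF d(2,1) two] by auto
  have "1 / (7 * \<delta>) * (m / M) * exp (- 8 * pi * y / \<delta>) \<le> lower_riesz_bound (lebesgue_on {0..1}) \<Lambda> exponential"
    if line: "0 < y" "0 < m" "0 < M" "bounded_on_line (sine_fun \<Lambda>) y m M" for y m M
  proof -
    interpret line: sine_type \<Lambda> \<delta> y m M
      using assms(2) \<delta> line by unfold_locales
    show ?thesis
      using \<delta>(1) line by (intro lower_riesz_bound_ge[OF two(1)] line.lower_riesz_inequality_exponentials) simp
  qed
  then show ?thesis using riesz_basis_exponentials by (simp add: \<delta>_def)
qed

end
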